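(* Let $p$ be a prime, $q$ a power of $p$, $n\ge 1$, $V$ an $n$-dimensional $\mathbb{F}_q$-vector space, and $k\ge 1$. Put $d:=\frac{k(q^n-1)}{q-1}-n$. (1) The quotient $\mathcal{R}(V^*,k)$ is zero in every degree greater than $d$, and in degree $d$ it is isomorphic, as a $\mathrm{GL}_n(\mathbb{F}_q)$-module, to the twisted Steinberg module $\mathrm{St}_n\otimes \mathrm{Det}^{k-1}$. (2) Suppose moreover $k=q^a r$ with integers $a\ge 0$ and $1\le r\le q-1$. Then: (a) for each $0\le i\le d$, the natural projection $\mathrm{Sym}^*(V^* )\twoheadrightarrow \mathcal{R}(V^*,k)$ induces an isomorphism of $\mathrm{GL}_n(\mathbb{F}_q)$-modules $Q^i(\mathrm{Sym}^*(V^* ))\cong Q^i(\mathcal{R}(V^*,k))$; (b) the top-degree part $\mathcal{R}^{d}(V^*,k)$ is $\mathcal{P}$-indecomposable, i.e. $\mathcal{R}^d(V^*,k)\cap \mathcal{P}^+\mathcal{R}(V^*,k)=0$.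
   Context: $\mathrm{Sym}^*(V^* )$ is the symmetric algebra on the dual $V^*$, identified with $\mathbb{F}_q[x_1,\dots,x_n]$ for a basis $x_1,\dots,x_n$ of $V^*$, each $x_i$ of degree $1$. $\mathrm{GL}_n=\mathrm{GL}_n(\mathbb{F}_q)$ acts by linear substitution of variables. The Steenrod algebra $\mathcal{P}$ over $\mathbb{F}_q$ is generated by reduced power operations $\mathcal{P}^i$ ($i\ge0$, $\mathcal{P}^0=1$) acting on $\mathrm{Sym}^*(V^* )$ by $\mathcal{P}^j(x^m)=\binom{m}{j}x^{m+(q-1)j}$ for linear forms $x$ and the Cartan formula $\mathcal{P}^j(fg)=\sum_{i+l=j}\mathcal{P}^i(f)\mathcal{P}^l(g)$; this action commutes with $\mathrm{GL}_n$. For a $\mathcal{P}$-module $M$, $Q(M):=M/\mathcal{P}^+M$ where $\mathcal{P}^+$ is the augmentation ideal (spanned by $\mathcal{P}$-monomials of positive degree); $Q^i$ denotes its degree-$i$ part. For each line $\ell$ in $V^*$ fix a nonzero $u_\ell\in\ell$. For a hyperplane $H\subset V^*$ let $V_{H,V^*}:=\prod_{\ell\not\subset H}u_\ell$ (product over lines of $V^*$ not contained in $H$). $I(V^*,k)$ is the ideal of $\mathrm{Sym}^*(V^* )$ generated by all $V_{H,V^*}^k$, $H$ a hyperplane, and $\mathcal{R}(V^*,k):=\mathrm{Sym}^*(V^* )/I(V^*,k)$, a graded $\mathcal{P}$-module and $\mathrm{GL}_n$-module. Let $B_n$, $U_n$, $\Sigma_n$ be the upper triangular, upper unitriangular and permutation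 matrix subgroups. The Steinberg idempotent is $\mathrm{st}_n=\frac{1}{[\mathrm{GL}_n:U_n]}\sum_{b\in B_n,\sigma\in\Sigma_n}\mathrm{sgn}(\sigma)b\sigma\in\mathbb{F}_q[\mathrm{GL}_n]$ and the Steinberg module is $\mathrm{St}_n=\mathrm{st}_n\cdot\mathbb{F}_q[\mathrm{GL}_n]$ (dimension $q^{n(n-1)/2}$). $\mathrm{Det}^i$ is the one-dimensional representation $g\mapsto\det(g)^i$. *)

theory Defs
  imports "HOL-Analysis.Analysis" "HOL-Library.Poly_Mapping"
begin

type_synonym ('k, 'n) sympoly = "('n \<Rightarrow>\<^sub>0 nat) \<Rightarrow>\<^sub>0 'k"

definition Xv :: "'n \<Rightarrow> ('k::comm_ring_1, 'n) sympoly" where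
  "Xv i = Poly_Mapping.single (Poly_Mapping.single i 1) 1"

definition pconst :: "'k::comm_ring_1 \<Rightarrow> ('k, 'n) sympoly" where
  "pconst c = Poly_Mapping.single 0 c"

definition mdeg :: "('n::finite \<Rightarrow>\<^sub>0 nat) \<Rightarrow> nat" where
  "mdeg m = (\<Sum>i\<in>UNIV. Poly_Mapping.lookup m i)"

text \<open>f is homogeneous of degree N (the zero polynomial is homogeneous of every degree).\<close>
definition homog :: "nat \<Rightarrow> ('k::comm_ring_1, 'n::finite) sympoly \<Rightarrow> bool" where
  "homog N f \<longleftrightarrow> (\<forall>m\<in>Poly_Mapping.keys f. mdeg m = N)"

definition Hom :: "nat \<Rightarrow> ('k::comm_ring_1, 'n::finite) sympoly set" where
  "Hom N = {f. homog N f}"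

definition linform :: "'k::comm_ring_1 ^ 'n::finite \<Rightarrow> ('k, 'n) sympoly" where
  "linform v = (\<Sum>i\<in>UNIV. pconst (v $ i) * Xv i)"

definition GLn :: "('k::field ^ 'n::finite ^ 'n) set" where
  "GLn = {g. invertible g}"

text \<open>f . g : substitute x_i := sum_j g_ij x_j.  This is a right action: (f.g).h = f.(g h).\<close>
definition gl_act :: "('k::field, 'n::finite) sympoly \<Rightarrow> 'k ^ 'n ^ 'n \<Rightarrow> ('k, 'n) sympoly" where
  "gl_act f g = (\<Sum>m\<in>Poly_Mapping.keys f. pconst (Poly_Mapping.lookup f m) * (\<Prod>i\<in>UNIV. linform (g $ i) ^ Poly_Mapping.lookup m i))"

definition Borel where
  "Borel = {g :: (('k::field, 'n::{finite,linorder}) vec, 'n) vec. g \<in> GLn \<and> (\<forall>i j. j < i \<longrightarrow> g $ i $ j = 0)}"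

definition Unip :: "(('k::field, 'n::{finite,linorder}) vec, 'n) vec set" where
  "Unip = {g\<in>Borel. \<forall>i. g $ i $ i = 1}"

definition perm_mat :: "('n::finite \<Rightarrow> 'n) \<Rightarrow> 'k::field ^ 'n ^ 'n" where
  "perm_mat \<pi> = (\<chi> i j. if \<pi> i = j then 1 else 0)"

text \<open>Elements of k[GL_n] are functions on matrices supported on GL_n.\<close>
definition galg :: "('k::field ^ 'n::finite ^ 'n \<Rightarrow> 'k) set" where
  "galg = {a. \<forall>x. a x \<noteq> 0 \<longrightarrow> x \<in> GLn}"

definition gconv :: "('k::field ^ 'n::finite ^ 'n \<Rightarrow> 'k) \<Rightarrow> ('k ^ 'n ^ 'n \<Rightarrow> 'k)
    \<Rightarrow> ('k ^ 'n ^ 'n \<Rightarrow> 'k)" where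
  "gconv a b = (\<lambda>x. \<Sum>h\<in>GLn. a h * b (matrix_inv h ** x))"

text \<open>Right action of g on k[GL_n]: a . g = a * delta_g.\<close>
definition ract :: "('k::field ^ 'n::finite ^ 'n \<Rightarrow> 'k) \<Rightarrow> 'k ^ 'n ^ 'n \<Rightarrow> ('k ^ 'n ^ 'n \<Rightarrow> 'k)" where
  "ract a g = (\<lambda>x. a (x ** matrix_inv g))"

definition stein_idem :: "(('k::{field,finite}, 'n::{finite,linorder}) vec, 'n) vec \<Rightarrow> 'k" where
  "stein_idem = (\<lambda>x. inverse (of_nat (card (GLn :: (('k, 'n) vec, 'n) vec set) div card (Unip :: (('k, 'n) vec, 'n) vec set)))
      * (\<Sum>\<pi>\<in>{\<pi>. \<pi> permutes (UNIV :: 'n set)}. \<Sum>b\<in>Borel.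
            if b ** perm_mat \<pi> = x then of_int (sign \<pi>) else 0))"

definition Steinberg :: "((('k::{field,finite}, 'n::{finite,linorder}) vec, 'n) vec \<Rightarrow> 'k) set" where
  "Steinberg = {gconv stein_idem a | a. a \<in> galg}"

definition lines :: "('k::field ^ 'n::finite) set set" where
  "lines = {L. vec.subspace L \<and> vec.dim L = 1}"

definition hyperplanes :: "('k::field ^ 'n::finite) set set" where
  "hyperplanes = {H. vec.subspace H \<and> vec.dim H = CARD('n) - 1}"

definition line_rep :: "('k::field ^ 'n::finite) set \<Rightarrow> 'k ^ 'n" where
  "line_rep L = (SOME v. v \<in> L \<and> v \<noteq> 0)"

definition VH :: "('k::field ^ 'n::finite) set \<Rightarrow> ('k, 'n) sympoly" where
  "VH H = (\<Prod>L\<in>{L\<in>lines. \<not> L \<subseteq> H}. linform (line_rep L))"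

definition Iid :: "nat \<Rightarrow> ('k::{field,finite}, 'n::finite) sympoly set" where
  "Iid k = {f. \<exists>c. f = (\<Sum>H\<in>hyperplanes. c H * VH H ^ k)}"

text \<open>P^j, determined by P^j(x^m) = binom(m,j) x^(m+(q-1)j), the Cartan formula and linearity.\<close>
definition steen :: "nat \<Rightarrow> ('k::{field,finite}, 'n::finite) sympoly \<Rightarrow> ('k, 'n) sympoly" where
  "steen j f = (\<Sum>m\<in>Poly_Mapping.keys f. pconst (Poly_Mapping.lookup f m) *
      (\<Sum>J\<in>{J :: 'n \<Rightarrow> nat. (\<Sum>i\<in>UNIV. J i) = j}.
          \<Prod>i\<in>UNIV. pconst (of_nat (Poly_Mapping.lookup m i choose J i))
                     * Xv i ^ (Poly_Mapping.lookup m i + (CARD('k) - 1) * J i)))"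

definition Pplus :: "('k::{field,finite}, 'n::finite) sympoly set" where
  "Pplus = {f. \<exists>J F. finite J \<and> (\<forall>j\<in>J. 0 < j) \<and> f = (\<Sum>j\<in>J. steen j (F j))}"

definition setplus :: "'a::plus set \<Rightarrow> 'a set \<Rightarrow> 'a set" where
  "setplus A B = {a + b | a b. a \<in> A \<and> b \<in> B}"

definition coset :: "'a::plus \<Rightarrow> 'a set \<Rightarrow> 'a set" where
  "coset f A = {f + a | a. a \<in> A}"

definition QSym :: "nat \<Rightarrow> ('k::{field,finite}, 'n::finite) sympoly set set" where
  "QSym i = (\<lambda>f. coset f (Pplus \<inter> Hom i)) ` Hom i"

text \<open>Q^i(R) = R^i / (P^+ R)^i with R = Sym/I, realised as Sym^i / ((P^+ Sym + I) \<inter> Sym^i).\<close>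
definition QR :: "nat \<Rightarrow> nat \<Rightarrow> ('k::{field,finite}, 'n::finite) sympoly set set" where
  "QR k i = (\<lambda>f. coset f (setplus Pplus (Iid k) \<inter> Hom i)) ` Hom i"

end

theory Submission
  imports Defs "HOL-Computational_Algebra.Primes" "HOL-Computational_Algebra.Factorial_Ring"
    "HOL-Computational_Algebra.Polynomial" "HOL-Computational_Algebra.Formal_Power_Series"
begin

text \<open>Write \<open>q\<close> for the order of the field, call a vector monic if its first nonzero entry is \<open>1\<close>, and
  let \<open>\<Lambda>\<close> be the product of the linear forms of all monic vectors. Up to a scalar \<open>V\<^sub>H\<close> is the part
  of \<open>\<Lambda>\<close> off \<open>H\<close>, so \<open>I(V\<^sup>*, k)\<close> is generated by the cocircuit products of the multiset of \<open>k\<close> copies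
  of each monic vector. Deletion and contraction show that this ideal contains all forms of degree
  above \<open>d\<close>, and that modulo it \<open>Sym\<^sup>d\<close> is spanned by the quotients of \<open>\<Lambda>\<^sup>k\<close> by the products of the rows
  of invertible matrices \<open>g\<close>. If two rows of \<open>g\<close> have the same leading index, a linear relation
  between three such quotients lowers the leading indices; so the unitriangular translates of a single
  form \<open>E\<close> suffice.

  For independence choose \<open>L = q\<^sup>a r \<ge> k\<close> with \<open>1 \<le> r \<le> q - 1\<close> and let \<open>\<phi>(f)\<close> be the coefficient of
  \<open>\<Prod> x\<^sub>i\<^bsup>T\<^sub>i - 1\<^esup>\<close> in \<open>f \<Lambda>\<^bsup>L - k\<^esup>\<close>, where \<open>T\<^sub>i = L q\<^bsup>pos i\<^esup>\<close>. The Frobenius recursion for the product \<open>V\<^sub>i\<close>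
  of the monic forms with leading index \<open>i\<close> puts \<open>V\<^sub>i\<^sup>L\<close> into the monomial ideal of the \<open>x\<^sub>j\<^bsup>T\<^sub>j\<^esup>\<close>, so \<open>\<phi>\<close>
  vanishes on \<open>I(V\<^sup>*, k)\<close>. On a quotient of \<open>\<Lambda>\<^sup>k\<close> by the rows of \<open>g\<close>, lexicographic leading monomials
  show that \<open>\<phi>\<close> is nonzero exactly if \<open>g\<close> is a permutation matrix times an upper triangular matrix.
  As \<open>\<Lambda>\<close> transforms by the determinant, \<open>f \<mapsto> (x \<mapsto> det x\<^bsup>k - 1\<^esup> \<phi>(f . x\<^bsup>-1\<^esup>))\<close> sends \<open>E\<close> to a multiple of
  the Steinberg idempotent.

  Now let \<open>k = q\<^sup>a r\<close> and \<open>L = k\<close>. By Lucas' theorem \<open>\<phi>\<close> kills every \<open>P\<^sup>j f\<close> with \<open>j > 0\<close>, which gives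
  indecomposability. For the isomorphism it suffices that \<open>h V\<^sub>H\<^sup>k\<close> is hit for \<open>h\<close> of small degree. The conjugate operations
  \<open>\<chi>(P\<^sup>C)\<close> satisfy: \<open>h \<chi>(P\<^sup>C) G\<close> is hit if \<open>deg h < C\<close>. Take for \<open>G\<close> the form
  \<open>z\<^sup>k \<Prod> (z\<^bsup>q - 1\<^esup> - x\<^sub>i\<^bsup>q - 1\<^esup>)\<close> and \<open>C\<close> such that \<open>f = \<chi>(P\<^sup>C) G\<close> has degree \<open>k q\<^bsup>n - 1\<^esup>\<close>. At rational points
  \<open>f\<close> is a nonzero multiple of \<open>G\<close>, so it is supported on one line. Since \<open>\<phi>\<close> kills hit elements, every
  monomial of every translate of \<open>f\<close> is divisible by some \<open>x\<^sub>i\<^bsup>T\<^sub>i\<^esup>\<close>. If \<open>u\<^sup>k\<close> did not divide \<open>f\<close> for some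
  \<open>u\<close> off the hyperplane \<open>z = 0\<close>, a greedy choice of coordinates starting with \<open>u\<close> would produce a
  translate containing the pure power of the last variable, that is, a rational point with \<open>f \<noteq> 0\<close> and
  \<open>u = 0\<close>. Hence \<open>f\<close> is a nonzero multiple of \<open>V\<^sub>H\<^sup>k\<close>.\<close>

section \<open>Polynomials and substitution\<close>

abbreviation lookup where "lookup \<equiv> Poly_Mapping.lookup"
abbreviation keys where "keys \<equiv> Poly_Mapping.keys"
abbreviation single where "single \<equiv> Poly_Mapping.single"

lemma sum_singles: "(\<Sum>m\<in>keys f. single m (lookup f m)) = f"
proof (rule poly_mapping_eqI)
  fix l
  have "lookup (\<Sum>m\<in>keys f. single m (lookup f m)) l = (\<Sum>m\<in>keys f. if m = l then lookup f m else 0)"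
    by (simp add: lookup_sum lookup_single when_def)
  also have "\<dots> = lookup f l"
    by (simp add: sum.delta in_keys_iff)
  finally show "lookup (\<Sum>m\<in>keys f. single m (lookup f m)) l = lookup f l" .
qed

lemma poly_mapping_induct [case_names single add]:
  fixes P :: "('a \<Rightarrow>\<^sub>0 'b::comm_monoid_add) \<Rightarrow> bool"
  assumes s: "\<And>m c. P (single m c)" and a: "\<And>f g. P f \<Longrightarrow> P g \<Longrightarrow> P (f + g)"
  shows "P f"
proof -
  have "P (\<Sum>m\<in>A. single m (lookup f m))" if "finite A" for A
    using that
  proof (induction A rule: finite_induct)
    case empty
    show ?case using s[of undefined 0] by simp
  next
    case (insert x A)
    then show ?case by (simp add: a s)
  qed
  from this[of "keys f"] show ?thesis by (simp add: sum_singles)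
qed

lemma lookup_single_times:
  fixes f :: "('a::cancel_comm_monoid_add) \<Rightarrow>\<^sub>0 ('b::comm_semiring_1)"
  shows "lookup (single m c * f) (m + l) = c * lookup f l"
  by (induction f rule: poly_mapping_induct)
    (auto simp: mult_single lookup_single when_def lookup_add distrib_left)

lemma lookup_pconst_times [simp]: "lookup (pconst c * f) l = c * lookup f l"
  using lookup_single_times[of 0 c f l] by (simp add: pconst_def)

lemma pconst_0 [simp]: "pconst 0 = 0" and pconst_1 [simp]: "pconst 1 = 1"
  by (simp_all add: pconst_def)

lemma pconst_add: "pconst (a + b) = pconst a + pconst b"
  by (simp add: pconst_def single_add)

lemma pconst_uminus: "pconst (- a) = - pconst a"
  by (simp add: pconst_def single_uminus)

lemma pconst_diff: "pconst (a - b) = pconst a - pconst b"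
  by (simp add: pconst_def single_diff)

lemma pconst_mult: "pconst (a * b) = pconst a * pconst b"
  by (simp add: pconst_def mult_single)

lemma pconst_power: "pconst (a ^ m) = pconst a ^ m"
  by (induction m) (simp_all add: pconst_mult)

lemma pconst_sum: "pconst (sum f A) = (\<Sum>x\<in>A. pconst (f x))"
  by (induction A rule: infinite_finite_induct) (simp_all add: pconst_add)

lemma pconst_prod: "pconst (prod f A) = (\<Prod>x\<in>A. pconst (f x))"
  by (induction A rule: infinite_finite_induct) (simp_all add: pconst_mult)

lemma pconst_of_nat: "pconst (of_nat m) = of_nat m"
  by (induction m) (simp_all add: pconst_add)

lemma pconst_eq_iff [simp]: "pconst a = pconst b \<longleftrightarrow> a = b"
  by (metis lookup_single_eq pconst_def)

lemma pconst_eq_0_iff [simp]: "pconst a = 0 \<longleftrightarrow> a = 0"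
  by (metis pconst_0 pconst_eq_iff)

lemma single_times_power: "single m (1::'b::comm_semiring_1) ^ e = single (\<Sum>_\<in>{..<e}. m) 1"
  by (induction e) (simp_all add: mult_single add.commute)

lemma sum_const_mono: "(\<Sum>_\<in>{..<e}. single i (Suc 0)) = single i e"
  by (induction e) (simp_all add: single_add[symmetric])

lemma Xv_power: "Xv i ^ e = single (single i e) 1"
  by (simp add: Xv_def single_times_power sum_const_mono)

lemma prod_single_1: "(\<Prod>i\<in>A. single (h i) (1::'b::comm_semiring_1)) = single (\<Sum>i\<in>A. h i) 1"
  by (induction A rule: infinite_finite_induct) (simp_all add: mult_single)

lemma sum_single_monomial: "(\<Sum>i\<in>UNIV. single (i::'n::finite) (lookup m i)) = m"
  by (rule poly_mapping_eqI) (simp add: lookup_sum lookup_single when_def)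

lemma single_eq_prod: "single m c = pconst c * (\<Prod>i\<in>(UNIV::'n::finite set). Xv i ^ lookup m i)"
  by (simp add: Xv_power prod_single_1 sum_single_monomial pconst_def mult_single)

section \<open>Ring homomorphisms and the universal property of the polynomial ring\<close>

definition ring_hm :: "('a::comm_ring_1 \<Rightarrow> 'b::comm_ring_1) \<Rightarrow> bool" where
  "ring_hm h \<longleftrightarrow> h 1 = 1 \<and> (\<forall>a b. h (a + b) = h a + h b) \<and> (\<forall>a b. h (a * b) = h a * h b)"

lemma ring_hmD:
  assumes "ring_hm h"
  shows "h 1 = 1" "h (a + b) = h a + h b" "h (a * b) = h a * h b" "h 0 = 0"
    "h (- a) = - h a" "h (a - b) = h a - h b" "h (a ^ m) = h a ^ m"
    "h (sum f A) = (\<Sum>x\<in>A. h (f x))" "h (prod f A) = (\<Prod>x\<in>A. h (f x))"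
proof -
  show [simp]: "h 1 = 1" and add: "\<And>a b. h (a + b) = h a + h b" and mult: "\<And>a b. h (a * b) = h a * h b"
    using assms by (auto simp: ring_hm_def)
  show zero [simp]: "h 0 = 0" using add[of 0 0] by simp
  show um: "h (- a) = - h a" for a using add[of a "- a"] by (simp add: add_eq_0_iff)
  show "h (a - b) = h a - h b" using add[of a "- b"] um[of b] by simp
  show "h (a ^ m) = h a ^ m" by (induction m) (simp_all add: mult)
  show "h (sum f A) = (\<Sum>x\<in>A. h (f x))"
    by (induction A rule: infinite_finite_induct) (simp_all add: add)
  show "h (prod f A) = (\<Prod>x\<in>A. h (f x))"
    by (induction A rule: infinite_finite_induct) (simp_all add: mult)
qed

lemma ring_hm_comp: "ring_hm g \<Longrightarrow> ring_hm h \<Longrightarrow> ring_hm (\<lambda>x. g (h x))"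
  by (simp add: ring_hm_def)

lemma ring_hm_pconst: "ring_hm pconst"
  by (simp add: ring_hm_def pconst_add pconst_mult)

lemma ring_hm_id: "ring_hm (\<lambda>x. x)"
  by (simp add: ring_hm_def)

text \<open>The homomorphism of the universal property: \<open>c\<close> acts on coefficients,
  \<open>\<sigma>\<close> gives the images of the variables. Substitution, setting a variable to
  zero, evaluation at a point and the total Steenrod operation are instances.\<close>

definition peval :: "('k::comm_ring_1 \<Rightarrow> 'a::comm_ring_1) \<Rightarrow> ('n::finite \<Rightarrow> 'a) \<Rightarrow> ('k, 'n) sympoly \<Rightarrow> 'a" where
  "peval c \<sigma> f = (\<Sum>m\<in>keys f. c (lookup f m) * (\<Prod>i\<in>UNIV. \<sigma> i ^ lookup m i))"

context
  fixes c :: "'k::comm_ring_1 \<Rightarrow> 'a::comm_ring_1"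
  assumes c: "ring_hm c"
begin

lemma peval_superset:
  assumes "finite A" "keys f \<subseteq> A"
  shows "peval c \<sigma> f = (\<Sum>m\<in>A. c (lookup f m) * (\<Prod>i\<in>UNIV. \<sigma> i ^ lookup m i))"
  unfolding peval_def using assms
  by (intro sum.mono_neutral_left) (auto simp: in_keys_iff ring_hmD[OF c])

lemma peval_add: "peval c \<sigma> (f + g) = peval c \<sigma> f + peval c \<sigma> g"
proof -
  let ?A = "keys f \<union> keys g"
  have "keys (f + g) \<subseteq> ?A" by (rule keys_add)
  then show ?thesis
    by (simp add: peval_superset[of ?A] lookup_add ring_hmD[OF c] distrib_right sum.distrib)
qed

lemma peval_single: "peval c \<sigma> (single m a) = c a * (\<Prod>i\<in>UNIV. \<sigma> i ^ lookup m i)"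
  by (simp add: peval_superset[of "{m}"])

lemma peval_mult: "peval c \<sigma> (f * g) = peval c \<sigma> f * peval c \<sigma> g"
proof (induction f rule: poly_mapping_induct)
  case (single m a)
  show ?case
  proof (induction g rule: poly_mapping_induct)
    case (single l b)
    show ?case
      by (simp add: mult_single peval_single ring_hmD[OF c] lookup_add power_add prod.distrib ac_simps)
  qed (simp add: distrib_left peval_add)
qed (simp add: distrib_right peval_add)

lemma ring_hm_peval: "ring_hm (peval c \<sigma>)"
  using peval_single[of \<sigma> 0 1]
  by (simp add: ring_hm_def peval_add peval_mult ring_hmD[OF c])

lemma peval_pconst: "peval c \<sigma> (pconst a) = c a"
  by (simp add: pconst_def peval_single)

lemma peval_Xv: "peval c \<sigma> (Xv i) = \<sigma> i"
proof -
  have "(\<Prod>j\<in>UNIV. \<sigma> j ^ lookup (single i 1) j) = (\<Prod>j\<in>UNIV. if j = i then \<sigma> j else 1)"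
    by (intro prod.cong) (auto simp: lookup_single when_def)
  then show ?thesis by (simp add: Xv_def peval_single ring_hmD[OF c])
qed

end

lemma ring_hm_eq_peval:
  assumes "ring_hm h" "\<And>a. h (pconst a) = c a" "\<And>i. h (Xv i) = \<sigma> i"
  shows "h f = peval c \<sigma> f"
proof -
  have "h f = h (\<Sum>m\<in>keys f. single m (lookup f m))" by (simp only: sum_singles)
  also have "\<dots> = peval c \<sigma> f"
    unfolding peval_def ring_hmD(8)[OF assms(1)]
    by (simp add: single_eq_prod ring_hmD[OF assms(1)] assms(2,3))
  finally show ?thesis .
qed

text \<open>Uniqueness in the universal property: identities between substitutions or operations
  need to be checked on constants and variables only.\<close>

lemma ring_hm_eqI:
  fixes f :: "('k::comm_ring_1, 'n::finite) sympoly"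
  assumes "ring_hm h" "ring_hm h'" "\<And>a. h (pconst a) = h' (pconst a)" "\<And>i. h (Xv i) = h' (Xv i)"
  shows "h f = h' f"
  using ring_hm_eq_peval[OF assms(1), of "\<lambda>a. h' (pconst a)" "\<lambda>i. h' (Xv i)" f]
    ring_hm_eq_peval[OF assms(2) refl refl, of f] assms(3,4) by simp

section \<open>Linear substitutions and linear forms\<close>

lemma gl_act_eq_peval: "gl_act f g = peval pconst (\<lambda>i. linform (g $ i)) f"
  by (simp add: gl_act_def peval_def)

lemma ring_hm_gl_act: "ring_hm (\<lambda>f. gl_act f g)"
  unfolding gl_act_eq_peval by (rule ring_hm_peval[OF ring_hm_pconst])

lemmas gl_act_simps = ring_hmD[OF ring_hm_gl_act]

lemma gl_act_pconst [simp]: "gl_act (pconst a) g = pconst a"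
  by (simp add: gl_act_eq_peval peval_pconst[OF ring_hm_pconst])

lemma gl_act_Xv: "gl_act (Xv i) g = linform (g $ i)"
  by (simp add: gl_act_eq_peval peval_Xv[OF ring_hm_pconst])

text \<open>A linear form is identified with the row vector of its coefficients, so a substitution
  acts on it by right multiplication.\<close>

lemma gl_act_linform: "gl_act (linform v) g = linform (v v* g)"
proof -
  have "gl_act (linform v) g = (\<Sum>i\<in>UNIV. \<Sum>j\<in>UNIV. pconst (v $ i * g $ i $ j) * Xv j)"
    by (simp add: linform_def gl_act_simps gl_act_Xv sum_distrib_left pconst_mult mult.assoc)
  also have "\<dots> = linform (v v* g)"
    by (subst sum.swap)
      (simp add: linform_def vector_matrix_mult_def pconst_sum sum_distrib_left ac_simps)
  finally show ?thesis .
qed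

lemma gl_act_mat_1 [simp]:
  fixes f :: "('k::field, 'n::finite) sympoly"
  shows "gl_act f (mat 1) = f"
proof (rule ring_hm_eqI[OF ring_hm_gl_act ring_hm_id])
  show "gl_act (Xv i) (mat 1) = (Xv i :: ('k, 'n) sympoly)" for i :: 'n
    by (simp add: gl_act_Xv linform_def mat_def if_distrib if_distribR cong: if_cong)
qed simp

lemma gl_act_gl_act:
  fixes f :: "('k::field, 'n::finite) sympoly"
  shows "gl_act (gl_act f g) h = gl_act f (g ** h)"
proof (rule ring_hm_eqI[OF ring_hm_comp[OF ring_hm_gl_act ring_hm_gl_act] ring_hm_gl_act])
  show "gl_act (gl_act (Xv i) g) h = gl_act (Xv i) (g ** h)" for i :: 'n
  proof -
    have "(g $ i) v* h = (g ** h) $ i"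
      by (simp add: vec_eq_iff vector_matrix_mult_def matrix_matrix_mult_def ac_simps)
    then show ?thesis by (simp add: gl_act_Xv gl_act_linform)
  qed
qed simp

lemma linform_add: "linform (v + w) = linform v + linform w"
  by (simp add: linform_def pconst_add distrib_right sum.distrib)

lemma linform_scale: "linform (a *s v) = pconst a * linform v"
  by (simp add: linform_def pconst_mult sum_distrib_left mult.assoc)

lemma linform_0 [simp]: "linform 0 = 0"
  by (simp add: linform_def)

lemma linform_diff: "linform (v - w) = linform v - linform w"
  by (simp add: linform_def pconst_diff left_diff_distrib sum_subtractf)

lemma lookup_linform_single [simp]: "lookup (linform v) (single i 1) = v $ i"
proof -
  have "single j (1::nat) = single i 1 \<longleftrightarrow> j = i" for j
    using inj_single[of "1::nat"] by (metis keys_single one_neq_zero singleton_inject)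
  then show ?thesis
    by (simp add: linform_def lookup_sum Xv_def lookup_single when_def if_distrib cong: if_cong)
qed

lemmas lookup_linform_single_Suc [simp] = lookup_linform_single[unfolded One_nat_def]

lemma linform_eq_iff [simp]: "linform v = linform w \<longleftrightarrow> v = w"
  by (metis lookup_linform_single vec_eq_iff)

lemma linform_eq_0_iff [simp]: "linform v = 0 \<longleftrightarrow> v = 0"
  by (metis linform_0 linform_eq_iff)

lemma linform_axis [simp]: "linform (axis i 1) = Xv i"
  by (simp add: linform_def axis_def if_distrib if_distribR cong: if_cong)

lemma keys_linform: "m \<in> keys (linform v) \<Longrightarrow> \<exists>i. v $ i \<noteq> 0 \<and> m = single i 1"
proof -
  assume "m \<in> keys (linform v)"
  moreover have "lookup (linform v) m = (\<Sum>i\<in>UNIV. if single i 1 = m then v $ i else 0)"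
    by (simp add: linform_def lookup_sum Xv_def lookup_single when_def if_distrib cong: if_cong)
  ultimately have "(\<Sum>i\<in>UNIV. if single i 1 = m then v $ i else 0) \<noteq> 0"
    unfolding in_keys_iff by simp
  then obtain i where "(if single i 1 = m then v $ i else 0) \<noteq> 0"
    by (rule sum.not_neutral_contains_not_neutral)
  then show ?thesis by (auto split: if_splits)
qed

section \<open>Homogeneous components\<close>

lemma mdeg_add [simp]: "mdeg (m + l) = mdeg m + mdeg l"
  by (simp add: mdeg_def lookup_add sum.distrib)

lemma mdeg_0 [simp]: "mdeg 0 = 0"
  by (simp add: mdeg_def)

lemma mdeg_single [simp]: "mdeg (single i e) = e"
  by (simp add: mdeg_def lookup_single when_def)

lemma mdeg_eq_0_iff [simp]: "mdeg m = 0 \<longleftrightarrow> m = 0"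
  by (auto simp: mdeg_def intro: poly_mapping_eqI)

lemma homogD: "homog N f \<Longrightarrow> lookup f m \<noteq> 0 \<Longrightarrow> mdeg m = N"
  by (auto simp: homog_def in_keys_iff)

lemma homogI: "(\<And>m. lookup f m \<noteq> 0 \<Longrightarrow> mdeg m = N) \<Longrightarrow> homog N f"
  by (auto simp: homog_def in_keys_iff)

lemma homog_0 [simp]: "homog N 0"
  by (simp add: homog_def)

lemma homog_single: "mdeg m = N \<Longrightarrow> homog N (single m c)"
  by (auto simp: homog_def)

lemma homog_pconst [simp]: "homog 0 (pconst c)"
  by (simp add: pconst_def homog_single)

lemma homog_1 [simp]: "homog 0 1"
  using homog_pconst[of 1] by simp

lemma homog_add: "homog N f \<Longrightarrow> homog N g \<Longrightarrow> homog N (f + g)"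
  by (rule homogI) (metis add.right_neutral add.left_neutral homogD lookup_add)

lemma homog_uminus: "homog N f \<Longrightarrow> homog N (- f)"
  by (simp add: homog_def in_keys_iff)

lemma homog_diff: "homog N f \<Longrightarrow> homog N g \<Longrightarrow> homog N (f - g)"
  using homog_add[of N f "- g"] homog_uminus by fastforce

lemma homog_sum: "(\<And>x. x \<in> A \<Longrightarrow> homog N (f x)) \<Longrightarrow> homog N (sum f A)"
  by (induction A rule: infinite_finite_induct) (simp_all add: homog_add)

lemma homog_mult: "homog N f \<Longrightarrow> homog M g \<Longrightarrow> homog (N + M) (f * g)"
  unfolding homog_def using keys_mult[of f g] by fastforce

lemma homog_pconst_mult: "homog N f \<Longrightarrow> homog N (pconst c * f)"
  using homog_mult[of 0 "pconst c" N f] by simp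

lemma homog_power: "homog N f \<Longrightarrow> homog (e * N) (f ^ e)"
  by (induction e) (simp_all add: homog_mult)

lemma homog_prod: "(\<And>x. x \<in> A \<Longrightarrow> homog (d x) (f x)) \<Longrightarrow> homog (\<Sum>x\<in>A. d x) (prod f A)"
  by (induction A rule: infinite_finite_induct) (simp_all add: homog_mult)

lemma homog_Xv [simp]: "homog (Suc 0) (Xv i)"
  by (simp add: Xv_def homog_single)

lemma homog_linform [simp]: "homog (Suc 0) (linform v)"
  unfolding linform_def by (intro homog_sum homog_pconst_mult homog_Xv)

lemma homog_prod_linform: "homog (card A) (\<Prod>x\<in>A. linform (v x))"
  using homog_prod[of A "\<lambda>_. Suc 0" "\<lambda>x. linform (v x)"] by simp

lemma homog_gl_act:
  assumes "homog N f"
  shows "homog N (gl_act f g)"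
  unfolding gl_act_def
proof (intro homog_sum homog_pconst_mult)
  fix m assume "m \<in> keys f"
  then have "mdeg m = N" using assms by (simp add: homog_def)
  moreover have "homog (mdeg m) (\<Prod>i\<in>UNIV. linform (g $ i) ^ lookup m i)"
    unfolding mdeg_def
  proof (rule homog_prod)
    show "homog (lookup m i) (linform (g $ i) ^ lookup m i)" for i
      using homog_power[OF homog_linform, of "lookup m i" "g $ i"] by simp
  qed
  ultimately show "homog N (\<Prod>i\<in>UNIV. linform (g $ i) ^ lookup m i)" by simp
qed

lift_definition hc :: "nat \<Rightarrow> ('k::comm_ring_1, 'n::finite) sympoly \<Rightarrow> ('k, 'n) sympoly"
  is "\<lambda>N f m. if mdeg m = N then f m else 0"
  by (rule finite_subset) auto

lemma lookup_hc [simp]: "lookup (hc N f) m = (if mdeg m = N then lookup f m else 0)"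
  by transfer simp

lemma homog_hc [simp]: "homog N (hc N f)"
  by (rule homogI) (auto split: if_splits)

lemma hc_add: "hc N (f + g) = hc N f + hc N g"
  by (rule poly_mapping_eqI) (simp add: lookup_add)

lemma hc_0 [simp]: "hc N 0 = 0"
  by (rule poly_mapping_eqI) simp

lemma hc_sum: "hc N (sum f A) = (\<Sum>x\<in>A. hc N (f x))"
  by (induction A rule: infinite_finite_induct) (simp_all add: hc_add)

lemma hc_homog: "homog M f \<Longrightarrow> hc N f = (if M = N then f else 0)"
  by (rule poly_mapping_eqI) (auto dest: homogD)

text \<open>Used for degree comparisons: an arbitrary cofactor of a homogeneous polynomial can be
  replaced by its component of the right degree.\<close>

lemma hc_mult_homog:
  assumes "homog M p"
  shows "hc N (p * f) = (if M \<le> N then p * hc (N - M) f else 0)"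
proof (induction f rule: poly_mapping_induct)
  case (single m c)
  have "homog (M + mdeg m) (p * single m c)"
    by (intro homog_mult assms homog_single refl)
  moreover have "hc (N - M) (single m c) = (if mdeg m = N - M then single m c else 0)"
    by (intro hc_homog homog_single refl)
  ultimately show ?case by (auto simp: hc_homog)
qed (simp add: distrib_left hc_add)

section \<open>Finite fields\<close>

text \<open>Multiplication by a nonzero \<open>x\<close> permutes the nonzero elements, so it does
  not change their product.\<close>

lemma field_power_card:
  fixes x :: "'k::{field,finite}"
  shows "x ^ CARD('k) = x"
proof (cases "x = 0")
  case False
  have "x * (\<Prod>y\<in>UNIV-{0}. x * y) = x * x ^ (CARD('k) - 1) * (\<Prod>y\<in>UNIV-{0}. y)"
    by (simp add: prod.distrib mult_ac)
  also have "x * x ^ (CARD('k) - 1) = x ^ Suc (CARD('k) - 1)"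
    by (subst power_Suc) auto
  also have "Suc (CARD('k) - 1) = CARD('k)"
    using finite_UNIV_card_ge_0[where ?'a = 'k] by simp
  also have "(\<Prod>y\<in>UNIV-{0}. x * y) = (\<Prod>y\<in>UNIV-{0}. y)"
    by (rule prod.reindex_bij_witness[of _ "\<lambda>y. y / x" "\<lambda>y. x * y"]) (use False in auto)
  finally show ?thesis by simp
qed simp

lemma card_field_ge_2: "CARD('k::{field,finite}) \<ge> 2"
proof -
  have "card {0, 1 :: 'k} \<le> CARD('k)" by (rule card_mono) auto
  then show ?thesis by simp
qed

text \<open>Translation by \<open>1\<close> permutes the field, so the sum of all elements equals
  itself plus \<open>CARD('k)\<close> times \<open>1\<close>.\<close>

lemma of_nat_card_field: "of_nat (CARD('k::{field,finite})) = (0::'k)"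
proof -
  have "(\<Sum>x\<in>(UNIV::'k set). x + 1) = (\<Sum>x\<in>(UNIV::'k set). x)"
    by (rule sum.reindex_bij_witness[of _ "\<lambda>x. x - 1" "\<lambda>x. x + 1"]) auto
  then show ?thesis by (simp add: sum.distrib)
qed

text \<open>That the order of the field is a power of its characteristic is what makes the maps
  \<open>a \<mapsto> a ^ (CARD('k) ^ s)\<close> additive on polynomials.\<close>

locale fq =
  fixes p e :: nat and K :: "'k::{field,finite} itself"
  assumes prime_p: "prime p" and card_k: "CARD('k) = p ^ e"
begin

lemma CHAR_k: "CHAR('k) = p"
proof -
  have "of_nat (p ^ e) = (0::'k)"
    using of_nat_card_field[where ?'k = 'k] card_k by simp
  then have "CHAR('k) dvd p ^ e"
    by (simp only: of_nat_eq_0_iff_char_dvd)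
  moreover have "e > 0" using card_field_ge_2[where ?'k = 'k] card_k by (cases e) auto
  moreover have "CHAR('k) > 0"
    using \<open>CHAR('k) dvd p ^ e\<close> prime_p prime_gt_0_nat by (auto intro!: gr0I)
  ultimately show ?thesis
    using prime_CHAR_semidom[where ?'a = 'k] prime_p
    by (metis prime_dvd_power_nat primes_dvd_imp_eq)
qed

lemma CHAR_sympoly: "CHAR(('k, 'n) sympoly) = p"
proof (rule CHAR_eqI)
  show "of_nat p = (0 :: ('k, 'n) sympoly)"
    by (metis CHAR_k of_nat_CHAR pconst_0 pconst_of_nat)
  show "p dvd x" if "of_nat x = (0 :: ('k, 'n) sympoly)" for x
  proof -
    have "pconst (of_nat x :: 'k) = (0 :: ('k, 'n) sympoly)" using that by (simp add: pconst_of_nat)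
    then show ?thesis
      using CHAR_k by (metis lookup_single_eq lookup_zero of_nat_eq_0_iff_char_dvd pconst_def)
  qed
qed

lemma frob_add:
  fixes a b :: "('k, 'n) sympoly"
  shows "(a + b) ^ (CARD('k) ^ s) = a ^ (CARD('k) ^ s) + b ^ (CARD('k) ^ s)"
  by (rule freshmans_dream'[where n = "e * s"])
    (simp_all add: CHAR_sympoly prime_p card_k power_mult)

lemma frob_sum:
  fixes f :: "'a \<Rightarrow> ('k, 'n) sympoly"
  shows "sum f A ^ (CARD('k) ^ s) = (\<Sum>x\<in>A. f x ^ (CARD('k) ^ s))"
  by (rule freshmans_dream_sum'[where n = "e * s"])
    (simp_all add: CHAR_sympoly prime_p card_k power_mult)

end

lemma field_power_card_power:
  fixes x :: "'k::{field,finite}"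
  shows "x ^ (CARD('k) ^ s) = x"
  by (induction s) (simp_all add: field_power_card power_mult)

section \<open>Divisibility by linear forms\<close>

lemma Xv_power_dvd_iff:
  fixes f :: "('k::field, 'n::finite) sympoly"
  shows "Xv i ^ T dvd f \<longleftrightarrow> (\<forall>m. lookup f m \<noteq> 0 \<longrightarrow> T \<le> lookup m i)"
proof safe
  fix m assume "Xv i ^ T dvd f" "lookup f m \<noteq> 0"
  then obtain h where f: "f = Xv i ^ T * h" by (elim dvdE)
  then have "m \<in> keys (single (single i T) 1 * h)"
    using \<open>lookup f m \<noteq> 0\<close> by (simp add: Xv_power in_keys_iff)
  then obtain l where "m = single i T + l"
    using keys_mult[of "single (single i T) (1::'k)" h] by auto
  then show "T \<le> lookup m i" by (simp add: lookup_add)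
next
  assume *: "\<forall>m. lookup f m \<noteq> 0 \<longrightarrow> T \<le> lookup m i"
  have "Xv i ^ T dvd single m (lookup f m)" if "m \<in> keys f" for m
  proof
    have "single i T + (m - single i T) = m"
      using * that
      by (intro poly_mapping_eqI) (auto simp: lookup_add lookup_minus lookup_single when_def in_keys_iff)
    then show "single m (lookup f m) = Xv i ^ T * single (m - single i T) (lookup f m)"
      by (simp add: Xv_power mult_single)
  qed
  then have "Xv i ^ T dvd (\<Sum>m\<in>keys f. single m (lookup f m))" by (rule dvd_sum)
  then show "Xv i ^ T dvd f" by (simp add: sum_singles)
qed

lemma ring_hm_dvd: "ring_hm h \<Longrightarrow> a dvd b \<Longrightarrow> h a dvd h b"
  by (metis dvd_def ring_hmD(3))

text \<open>Reduction modulo the variable \<open>Xv i\<close>. It is a homomorphism into an integral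
  domain whose kernel is the ideal of \<open>Xv i\<close>, which makes the variable prime.\<close>

definition kill :: "'n \<Rightarrow> ('k::field, 'n::finite) sympoly \<Rightarrow> ('k, 'n) sympoly" where
  "kill i = peval pconst (\<lambda>j. if j = i then 0 else Xv j)"

lemma ring_hm_kill: "ring_hm (kill i)"
  unfolding kill_def by (rule ring_hm_peval[OF ring_hm_pconst])

lemma kill_Xv [simp]: "kill i (Xv j) = (if j = i then 0 else Xv j)"
  by (simp add: kill_def peval_Xv[OF ring_hm_pconst])

lemma kill_pconst [simp]: "kill i (pconst c) = pconst c"
  by (simp add: kill_def peval_pconst[OF ring_hm_pconst])

lemma dvd_prod_diff:
  fixes P :: "'a::comm_ring_1"
  assumes "\<And>j. j \<in> A \<Longrightarrow> P dvd g j - h j"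
  shows "P dvd c * prod g A - c * prod h A"
  using assms
proof (induction A rule: infinite_finite_induct)
  case (insert x F)
  have eq: "c * prod g (insert x F) - c * prod h (insert x F)
    = (g x - h x) * (c * prod g F) + h x * (c * prod g F - c * prod h F)"
    using insert.hyps by (simp add: algebra_simps)
  have "P dvd g x - h x" "P dvd c * prod g F - c * prod h F" using insert by auto
  then show ?case unfolding eq by (intro dvd_add dvd_mult dvd_mult2)
qed simp_all

lemma Xv_dvd_diff_kill: "Xv i dvd f - kill i f"
proof (induction f rule: poly_mapping_induct)
  case (single m c)
  have "Xv i dvd Xv j ^ lookup m j - kill i (Xv j) ^ lookup m j" for j
    by (cases "lookup m j") (simp_all add: dvd_mult2)
  then have "Xv i dvd pconst c * (\<Prod>j\<in>UNIV. Xv j ^ lookup m j)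
      - pconst c * (\<Prod>j\<in>UNIV. kill i (Xv j) ^ lookup m j)"
    by (rule dvd_prod_diff)
  then show ?case
    by (simp add: single_eq_prod ring_hmD[OF ring_hm_kill] del: kill_Xv)
next
  case (add f g)
  then have "Xv i dvd (f - kill i f) + (g - kill i g)" by (rule dvd_add)
  then show ?case by (simp add: ring_hmD[OF ring_hm_kill] algebra_simps)
qed

lemma Xv_dvd_iff_kill: "Xv i dvd f \<longleftrightarrow> kill i f = 0"
proof
  assume "Xv i dvd f"
  then have "kill i (Xv i) dvd kill i f" by (rule ring_hm_dvd[OF ring_hm_kill])
  then show "kill i f = 0" by simp
qed (use Xv_dvd_diff_kill[of i f] in simp)

lemma Xv_neq_0 [simp]: "(Xv i :: ('k::field, 'n::finite) sympoly) \<noteq> 0"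
  unfolding linform_axis[symmetric] linform_eq_0_iff by (simp add: axis_eq_0_iff)

lemma prime_elem_Xv: "prime_elem (Xv i :: ('k::field, 'n::{finite,linorder}) sympoly)"
  unfolding prime_elem_def Xv_dvd_iff_kill
  by (auto simp: ring_hmD[OF ring_hm_kill])

lemma gl_act_dvd_iff:
  assumes "invertible g"
  shows "gl_act a g dvd gl_act b g \<longleftrightarrow> a dvd b"
proof
  obtain h where h: "g ** h = mat 1" using assms by (auto simp: invertible_def)
  assume "gl_act a g dvd gl_act b g"
  from ring_hm_dvd[OF ring_hm_gl_act[of h] this] show "a dvd b" by (simp add: gl_act_gl_act h)
qed (rule ring_hm_dvd[OF ring_hm_gl_act])

text \<open>Row \<open>j\<close> of the first matrix in the proof is solved from \<open>v v* g = axis j 1\<close>; a transposition then moves \<open>j\<close> to \<open>i\<close>.\<close>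

lemma ex_gl_to_axis:
  fixes v :: "'k::field ^ 'n::finite"
  assumes "v \<noteq> 0" "\<And>b. b \<notin> A \<Longrightarrow> v $ b = 0" "i \<in> A"
  obtains h :: "'k ^ 'n ^ 'n" where "invertible h" "v v* h = axis i 1" "\<And>a. a \<notin> A \<Longrightarrow> h $ a = axis a 1"
    "\<And>a b. a \<in> A \<Longrightarrow> b \<notin> A \<Longrightarrow> h $ a $ b = 0"
proof -
  obtain j where j: "v $ j \<noteq> 0" using assms(1) by (auto simp: vec_eq_iff)
  then have jA: "j \<in> A" using assms(2) by blast
  define g :: "'k ^ 'n ^ 'n" where
    "g = (\<chi> a b. if a = j then (if b = j then 1 / v $ j else - v $ b / v $ j) else if a = b then 1 else 0)"
  \<comment> \<open>The identity matrix with row \<open>j\<close> replaced by \<open>v\<close>; it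
    turns out to be the inverse of \<open>g\<close>, hence \<open>g\<close> carries \<open>v\<close>
    to the axis vector of \<open>j\<close>.\<close>
  define g' :: "'k ^ 'n ^ 'n" where "g' = (\<chi> a b. if a = j then v $ b else if a = b then 1 else 0)"
  have sum1: "(\<Sum>c\<in>UNIV. (if a = c then 1 else 0) * F c) = F a" for a and F :: "'n \<Rightarrow> 'k"
    by (simp add: if_distrib if_distribR cong: if_cong)
  have "(g' ** g) $ a $ b = mat 1 $ a $ b" for a b
  proof (cases "a = j")
    case True
    have "(g' ** g) $ a $ b = v $ j * g $ j $ b + (\<Sum>c\<in>UNIV - {j}. v $ c * g $ c $ b)"
      using True by (simp add: matrix_matrix_mult_def g'_def sum.remove[of UNIV j])
    also have "(\<Sum>c\<in>UNIV - {j}. v $ c * g $ c $ b) = (\<Sum>c\<in>UNIV - {j}. if c = b then v $ c else 0)"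
      by (intro sum.cong) (auto simp: g_def)
    finally show ?thesis using True j by (auto simp: g_def mat_def sum.delta)
  next
    case False
    then have "(g' ** g) $ a $ b = (\<Sum>c\<in>UNIV. (if a = c then 1 else 0) * g $ c $ b)"
      by (simp add: matrix_matrix_mult_def g'_def)
    then show ?thesis using False by (simp add: sum1 g_def mat_def)
  qed
  then have "g' ** g = mat 1" by (simp add: vec_eq_iff)
  then have inv_g: "invertible g" by (auto simp: invertible_left_inverse)
  have vg: "v v* g = axis j 1"
  proof -
    have "v = g' $ j" by (simp add: g'_def vec_eq_iff)
    then have "(v v* g) $ b = (g' ** g) $ j $ b" for b
      by (simp add: vector_matrix_mult_def matrix_matrix_mult_def ac_simps)
    then show ?thesis using \<open>g' ** g = mat 1\<close> by (simp add: vec_eq_iff mat_def axis_def)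
  qed
  define s :: "'k ^ 'n ^ 'n" where "s = (\<chi> a b. if Transposition.transpose i j a = b then 1 else 0)"
  have sum2: "(\<Sum>c\<in>UNIV. (if x = c then 1 else 0) * F c) = F x" for x and F :: "'n \<Rightarrow> 'k"
    by (rule sum1)
  have "s ** s = mat 1"
    unfolding vec_eq_iff matrix_matrix_mult_def by (simp add: s_def sum2 mat_def)
  then have inv_s: "invertible s" by (auto simp: invertible_def)
  have gs: "(g ** s) $ a $ b = g $ a $ (Transposition.transpose i j b)" for a b
  proof -
    have "Transposition.transpose i j c = b \<longleftrightarrow> c = Transposition.transpose i j b" for c
      by (metis transpose_involutory)
    then show ?thesis
      by (simp add: s_def matrix_matrix_mult_def sum.delta if_distrib[of "\<lambda>x. _ * x"] cong: if_cong)
  qed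
  show ?thesis
  proof
    show "invertible (g ** s)" using inv_g inv_s by (rule invertible_mult)
    have "v v* (g ** s) = (v v* g) v* s" by (simp add: vector_matrix_mul_assoc)
    also have "\<dots> = axis i 1"
    proof -
      have "(axis j 1 v* s) $ b = s $ j $ b" for b
        using sum1[of j "\<lambda>i. s $ i $ b"] by (simp add: vector_matrix_mult_def axis_def eq_commute[of j] mult.commute)
      then show ?thesis unfolding vg by (auto simp: vec_eq_iff s_def axis_def)
    qed
    finally show "v v* (g ** s) = axis i 1" .
    show "(g ** s) $ a = axis a 1" if "a \<notin> A" for a
      unfolding vec_eq_iff gs using that jA assms(3)
      by (auto simp: g_def axis_def Transposition.transpose_def)
    show "(g ** s) $ a $ b = 0" if "a \<in> A" "b \<notin> A" for a b
      unfolding gs using that jA assms(2,3) by (auto simp: g_def Transposition.transpose_def)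
  qed
qed

lemma ex_gl_to_axis':
  fixes v :: "'k::field ^ 'n::finite"
  assumes "v \<noteq> 0"
  obtains h :: "'k ^ 'n ^ 'n" where "invertible h" "v v* h = axis i 1"
  using ex_gl_to_axis[of v UNIV i] assms by auto

text \<open>A change of coordinates turns the form into a variable, and divisibility is invariant
  under coordinate changes.\<close>

lemma prime_elem_linform:
  fixes v :: "'k::field ^ 'n::{finite,linorder}"
  assumes "v \<noteq> 0"
  shows "prime_elem (linform v)"
proof -
  \<comment> \<open>The index \<open>undefined\<close> stands for an arbitrary coordinate.\<close>
  obtain h :: "(('k, 'n) vec, 'n) vec" where h: "invertible h" "v v* h = axis undefined 1" by (rule ex_gl_to_axis'[OF assms, of undefined])
  have *: "linform v dvd f \<longleftrightarrow> Xv undefined dvd gl_act f h" for f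
    using gl_act_dvd_iff[OF h(1), of "linform v" f] by (simp add: gl_act_linform h(2))
  show ?thesis
    unfolding prime_elem_def *
    using prime_elem_Xv[of undefined] assms
    by (auto simp: gl_act_simps prime_elem_def)
qed

lemma linform_dvd_linform:
  fixes v w :: "'k::field ^ 'n::{finite,linorder}"
  assumes "v \<noteq> 0" "linform v dvd linform w"
  obtains c where "w = c *s v"
proof -
  obtain h :: "(('k, 'n) vec, 'n) vec" where h: "invertible h" "v v* h = axis undefined 1" by (rule ex_gl_to_axis'[OF assms(1), of undefined])
  obtain h' where h': "h ** h' = mat 1" using h(1) by (auto simp: invertible_def)
  have "Xv undefined ^ 1 dvd linform (w v* h)"
    using assms(2) gl_act_dvd_iff[OF h(1), of "linform v" "linform w"] by (simp add: gl_act_linform h(2))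
  then have *: "lookup (linform (w v* h)) m \<noteq> 0 \<Longrightarrow> 1 \<le> lookup m undefined" for m
    unfolding Xv_power_dvd_iff by blast
  have "(w v* h) $ i = 0" if "i \<noteq> undefined" for i
    using *[of "single i 1"] that by (auto simp: lookup_single when_def)
  then have "w v* h = ((w v* h) $ undefined) *s axis undefined 1"
    by (simp add: vec_eq_iff axis_def)
  also have "\<dots> = ((w v* h) $ undefined) *s (v v* h)" by (simp add: h(2))
  finally have "(w v* h) v* h' = (((w v* h) $ undefined) *s (v v* h)) v* h'" by simp
  then have "w = ((w v* h) $ undefined) *s v"
    by (simp add: vector_matrix_mul_assoc h' scalar_vector_matrix_assoc[symmetric])
  then show ?thesis by (rule that)
qed

text \<open>The factors \<open>P\<close> are split off \<open>g\<close> one at a time: once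
  \<open>P ^ m\<close> is removed, the next \<open>P\<close> divides \<open>w * g'\<close> but not
  \<open>w\<close>.\<close>

lemma prime_power_dvd_cofactor:
  fixes P :: "'a::idom"
  assumes "prime_elem P" "\<not> P dvd w" "P ^ m dvd w * g"
  shows "P ^ m dvd g"
  using assms(3)
proof (induction m)
  case (Suc m)
  have "P ^ m dvd w * g" using Suc.prems by (metis dvd_trans le_imp_power_dvd lessI less_imp_le)
  then obtain g' where g': "g = P ^ m * g'" using Suc.IH by (auto elim: dvdE)
  have "P ^ m * P dvd P ^ m * (w * g')" using Suc.prems g' by (simp add: ac_simps)
  then have "P dvd w * g'"
    using assms(1) by (simp add: prime_elem_def)
  then have "P dvd g'" using assms(1,2) by (auto simp: prime_elem_def)
  then show ?case unfolding g' by (metis mult_dvd_mono dvd_refl power_Suc2)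
qed simp

text \<open>Pairwise non-proportional linear forms are non-associated primes, so their powers can be
  split off one after the other.\<close>

lemma prod_linform_power_dvd:
  fixes f :: "('k::field, 'n::{finite,linorder}) sympoly"
  assumes "finite A" "\<And>v. v \<in> A \<Longrightarrow> v \<noteq> 0"
    "\<And>v w c. v \<in> A \<Longrightarrow> w \<in> A \<Longrightarrow> w = c *s v \<Longrightarrow> w = v"
    "\<And>v. v \<in> A \<Longrightarrow> linform v ^ T dvd f"
  shows "(\<Prod>v\<in>A. linform v) ^ T dvd f"
  using assms
proof (induction A rule: finite_induct)
  case (insert v A)
  have "(\<Prod>v\<in>A. linform v) ^ T dvd f" using insert by blast
  then obtain g where g: "f = (\<Prod>v\<in>A. linform v) ^ T * g" by (elim dvdE)
  have prime: "prime_elem (linform v)" using insert.prems(1) by (simp add: prime_elem_linform)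
  have "\<not> linform v dvd linform w" if "w \<in> A" for w
  proof
    assume "linform v dvd linform w"
    then obtain c where "w = c *s v" using linform_dvd_linform insert.prems(1) by (metis insertI1)
    then show False using insert.prems(2)[of v w c] insert.hyps(2) that by auto
  qed
  note ndvd = this
  have "\<not> linform v dvd (\<Prod>w\<in>B. linform w)" if "B \<subseteq> A" for B
    using finite_subset[OF that insert.hyps(1)] that
  proof (induction B rule: finite_induct)
    case empty
    then show ?case using prime by (simp add: prime_elem_def)
  next
    case (insert w B)
    have "\<not> linform v dvd linform w" "\<not> linform v dvd (\<Prod>w\<in>B. linform w)"
      using insert ndvd by blast+
    then have "\<not> linform v dvd linform w * (\<Prod>w\<in>B. linform w)"
      using prime_elem_dvd_multD[OF prime] by blast
    then show ?case using insert.hyps by simp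
  qed
  then have "\<not> linform v dvd (\<Prod>v\<in>A. linform v) ^ T"
    using prime_elem_dvd_power[OF prime] by blast
  moreover have "linform v ^ T dvd (\<Prod>v\<in>A. linform v) ^ T * g"
    using insert.prems(3)[of v] unfolding g by simp
  ultimately have "linform v ^ T dvd g"
    by (rule prime_power_dvd_cofactor[OF prime])
  then have "linform v ^ T * (\<Prod>v\<in>A. linform v) ^ T dvd g * (\<Prod>v\<in>A. linform v) ^ T"
    by (intro mult_dvd_mono dvd_refl)
  moreover have "(\<Prod>v\<in>insert v A. linform v) ^ T = linform v ^ T * (\<Prod>v\<in>A. linform v) ^ T"
    using insert.hyps by (simp add: power_mult_distrib)
  moreover have "f = g * (\<Prod>v\<in>A. linform v) ^ T" unfolding g by (rule mult.commute)
  ultimately show ?case by (simp only:)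
qed simp

section \<open>Monic vectors and the product of all lines\<close>

text \<open>The position counts from the end: the largest index has position \<open>0\<close>, the
  smallest \<open>CARD('n) - 1\<close>. It is the number of free entries of a monic vector with
  leading index \<open>i\<close>.\<close>

definition pos :: "'n::{finite,linorder} \<Rightarrow> nat" where
  "pos i = card {i<..}"

definition Mon :: "'n::{finite,linorder} \<Rightarrow> ('k::field, 'n) vec set" where
  "Mon i = {v. v $ i = 1 \<and> (\<forall>j<i. v $ j = 0)}"

definition Mons :: "('k::field, 'n::{finite,linorder}) vec set" where
  "Mons = (\<Union>i. Mon i)"

definition Lam :: "('k::{field,finite}, 'n::{finite,linorder}) sympoly" where
  "Lam = (\<Prod>u\<in>Mons. linform u)"

lemma pos_less: "i < j \<Longrightarrow> pos j < pos i"
  unfolding pos_def by (rule psubset_card_mono) auto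

lemma pos_inj: "pos i = pos j \<longleftrightarrow> i = j"
  by (metis linorder_neqE_nat linorder_less_linear pos_less less_irrefl)

lemma pos_less_iff: "pos j < pos i \<longleftrightarrow> i < j"
  by (metis less_asym linorder_less_linear pos_inj pos_less less_irrefl)

lemma bij_pos: "bij_betw (pos :: 'n::{finite,linorder} \<Rightarrow> nat) UNIV {..<CARD('n)}"
proof -
  have inj: "inj (pos :: 'n \<Rightarrow> nat)" by (rule injI) (simp add: pos_inj)
  have "pos i < CARD('n)" for i :: 'n
    unfolding pos_def by (rule psubset_card_mono) auto
  then have "range (pos :: 'n \<Rightarrow> nat) \<subseteq> {..<CARD('n)}" by auto
  moreover have "card (range (pos :: 'n \<Rightarrow> nat)) = card {..<CARD('n)}"
    using inj by (simp add: card_image)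
  ultimately have "range (pos :: 'n \<Rightarrow> nat) = {..<CARD('n)}"
    by (intro card_subset_eq) auto
  then show ?thesis using inj by (simp add: bij_betw_def)
qed

lemma sum_pos: "(\<Sum>i\<in>UNIV. F (pos (i::'n::{finite,linorder}))) = (\<Sum>t<CARD('n). F t)"
  using sum.reindex_bij_betw[OF bij_pos, of F] by simp

lemma geometric_nat:
  assumes "q \<ge> (1::nat)"
  shows "(q - 1) * (\<Sum>t<m. q ^ t) + 1 = q ^ m"
proof -
  obtain r where "q = Suc r" using assms by (cases q) auto
  then show ?thesis by (induction m) (simp_all add: algebra_simps)
qed

lemma geometric_nat_div:
  assumes "q \<ge> (2::nat)"
  shows "(q ^ m - 1) div (q - 1) = (\<Sum>t<m. q ^ t)"
proof -
  have "q ^ m - 1 = (q - 1) * (\<Sum>t<m. q ^ t)" using geometric_nat[of q m] assms by simp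
  then show ?thesis using assms by simp
qed

lemma Mon_unique: "v \<in> Mon i \<Longrightarrow> v \<in> Mon j \<Longrightarrow> i = j"
  unfolding Mon_def by (metis (mono_tags, lifting) linorder_less_linear mem_Collect_eq zero_neq_one)

lemma Mons_neq_0: "v \<in> Mons \<Longrightarrow> v \<noteq> 0"
  by (auto simp: Mons_def Mon_def)

lemma Mons_scale: "v \<in> Mons \<Longrightarrow> w \<in> Mons \<Longrightarrow> w = c *s v \<Longrightarrow> w = v"
proof -
  assume v: "v \<in> Mons" and w: "w \<in> Mons" and eq: "w = c *s v"
  obtain i where i: "v \<in> Mon i" using v by (auto simp: Mons_def)
  obtain j where j: "w \<in> Mon j" using w by (auto simp: Mons_def)
  have "c \<noteq> 0" using j eq by (auto simp: Mon_def)
  then have "\<not> i < j" "\<not> j < i" using i j eq by (auto simp: Mon_def)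
  then have "i = j" by simp
  then have "c = 1" using i j eq by (auto simp: Mon_def)
  then show ?thesis using eq by simp
qed

lemma lead_ex:
  fixes v :: "('k::field, 'n::{finite,linorder}) vec"
  assumes "v \<noteq> 0"
  obtains i where "v $ i \<noteq> 0" "\<And>j. j < i \<Longrightarrow> v $ j = 0"
proof -
  let ?S = "{i. v $ i \<noteq> 0}"
  have ne: "?S \<noteq> {}" using assms by (auto simp: vec_eq_iff)
  show ?thesis
  proof
    show "v $ Min ?S \<noteq> 0" using Min_in[OF _ ne] by simp
    show "v $ j = 0" if "j < Min ?S" for j using that by (meson Min_le finite mem_Collect_eq not_le)
  qed
qed

lemma monic_ex:
  fixes v :: "('k::field, 'n::{finite,linorder}) vec"
  assumes "v \<noteq> 0"
  obtains u c where "u \<in> Mons" "c \<noteq> 0" "v = c *s u"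
proof -
  obtain i where i: "v $ i \<noteq> 0" "\<And>j. j < i \<Longrightarrow> v $ j = 0" using lead_ex[OF assms] by blast
  have "(1 / v $ i) *s v \<in> Mon i" using i by (auto simp: Mon_def)
  moreover have "v = v $ i *s ((1 / v $ i) *s v)" using i by (simp add: vec_eq_iff)
  ultimately show ?thesis using that[of "(1 / v $ i) *s v" "v $ i"] i unfolding Mons_def by blast
qed

lemma card_vec_fixed:
  fixes a :: "('k::{field,finite}, 'n::finite) vec"
  shows "card {v. \<forall>j. j \<notin> A \<longrightarrow> v $ j = a $ j} = CARD('k) ^ card A"
proof -
  have "bij_betw (\<lambda>v. \<lambda>j\<in>A. v $ j) {v. \<forall>j. j \<notin> A \<longrightarrow> v $ j = a $ j} (A \<rightarrow>\<^sub>E (UNIV :: 'k set))"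
    by (rule bij_betw_byWitness[where f' = "\<lambda>f. \<chi> j. if j \<in> A then f j else a $ j"])
      (auto simp: vec_eq_iff fun_eq_iff PiE_iff extensional_def)
  then show ?thesis by (simp add: bij_betw_same_card card_PiE)
qed

lemma card_Mon: "card (Mon i :: ('k::{field,finite}, 'n::{finite,linorder}) vec set) = CARD('k) ^ pos i"
proof -
  have "(Mon i :: ('k, 'n) vec set) = {v. \<forall>j. j \<notin> {i<..} \<longrightarrow> v $ j = axis i 1 $ j}"
    by (auto simp: Mon_def axis_def not_less order_le_less)
  then show ?thesis using card_vec_fixed[of "{i<..}" "axis i (1::'k)"] by (simp add: pos_def)
qed

lemma card_Mons:
  "card (Mons :: ('k::{field,finite}, 'n::{finite,linorder}) vec set) = (\<Sum>t<CARD('n). CARD('k) ^ t)"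
proof -
  have "card (Mons :: ('k, 'n) vec set) = (\<Sum>i\<in>UNIV. card (Mon i :: ('k, 'n) vec set))"
    unfolding Mons_def by (rule card_UN_disjoint) (use Mon_unique in auto)
  then show ?thesis by (simp add: card_Mon sum_pos)
qed

lemma Lam_eq: "Lam = (\<Prod>i\<in>UNIV. \<Prod>u\<in>Mon i. linform u)"
  unfolding Lam_def Mons_def by (rule prod.UNION_disjoint) (use Mon_unique in auto)

lemma prod_linform_neq_0:
  fixes A :: "('k::{field,finite}, 'n::{finite,linorder}) vec set"
  shows "(\<And>v. v \<in> A \<Longrightarrow> v \<noteq> 0) \<Longrightarrow> (\<Prod>v\<in>A. linform v) \<noteq> 0"
  by (subst prod_zero_iff) auto

lemma Lam_neq_0 [simp]: "(Lam :: ('k::{field,finite}, 'n::{finite,linorder}) sympoly) \<noteq> 0"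
  unfolding Lam_def by (rule prod_linform_neq_0) (rule Mons_neq_0)

lemma homog_Lam: "homog (card (Mons :: ('k, 'n) vec set)) (Lam :: ('k::{field,finite}, 'n::{finite,linorder}) sympoly)"
  unfolding Lam_def by (rule homog_prod_linform)

section \<open>Lines and hyperplanes\<close>

lemma span_single_subset_iff: "vec.subspace H \<Longrightarrow> vec.span {u} \<subseteq> H \<longleftrightarrow> u \<in> H"
  by (meson empty_subsetI insert_subset subsetD vec.span_base vec.span_minimal insertI1)

lemma bij_betw_Mons_lines:
  "bij_betw (\<lambda>u. vec.span {u}) (Mons :: ('k::field, 'n::{finite,linorder}) vec set) lines"
  unfolding bij_betw_def
proof
  show "inj_on (\<lambda>u. vec.span {u}) (Mons :: ('k, 'n) vec set)"
  proof (rule inj_onI)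
    fix u w :: "('k, 'n) vec"
    assume "u \<in> Mons" "w \<in> Mons" "vec.span {u} = vec.span {w}"
    then have "w \<in> vec.span {u}" by (simp add: vec.span_base)
    then obtain c where "w = c *s u" by (auto simp: vec.span_singleton)
    then show "u = w" using Mons_scale \<open>u \<in> Mons\<close> \<open>w \<in> Mons\<close> by metis
  qed
  show "(\<lambda>u. vec.span {u}) ` Mons = (lines :: ('k, 'n) vec set set)"
  proof safe
    fix u :: "('k, 'n) vec" assume "u \<in> Mons"
    then show "vec.span {u} \<in> lines"
      using Mons_neq_0 by (auto simp: lines_def vec.dim_singleton)
  next
    fix L :: "('k, 'n) vec set" assume L: "L \<in> lines"
    then obtain B where B: "B \<subseteq> L" "vec.independent B" "L \<subseteq> vec.span B" "card B = 1"
      using vec.basis_exists[of L] by (auto simp: lines_def)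
    then obtain v where v: "B = {v}" by (auto simp: card_1_singleton_iff)
    then have "v \<noteq> 0" using B(2) vec.dependent_zero by auto
    then obtain u c where u: "u \<in> Mons" "c \<noteq> 0" "v = c *s u" using monic_ex by blast
    have "L = vec.span {v}"
      using B L v by (intro equalityI vec.span_minimal) (auto simp: lines_def)
    also have "\<dots> = vec.span {u}"
    proof -
      have "v \<in> vec.span {u}" using u by (auto simp: vec.span_singleton)
      moreover have "u = inverse c *s v" using u by (simp add: vec_eq_iff)
      then have "u \<in> vec.span {v}" unfolding vec.span_singleton by (rule range_eqI)
      ultimately show ?thesis
        by (intro equalityI) (simp_all add: span_single_subset_iff)
    qed
    finally show "L \<in> (\<lambda>u. vec.span {u}) ` Mons" using u by blast
  qed
qed

lemma line_rep_span:
  fixes u :: "('k::field, 'n::finite) vec"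
  assumes "u \<noteq> 0"
  shows "\<exists>c. c \<noteq> 0 \<and> line_rep (vec.span {u}) = c *s u"
proof -
  have "line_rep (vec.span {u}) \<in> vec.span {u} \<and> line_rep (vec.span {u}) \<noteq> 0"
    unfolding line_rep_def by (rule someI[of _ u]) (simp add: vec.span_base assms)
  then show ?thesis by (auto simp: vec.span_singleton)
qed

text \<open>The representatives \<open>line_rep\<close> are arbitrary nonzero vectors, so they
  differ from the monic ones by scalars, which are collected in \<open>c\<close>.\<close>

lemma VH_eq:
  fixes H :: "('k::{field,finite}, 'n::{finite,linorder}) vec set"
  assumes "vec.subspace H"
  obtains c where "c \<noteq> 0" "VH H = pconst c * (\<Prod>u\<in>Mons - H. linform u)"
proof -
  have "\<forall>u\<in>Mons. \<exists>c. c \<noteq> 0 \<and> line_rep (vec.span {u}) = c *s (u :: ('k, 'n) vec)"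
    using line_rep_span Mons_neq_0 by blast
  then obtain \<gamma> where \<gamma>: "\<And>u. u \<in> Mons \<Longrightarrow> \<gamma> u \<noteq> 0"
    "\<And>u. u \<in> Mons \<Longrightarrow> line_rep (vec.span {u}) = \<gamma> u *s (u :: ('k, 'n) vec)" by metis
  have bij: "bij_betw (\<lambda>u. vec.span {u}) (Mons - H) {L \<in> lines. \<not> L \<subseteq> H}"
    unfolding bij_betw_def
  proof
    show "inj_on (\<lambda>u. vec.span {u}) (Mons - H)"
      using bij_betw_Mons_lines[where ?'k = 'k and ?'n = 'n] by (auto simp: bij_betw_def inj_on_def)
    show "(\<lambda>u. vec.span {u}) ` (Mons - H) = {L \<in> lines. \<not> L \<subseteq> H}"
      unfolding bij_betw_imp_surj_on[OF bij_betw_Mons_lines, symmetric]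
      using span_single_subset_iff[OF assms] by auto
  qed
  have "VH H = (\<Prod>u\<in>Mons - H. linform (line_rep (vec.span {u})))"
    unfolding VH_def by (rule prod.reindex_bij_betw[OF bij, symmetric])
  also have "\<dots> = (\<Prod>u\<in>Mons - H. pconst (\<gamma> u) * linform u)"
    by (intro prod.cong) (auto simp: \<gamma> linform_scale)
  also have "\<dots> = pconst (\<Prod>u\<in>Mons - H. \<gamma> u) * (\<Prod>u\<in>Mons - H. linform u)"
    by (simp add: prod.distrib pconst_prod)
  finally show ?thesis using that[of "\<Prod>u\<in>Mons - H. \<gamma> u"] \<gamma> by auto
qed

text \<open>The substitution permutes lines, so it permutes monic vectors up to scalars.\<close>

lemma gl_act_prod_Mons:
  fixes H :: "('k::{field,finite}, 'n::{finite,linorder}) vec set"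
  assumes H: "vec.subspace H" and g: "invertible g"
  obtains c where "c \<noteq> 0"
    "gl_act (\<Prod>u\<in>Mons - H. linform u) g = pconst c * (\<Prod>u\<in>Mons - (\<lambda>v. v v* g) ` H. linform u)"
proof -
  obtain h where h: "g ** h = mat 1" "h ** g = mat 1" using g by (auto simp: invertible_def)
  have gh: "(v v* g) v* h = v" and hg: "(v v* h) v* g = v" for v :: "('k, 'n) vec"
    by (simp_all add: vector_matrix_mul_assoc h)
  have scale: "(c *s v) v* m = c *s (v v* m)" for c m and v :: "('k, 'n) vec"
    by (simp add: vec_eq_iff vector_matrix_mult_def sum_distrib_left ac_simps)
  have "\<forall>u\<in>Mons. \<exists>w c. w \<in> Mons \<and> c \<noteq> 0 \<and> u v* g = c *s (w :: ('k, 'n) vec)"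
  proof
    fix u :: "('k, 'n) vec" assume "u \<in> Mons"
    then have "u v* g \<noteq> 0" using gh[of u] Mons_neq_0 by (metis vector_matrix_mult_0)
    then show "\<exists>w c. w \<in> Mons \<and> c \<noteq> 0 \<and> u v* g = c *s w" using monic_ex by metis
  qed
  then obtain N \<gamma> where N: "\<And>u. u \<in> Mons \<Longrightarrow> N u \<in> Mons" "\<And>u. u \<in> Mons \<Longrightarrow> \<gamma> u \<noteq> 0"
    "\<And>u. u \<in> Mons \<Longrightarrow> u v* g = \<gamma> u *s (N u :: ('k, 'n) vec)" by metis
  let ?H = "(\<lambda>v. v v* g) ` H"
  have inj: "inj_on N Mons"
  proof (rule inj_onI)
    fix u w assume uw: "u \<in> Mons" "w \<in> Mons" "N u = N w"
    then have "w v* g = (\<gamma> w / \<gamma> u) *s (u v* g)" using N by (simp add: vec_eq_iff)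
    then have "w = (\<gamma> w / \<gamma> u) *s u" using gh scale by metis
    then show "u = w" using Mons_scale uw by metis
  qed
  then have surj: "N ` Mons = Mons"
    using N(1) by (intro endo_inj_surj) auto
  have mem: "N u \<in> ?H \<longleftrightarrow> u \<in> H" if "u \<in> Mons" for u
  proof
    assume "N u \<in> ?H"
    then obtain v where v: "v \<in> H" "N u = v v* g" by auto
    then have "u v* g = (\<gamma> u *s v) v* g" using N(3)[OF that] by (simp only: scale)
    then have "u = \<gamma> u *s v" using gh by metis
    then show "u \<in> H" using v H by (metis vec.subspace_scale)
  next
    assume "u \<in> H"
    then have "inverse (\<gamma> u) *s u \<in> H" using H by (simp add: vec.subspace_scale)
    moreover have "N u = (inverse (\<gamma> u) *s u) v* g"
      using N(2,3)[OF that] by (simp add: scale)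
    ultimately show "N u \<in> ?H" by blast
  qed
  have bij: "bij_betw N (Mons - H) (Mons - ?H)"
    unfolding bij_betw_def
  proof
    show "inj_on N (Mons - H)" using inj by (rule inj_on_subset) auto
    show "N ` (Mons - H) = Mons - ?H"
    proof
      show "N ` (Mons - H) \<subseteq> Mons - ?H"
      proof
        fix x assume "x \<in> N ` (Mons - H)"
        then obtain u where "u \<in> Mons" "u \<notin> H" "x = N u" by blast
        then show "x \<in> Mons - ?H" using N(1)[of u] mem[of u] by (simp only: DiffI simp_thms)
      qed
      show "Mons - ?H \<subseteq> N ` (Mons - H)"
      proof
        fix x assume x: "x \<in> Mons - ?H"
        then obtain u where "u \<in> Mons" "x = N u" using surj by blast
        then show "x \<in> N ` (Mons - H)" using x mem[of u] by blast
      qed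
    qed
  qed
  have "gl_act (\<Prod>u\<in>Mons - H. linform u) g = (\<Prod>u\<in>Mons - H. pconst (\<gamma> u) * linform (N u))"
    by (simp add: gl_act_simps gl_act_linform) (intro prod.cong, auto simp: N linform_scale)
  also have "\<dots> = pconst (\<Prod>u\<in>Mons - H. \<gamma> u) * (\<Prod>u\<in>Mons - H. linform (N u))"
    by (simp add: prod.distrib pconst_prod)
  also have "(\<Prod>u\<in>Mons - H. linform (N u)) = (\<Prod>u\<in>Mons - ?H. linform u)"
    by (rule prod.reindex_bij_betw[OF bij])
  finally show ?thesis using that[of "\<Prod>u\<in>Mons - H. \<gamma> u"] N by auto
qed

section \<open>Matrices acting on row vectors and on hyperplanes\<close>

lemma linear_vmult: "Vector_Spaces.linear (*s) (*s) (\<lambda>v. v v* (g :: (('k::field, 'n::finite) vec, 'n) vec))"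
  unfolding transpose_matrix_vector[symmetric] by (rule matrix_vector_mul_linear_gen)

lemma axis_vmult: "axis i 1 v* (m :: (('k::field, 'n::finite) vec, 'n) vec) = m $ i"
  by (simp add: vec_eq_iff vector_matrix_mult_def axis_def if_distrib if_distribR cong: if_cong)

lemma subspace_vmult_image:
  "vec.subspace H \<Longrightarrow> vec.subspace ((\<lambda>v. v v* (g :: (('k::field, 'n::finite) vec, 'n) vec)) ` H)"
  by (rule vec.linear_subspace_image[OF linear_vmult])

lemma invertible_rows:
  fixes g :: "(('k::field, 'n::finite) vec, 'n) vec"
  shows "invertible g \<longleftrightarrow> inj (($) g) \<and> vec.independent (range (($) g))"
proof -
  have "invertible g \<longleftrightarrow> (\<forall>c. (\<Sum>i\<in>UNIV. c i *s g $ i) = 0 \<longrightarrow> (\<forall>i. c i = 0))"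
    unfolding invertible_right_inverse matrix_right_invertible_independent_rows row_def
    by (simp add: vec_lambda_eta)
  also have "\<dots> \<longleftrightarrow> inj (($) g) \<and> vec.independent (range (($) g))"
  proof safe
    assume *: "\<forall>c. (\<Sum>i\<in>UNIV. c i *s g $ i) = 0 \<longrightarrow> (\<forall>i. c i = 0)"
    show inj: "inj (($) g)"
    proof (rule injI, rule ccontr)
      fix i j assume ij: "g $ i = g $ j" "i \<noteq> j"
      let ?c = "\<lambda>l. if l = i then 1 else if l = j then - 1 else (0::'k)"
      have "(\<Sum>l\<in>UNIV. ?c l *s g $ l) = (\<Sum>l\<in>{i,j}. ?c l *s g $ l)"
        by (rule sum.mono_neutral_right) auto
      also have "\<dots> = 0" using ij by simp
      finally have "?c i = 0" using *[rule_format, of ?c i] by blast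
      then show False by simp
    qed
    assume "vec.dependent (range (($) g))"
    then obtain u where u: "(\<Sum>v\<in>range (($) g). u v *s v) = 0" "\<exists>v\<in>range (($) g). u v \<noteq> 0"
      by (auto simp: vec.dependent_finite)
    then have "(\<Sum>i\<in>UNIV. u (g $ i) *s g $ i) = 0"
      using sum.reindex[OF inj, of "\<lambda>v. u v *s v"] by simp
    then have "u (g $ i) = 0" for i using *[rule_format, of "\<lambda>i. u (g $ i)" i] by blast
    then show False using u(2) by blast
  next
    fix c i assume inj: "inj (($) g)" and ind: "vec.independent (range (($) g))"
      and c: "(\<Sum>i\<in>UNIV. c i *s g $ i) = 0"
    let ?u = "\<lambda>v. c (inv (($) g) v)"
    have "(\<Sum>v\<in>range (($) g). ?u v *s v) = 0"
      using sum.reindex[OF inj, of "\<lambda>v. ?u v *s v"] c inj by simp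
    then have "\<forall>v\<in>range (($) g). ?u v = 0"
      using ind vec.dependent_finite[of "range (($) g)"] by auto
    then have "?u (g $ i) = 0" by blast
    then show "c i = 0" using inj by simp
  qed
  finally show ?thesis .
qed

text \<open>The group acts transitively: each hyperplane is the image of the same coordinate
  hyperplane, under a matrix whose rows extend a basis of it.\<close>

lemma ex_gl_hyperplane:
  fixes H H' :: "('k::field, 'n::finite) vec set"
  assumes "H \<in> hyperplanes" "H' \<in> hyperplanes"
  obtains g :: "(('k, 'n) vec, 'n) vec" where "invertible g" "H' = (\<lambda>v. v v* g) ` H"
proof -
  have ext: "\<exists>m::(('k, 'n) vec, 'n) vec. invertible m \<and> G = (\<lambda>v. v v* m) ` vec.span ((\<lambda>i. axis i 1) ` (UNIV - {i0}))"
    if G: "G \<in> hyperplanes" for G :: "('k, 'n) vec set" and i0 :: 'n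
  proof -
    have sG: "vec.subspace G" "vec.dim G = CARD('n) - 1" using G by (auto simp: hyperplanes_def)
    obtain B where B: "B \<subseteq> G" "vec.independent B" "G \<subseteq> vec.span B" "card B = CARD('n) - 1"
      using vec.basis_exists[of G] sG(2) by metis
    have fB: "finite B" using B(2) vec.finiteI_independent by blast
    have GB: "G = vec.span B" using B sG(1) by (simp add: subset_antisym vec.span_minimal)
    have "G \<noteq> UNIV"
    proof
      assume "G = UNIV"
      then have "CARD('n) - 1 = CARD('n)" using sG(2) vec_dim_card[where ?'a = 'k and ?'n = 'n] by simp
      then show False using zero_less_card_finite[where ?'a = 'n] by linarith
    qed
    then obtain w where w: "w \<notin> G" by auto
    then have ind: "vec.independent (insert w B)" using B(2) GB vec.independent_insertI by blast
    have "card B = card (UNIV - {i0})" using B(4) by (simp add: card_Diff_singleton)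
    then obtain b where b: "bij_betw b (UNIV - {i0}) B"
      using fB by (metis finite bij_betw_iff_card)
    \<comment> \<open>Row \<open>i0\<close> holds a vector outside \<open>G\<close>, the remaining
      rows a basis of \<open>G\<close>.\<close>
    define m :: "(('k, 'n) vec, 'n) vec" where "m = (\<chi> i. if i = i0 then w else b i)"
    have wB: "w \<notin> B" using w B(1) by auto
    have "bij_betw (($) m) UNIV (insert w B)"
    proof -
      have "bij_betw (($) m) (UNIV - {i0}) B"
        using b by (subst bij_betw_cong[of _ _ b]) (auto simp: m_def)
      moreover have "m $ i0 = w" by (simp add: m_def)
      ultimately have "bij_betw (($) m) (insert i0 (UNIV - {i0})) (insert w B)"
        using notIn_Un_bij_betw[of i0 "UNIV - {i0}" "($) m" B] wB by simp
      then show ?thesis by (simp add: insert_UNIV)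
    qed
    then have "invertible m" unfolding invertible_rows using ind by (auto simp: bij_betw_def)
    moreover have "G = (\<lambda>v. v v* m) ` vec.span ((\<lambda>i. axis i 1) ` (UNIV - {i0}))"
    proof -
      have "(\<lambda>v. v v* m) ` vec.span ((\<lambda>i. axis i 1) ` (UNIV - {i0}))
        = vec.span ((\<lambda>v. v v* m) ` (\<lambda>i. axis i 1) ` (UNIV - {i0}))"
        by (rule vec.linear_span_image[OF linear_vmult, symmetric])
      also have "(\<lambda>v. v v* m) ` (\<lambda>i. axis i 1) ` (UNIV - {i0}) = B"
      proof -
        have "(\<lambda>v. v v* m) ` (\<lambda>i. axis i 1) ` (UNIV - {i0}) = (\<lambda>i. m $ i) ` (UNIV - {i0})"
          by (simp only: image_image axis_vmult)
        also have "\<dots> = b ` (UNIV - {i0})" by (rule image_cong) (auto simp: m_def)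
        finally show ?thesis using b by (simp add: bij_betw_def)
      qed
      finally show ?thesis using GB by simp
    qed
    ultimately show ?thesis by blast
  qed
  let ?S = "vec.span ((\<lambda>i. axis i 1) ` (UNIV - {undefined}))"
  obtain m m' :: "(('k, 'n) vec, 'n) vec" where m: "invertible m" "H = (\<lambda>v. v v* m) ` ?S"
    and m': "invertible m'" "H' = (\<lambda>v. v v* m') ` ?S"
    using ext[OF assms(1), of undefined] ext[OF assms(2), of undefined] by blast
  obtain mi where mi: "m ** mi = mat 1" "mi ** m = mat 1" using m(1) by (auto simp: invertible_def)
  show ?thesis
  proof
    show "invertible (mi ** m')"
      using m'(1) mi by (intro invertible_mult) (auto simp: invertible_def)
    show "H' = (\<lambda>v. v v* (mi ** m')) ` H"
      unfolding m(2) m'(2) image_image vector_matrix_mul_assoc matrix_mul_assoc mi(1)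
      by (simp add: mi(1))
  qed
qed

lemma VH_gl_act:
  fixes H :: "('k::{field,finite}, 'n::{finite,linorder}) vec set"
  assumes H: "vec.subspace H" and g: "invertible g"
  obtains c where "c \<noteq> 0" "gl_act (VH H) g = pconst c * VH ((\<lambda>v. v v* g) ` H)"
proof -
  obtain a where a: "a \<noteq> 0" "VH H = pconst a * (\<Prod>u\<in>Mons - H. linform u)" by (rule VH_eq[OF H])
  obtain b where b: "b \<noteq> 0"
    "VH ((\<lambda>v. v v* g) ` H) = pconst b * (\<Prod>u\<in>Mons - (\<lambda>v. v v* g) ` H. linform u)"
    by (rule VH_eq[OF subspace_vmult_image[OF H]])
  obtain c where c: "c \<noteq> 0" "gl_act (\<Prod>u\<in>Mons - H. linform u) g
    = pconst c * (\<Prod>u\<in>Mons - (\<lambda>v. v v* g) ` H. linform u)" by (rule gl_act_prod_Mons[OF H g])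
  have "a * c / b * b = a * c" using b(1) by simp
  then have pc: "pconst a * pconst c = pconst (a * c / b) * pconst b" by (simp only: flip: pconst_mult)
  then have "gl_act (VH H) g = pconst (a * c / b) * VH ((\<lambda>v. v v* g) ` H)"
    unfolding b(2) a(2) gl_act_simps(3) c(2) gl_act_pconst by (simp only: mult.assoc[symmetric] pc)
  then show ?thesis using that[of "a * c / b"] a b c by simp
qed

section \<open>The Moore determinant\<close>

text \<open>Introduced to find the character by which \<open>Lam\<close> transforms: for this
  determinant it can be read off from the multiplicativity of \<open>det\<close>, and
  \<open>Lam\<close> is a scalar multiple of it.\<close>

definition Moore :: "('k::{field,finite}, 'n::{finite,linorder}) sympoly" where
  "Moore = det (\<chi> i j. Xv i ^ (CARD('k) ^ pos j))"

lemma ring_hm_of_int: "ring_hm h \<Longrightarrow> h (of_int z) = of_int z"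
proof -
  assume h: "ring_hm h"
  have "h (of_nat m) = of_nat m" for m by (induction m) (simp_all add: ring_hmD[OF h])
  then show ?thesis by (cases z) (simp_all add: ring_hmD[OF h])
qed

lemma ring_hm_det: "ring_hm h \<Longrightarrow> h (det A) = det (\<chi> i j. h (A $ i $ j))"
  by (simp add: det_def ring_hmD ring_hm_of_int)

lemma Moore_sum: "(Moore :: ('k::{field,finite}, 'n::{finite,linorder}) sympoly)
  = (\<Sum>p | p permutes UNIV. of_int (sign p) * single (\<Sum>i\<in>UNIV. single i (CARD('k) ^ pos (p i))) 1)"
  by (simp add: Moore_def det_def Xv_power prod_single_1)

lemma lookup_sum_single: "lookup (\<Sum>i\<in>UNIV. single (i::'n::finite) (h i)) j = h j"
  by (simp add: lookup_sum lookup_single when_def)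

text \<open>The exponents \<open>CARD('k) ^ pos i\<close> are distinct, so the diagonal monomial
  arises from the identity permutation alone and cannot cancel.\<close>

lemma Moore_neq_0: "(Moore :: ('k::{field,finite}, 'n::{finite,linorder}) sympoly) \<noteq> 0"
proof
  let ?m = "\<Sum>i\<in>UNIV. single (i::'n) (CARD('k) ^ pos i)"
  assume "(Moore :: ('k, 'n) sympoly) = 0"
  then have "0 = lookup (Moore :: ('k, 'n) sympoly) ?m" by simp
  also have "\<dots> = (\<Sum>p | p permutes (UNIV :: 'n set). if p = id then 1 else 0)"
    unfolding Moore_sum lookup_sum
  proof (rule sum.cong)
    fix p assume "p \<in> {p. p permutes (UNIV :: 'n set)}"
    have "(\<Sum>i\<in>UNIV. single i (CARD('k) ^ pos (p i))) = ?m \<longleftrightarrow> p = id"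
    proof
      assume eq: "(\<Sum>i\<in>UNIV. single i (CARD('k) ^ pos (p i))) = ?m"
      have "CARD('k) ^ pos (p i) = CARD('k) ^ pos i" for i
        using arg_cong[OF eq, of "\<lambda>m. lookup m i"] by (simp only: lookup_sum_single)
      then have "p i = i" for i
        using card_field_ge_2[where ?'k = 'k] by (simp add: power_inject_exp pos_inj)
      then show "p = id" by auto
    qed simp
    moreover have "of_int (sign p) * single m (1::'k) = single m (of_int (sign p))" for m :: "'n \<Rightarrow>\<^sub>0 nat"
      by (simp add: sign_def single_uminus)
    ultimately have eq: "lookup (of_int (sign p) * single (\<Sum>i\<in>UNIV. single i (CARD('k) ^ pos (p i))) (1::'k)) ?m
      = (of_int (sign p) when p = id)" by (simp only: lookup_single)
    show "lookup (of_int (sign p) * single (\<Sum>i\<in>UNIV. single i (CARD('k) ^ pos (p i))) (1::'k)) ?m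
      = (if p = id then 1 else 0)" unfolding eq when_def using sign_id by (cases "p = id") simp_all
  qed simp
  also have "\<dots> = 1" by (simp add: permutes_id)
  finally show False by simp
qed

lemma homog_Moore: "homog (card (Mons :: ('k, 'n) vec set)) (Moore :: ('k::{field,finite}, 'n::{finite,linorder}) sympoly)"
  unfolding Moore_sum
proof (rule homog_sum)
  fix p assume p: "p \<in> {p. p permutes (UNIV :: 'n set)}"
  have "mdeg (\<Sum>i\<in>UNIV. single i (CARD('k) ^ pos (p i))) = (\<Sum>i\<in>UNIV. CARD('k) ^ pos (p i))"
    unfolding mdeg_def by (rule sum.cong[OF refl]) (rule lookup_sum_single)
  also have "\<dots> = (\<Sum>i\<in>UNIV. CARD('k) ^ pos (i::'n))"
    using p by (intro sum.permute[symmetric, unfolded o_def]) simp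
  also have "\<dots> = card (Mons :: ('k, 'n) vec set)" by (simp add: card_Mons sum_pos)
  finally have "homog (card (Mons :: ('k, 'n) vec set))
    (single (\<Sum>i\<in>UNIV. single i (CARD('k) ^ pos (p i))) (1::'k))" by (rule homog_single)
  then show "homog (card (Mons :: ('k, 'n) vec set))
      (of_int (sign p) * single (\<Sum>i\<in>UNIV. single i (CARD('k) ^ pos (p i))) (1::'k))"
    using homog_uminus by (auto simp: sign_def)
qed

lemma homog_0D: "homog 0 f \<Longrightarrow> f = pconst (lookup f 0)"
  by (rule poly_mapping_eqI) (auto simp: pconst_def lookup_single when_def dest: homogD)

context fq
begin

text \<open>Frobenius powers are additive and fix the entries of \<open>g\<close>, so substitution
  multiplies the Moore matrix by \<open>g\<close> from the left.\<close>

lemma gl_act_Moore: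
  fixes g :: "(('k, 'n::{finite,linorder}) vec, 'n) vec"
  shows "gl_act Moore g = pconst (det g) * Moore"
proof -
  let ?X = "(\<chi> i j. Xv i ^ (CARD('k) ^ pos j)) :: ((('k, 'n) sympoly, 'n) vec, 'n) vec"
  have "gl_act Moore g = det (\<chi> i j. gl_act (Xv i ^ (CARD('k) ^ pos j)) g)"
    unfolding Moore_def by (subst ring_hm_det[OF ring_hm_gl_act]) simp
  also have "(\<chi> i j. gl_act (Xv i ^ (CARD('k) ^ pos j)) g) = (\<chi> i j. pconst (g $ i $ j)) ** ?X"
  proof -
    have "gl_act (Xv i ^ (CARD('k) ^ pos j)) g = (\<Sum>l\<in>UNIV. pconst (g $ i $ l) * Xv l ^ (CARD('k) ^ pos j))" for i j :: 'n
      by (simp add: gl_act_simps gl_act_Xv linform_def frob_sum power_mult_distrib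
          pconst_power[symmetric] field_power_card_power)
    then show ?thesis by (simp add: vec_eq_iff matrix_matrix_mult_def)
  qed
  also have "det \<dots> = pconst (det g) * Moore"
    unfolding det_mul Moore_def ring_hm_det[OF ring_hm_pconst, of g] by simp
  finally show ?thesis .
qed

text \<open>The variables divide every term of the determinant; by equivariance all linear forms
  divide it, hence \<open>Lam\<close> does, and equal degrees leave a constant quotient.\<close>

lemma Moore_eq_Lam:
  obtains c where "c \<noteq> 0" "(Moore :: ('k, 'n::{finite,linorder}) sympoly) = pconst c * Lam"
proof -
  have Xv_dvd: "Xv i dvd (Moore :: ('k, 'n) sympoly)" for i
    unfolding Moore_def det_def
  proof (intro dvd_sum dvd_mult)
    fix p
    have "Xv i dvd Xv i ^ (CARD('k) ^ pos (p i))"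
      using card_field_ge_2[where ?'k = 'k] by (intro dvd_power) simp
    also have "\<dots> dvd (\<Prod>i\<in>UNIV. Xv i ^ (CARD('k) ^ pos (p i)))"
      by (rule dvd_prodI) auto
    also have "\<dots> = (\<Prod>i\<in>UNIV. (\<chi> i j. Xv i ^ (CARD('k) ^ pos j)) $ i $ p i)" by simp
    finally show "Xv i dvd (\<Prod>i\<in>UNIV. (\<chi> i j. Xv i ^ (CARD('k) ^ pos j)) $ i $ p i)" .
  qed
  have "linform u dvd (Moore :: ('k, 'n) sympoly)" if u: "u \<in> Mons" for u
  proof -
    obtain h :: "(('k, 'n) vec, 'n) vec" where h: "invertible h" "u v* h = axis undefined 1"
      using ex_gl_to_axis'[OF Mons_neq_0[OF u], of undefined] by blast
    have "gl_act (linform u) h dvd gl_act Moore h"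
      unfolding gl_act_linform h(2) gl_act_Moore linform_axis by (rule dvd_mult[OF Xv_dvd])
    then show ?thesis using gl_act_dvd_iff[OF h(1)] by blast
  qed
  then have "(\<Prod>u\<in>Mons. linform u) ^ 1 dvd (Moore :: ('k, 'n) sympoly)"
    by (intro prod_linform_power_dvd)
      (simp_all only: power_one_right finite Mons_neq_0 not_False_eq_True, metis Mons_scale)
  then obtain h where h: "(Moore :: ('k, 'n) sympoly) = Lam * h"
    by (auto simp: Lam_def elim: dvdE)
  have "Moore = hc (card (Mons :: ('k, 'n) vec set)) (Moore :: ('k, 'n) sympoly)"
    by (simp add: hc_homog[OF homog_Moore])
  also have "\<dots> = hc (card (Mons :: ('k, 'n) vec set)) (Lam * h)" using h by (rule arg_cong)
  also have "\<dots> = Lam * hc 0 h" by (simp add: hc_mult_homog[OF homog_Lam])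
  also have "hc 0 h = pconst (lookup (hc 0 h) 0)" by (rule homog_0D) simp
  finally have eq: "(Moore :: ('k, 'n) sympoly) = pconst (lookup (hc 0 h) 0) * Lam" by (simp only: mult.commute)
  then show ?thesis using that[of "lookup (hc 0 h) 0"] Moore_neq_0 by (metis mult_zero_left pconst_0)
qed

lemma gl_act_Lam:
  fixes g :: "(('k, 'n::{finite,linorder}) vec, 'n) vec"
  shows "gl_act Lam g = pconst (det g) * Lam"
proof -
  obtain c where c: "c \<noteq> 0" "(Moore :: ('k, 'n) sympoly) = pconst c * Lam" by (rule Moore_eq_Lam)
  have "pconst c * gl_act Lam g = pconst c * (pconst (det g) * Lam)"
    using gl_act_Moore[of g] unfolding c(2) gl_act_simps(3) gl_act_pconst by (simp only: ac_simps)
  then show ?thesis using c(1) by simp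
qed

end

section \<open>Cocircuit ideals of multisets of linear forms\<close>

text \<open>The ring as a module over itself: its submodules are ideals and \<open>idl.span\<close>
  is the generated ideal.\<close>

interpretation idl: module "(*) :: 'a::comm_ring_1 \<Rightarrow> 'a \<Rightarrow> 'a"
  by unfold_locales (simp_all add: algebra_simps)

declare idl.scale_scale [simp del]

text \<open>Polynomials as a module over the scalars: \<open>fsp.span\<close> is the linear
  span.\<close>

interpretation fsp: module "\<lambda>(c::'k::comm_ring_1) (f::('k, 'n) sympoly). pconst c * f"
  by unfold_locales (simp_all only: distrib_left distrib_right pconst_add pconst_mult mult.assoc pconst_1 mult_1_left)

lemma hc_span_homog:
  assumes "\<And>s. s \<in> S \<Longrightarrow> \<exists>d. homog d s" "f \<in> idl.span S"
  shows "hc N f \<in> idl.span S"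
proof -
  have "\<forall>N. hc N f \<in> idl.span S"
    using assms(2)
  proof (rule idl.span_induct)
    show "idl.subspace {f. \<forall>N. hc N f \<in> idl.span S}"
    proof (rule idl.subspaceI)
      fix c x assume x: "x \<in> {f. \<forall>N. hc N f \<in> idl.span S}"
      have "\<forall>N. hc N (c * x) \<in> idl.span S"
      proof (induction c rule: poly_mapping_induct)
        case (single m a)
        show ?case using x
          by (auto simp: hc_mult_homog[OF homog_single[OF refl]] idl.span_scale idl.span_zero)
      qed (simp add: distrib_right hc_add idl.span_add)
      then show "c * x \<in> {f. \<forall>N. hc N f \<in> idl.span S}" by simp
    qed (auto simp: idl.span_zero hc_add idl.span_add)
    show "\<forall>N. hc N s \<in> idl.span S" if "s \<in> S" for s
      using assms(1)[OF that] that by (auto simp: hc_homog idl.span_base idl.span_zero)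
  qed
  then show ?thesis ..
qed

lemma hc_diff_homog:
  assumes "homog N f"
  shows "hc N (f - g * l) = f - hc N (l * g)"
proof -
  have "f = hc N ((f - g * l) + l * g)" by (simp add: hc_homog[OF assms] mult.commute)
  then have "f = hc N (f - g * l) + hc N (l * g)" by (simp only: hc_add)
  from this[symmetric] show ?thesis by (rule eq_diff_eq[THEN iffD2])
qed

section \<open>Deletion and contraction\<close>

lemma ex_hyperplane_superset:
  fixes K :: "('k::field, 'n::finite) vec set"
  assumes "vec.subspace K" "K \<noteq> UNIV"
  obtains H where "H \<in> hyperplanes" "K \<subseteq> H"
proof -
  obtain B where B: "B \<subseteq> K" "vec.independent B" "K \<subseteq> vec.span B"
    using vec.basis_exists[of K] by metis
  obtain C where C: "B \<subseteq> C" "vec.independent C" "UNIV \<subseteq> vec.span C"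
    using vec.maximal_independent_subset_extend[of B UNIV] B(2) by auto
  have KB: "K = vec.span B" using B assms(1) by (simp add: subset_antisym vec.span_minimal)
  then have "B \<noteq> C" using C(3) assms(2) by auto
  then obtain w where w: "w \<in> C" "w \<notin> B" using C(1) by auto
  have fC: "finite C" using C(2) vec.finiteI_independent by blast
  have cC: "card C = CARD('n)"
    using C vec.dim_eq_card_independent[OF C(2)] vec_dim_card[where ?'a = 'k and ?'n = 'n]
    by (metis vec.dim_span top.extremum_uniqueI)
  have ind: "vec.independent (C - {w})" using C(2) vec.independent_mono by blast
  show ?thesis
  proof
    show "vec.span (C - {w}) \<in> hyperplanes"
      using vec.dim_span_eq_card_independent[OF ind] w fC cC by (simp add: hyperplanes_def)
    show "K \<subseteq> vec.span (C - {w})" unfolding KB using C(1) w by (intro vec.span_mono) auto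
  qed
qed

text \<open>The cocircuit ideal of the family \<open>v\<close> on \<open>Y\<close> after contraction
  of the subspace \<open>K\<close>: the forms of \<open>K\<close> are set to zero and only
  hyperplanes above \<open>K\<close> contribute. Vectors are indexed by \<open>Y\<close> so that
  they may repeat.\<close>

definition JJ :: "('k::field, 'n::finite) vec set \<Rightarrow> 'y set \<Rightarrow> ('y \<Rightarrow> ('k, 'n) vec) \<Rightarrow> ('k, 'n) sympoly set" where
  "JJ K Y v = idl.span (linform ` K \<union> {\<Prod>y\<in>{y\<in>Y. v y \<notin> H}. linform (v y) | H. H \<in> hyperplanes \<and> K \<subseteq> H})"

lemma JJ_add: "f \<in> JJ K Y v \<Longrightarrow> g \<in> JJ K Y v \<Longrightarrow> f + g \<in> JJ K Y v"
  unfolding JJ_def by (rule idl.span_add)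

lemma JJ_scale: "f \<in> JJ K Y v \<Longrightarrow> c * f \<in> JJ K Y v"
  unfolding JJ_def by (rule idl.span_scale)

lemma JJ_0: "0 \<in> JJ K Y v"
  unfolding JJ_def by (rule idl.span_zero)

lemma JJ_linform: "w \<in> K \<Longrightarrow> linform w \<in> JJ K Y v"
  unfolding JJ_def by (rule idl.span_base) simp

lemma JJ_prod: "H \<in> hyperplanes \<Longrightarrow> K \<subseteq> H \<Longrightarrow> (\<Prod>y\<in>{y\<in>Y. v y \<notin> H}. linform (v y)) \<in> JJ K Y v"
  unfolding JJ_def by (rule idl.span_base) auto

lemma JJ_minimal:
  assumes "f \<in> JJ K Y v" "idl.subspace I" "\<And>w. w \<in> K \<Longrightarrow> linform w \<in> I"
    "\<And>H. H \<in> hyperplanes \<Longrightarrow> K \<subseteq> H \<Longrightarrow> (\<Prod>y\<in>{y\<in>Y. v y \<notin> H}. linform (v y)) \<in> I"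
  shows "f \<in> I"
proof -
  have "linform ` K \<union> {\<Prod>y\<in>{y\<in>Y. v y \<notin> H}. linform (v y) | H. H \<in> hyperplanes \<and> K \<subseteq> H} \<subseteq> I"
    using assms(3,4) by (intro Un_least subsetI) (auto simp only: mem_Collect_eq image_iff)
  from idl.span_minimal[OF this assms(2)] show ?thesis using assms(1) by (auto simp only: JJ_def)
qed

lemma hc_JJ: "f \<in> JJ K Y v \<Longrightarrow> hc N f \<in> JJ K Y v"
  unfolding JJ_def
proof (rule hc_span_homog)
  fix s assume "s \<in> linform ` K \<union> {\<Prod>y\<in>{y\<in>Y. v y \<notin> H}. linform (v y) | H. H \<in> hyperplanes \<and> K \<subseteq> H}"
  then show "\<exists>d. homog d s"
  proof
    assume "s \<in> linform ` K"
    then show ?thesis using homog_linform by (elim imageE) (simp only:, rule exI)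
  next
    assume "s \<in> {\<Prod>y\<in>{y\<in>Y. v y \<notin> H}. linform (v y) | H. H \<in> hyperplanes \<and> K \<subseteq> H}"
    then obtain H where "s = (\<Prod>y\<in>{y\<in>Y. v y \<notin> H}. linform (v y))" by (elim CollectE exE conjE)
    then show ?thesis using homog_prod_linform by (simp only:) (rule exI)
  qed
qed

text \<open>Enlarging \<open>K\<close> by \<open>v x\<close> adds the one generator
  \<open>linform (v x)\<close> and otherwise only removes hyperplanes.\<close>

lemma JJ_contract:
  assumes "vec.subspace K" "f \<in> JJ (vec.span (insert (v x) K)) Y v"
  shows "\<exists>g. f - g * linform (v x) \<in> JJ K Y v"
proof -
  let ?I = "idl.span (insert (linform (v x)) (JJ K Y v))"
  have "f \<in> ?I"
    using assms(2)
  proof (rule JJ_minimal)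
    show "linform w \<in> ?I" if w: "w \<in> vec.span (insert (v x) K)" for w
    proof -
      obtain c where c: "w - c *s v x \<in> vec.span K"
        using w unfolding vec.span_breakdown_eq by blast
      then have "w - c *s v x \<in> K" by (metis assms(1) vec.span_eq_iff)
      then have "linform (w - c *s v x) \<in> ?I" by (intro idl.span_base insertI2 JJ_linform)
      moreover have "pconst c * linform (v x) \<in> ?I"
        by (intro idl.span_scale idl.span_base) simp
      ultimately have "linform (w - c *s v x) + pconst c * linform (v x) \<in> ?I"
        by (rule idl.span_add)
      then show ?thesis by (simp add: linform_diff linform_scale)
    qed
    show "(\<Prod>y\<in>{y\<in>Y. v y \<notin> H}. linform (v y)) \<in> ?I"
      if "H \<in> hyperplanes" "vec.span (insert (v x) K) \<subseteq> H" for H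
      using that vec.span_superset[of "insert (v x) K"]
      by (intro idl.span_base insertI2 JJ_prod) auto
  qed simp
  then obtain g where "f - g * linform (v x) \<in> idl.span (JJ K Y v)"
    by (auto simp: idl.span_breakdown_eq)
  then show ?thesis by (auto simp: JJ_def idl.span_span)
qed

text \<open>Putting \<open>x\<close> back multiplies the product of a hyperplane by
  \<open>linform (v x)\<close> if \<open>v x\<close> is off it, and leaves it unchanged
  otherwise.\<close>

lemma linform_mult_JJ:
  assumes "finite Y" "x \<in> Y" "f \<in> JJ K (Y - {x}) v"
  shows "linform (v x) * f \<in> JJ K Y v"
proof -
  have "f \<in> {f. linform (v x) * f \<in> JJ K Y v}"
    using assms(3)
  proof (rule JJ_minimal)
    show "idl.subspace {f. linform (v x) * f \<in> JJ K Y v}"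
      by (rule idl.subspaceI) (auto simp: JJ_0 distrib_left JJ_add mult.left_commute[of "linform (v x)"] JJ_scale)
    show "linform w \<in> {f. linform (v x) * f \<in> JJ K Y v}" if "w \<in> K" for w
      using that by (simp add: JJ_linform JJ_scale)
    fix H assume H: "H \<in> hyperplanes" "K \<subseteq> H"
    show "(\<Prod>y\<in>{y \<in> Y - {x}. v y \<notin> H}. linform (v y)) \<in> {f. linform (v x) * f \<in> JJ K Y v}"
    proof (cases "v x \<in> H")
      case True
      then have "{y \<in> Y - {x}. v y \<notin> H} = {y \<in> Y. v y \<notin> H}" by auto
      then show ?thesis using H by (simp add: JJ_prod JJ_scale)
    next
      case False
      then have "{y \<in> Y. v y \<notin> H} = insert x {y \<in> Y - {x}. v y \<notin> H}" using assms(2) by auto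
      then have "linform (v x) * (\<Prod>y\<in>{y \<in> Y - {x}. v y \<notin> H}. linform (v y))
        = (\<Prod>y\<in>{y\<in>Y. v y \<notin> H}. linform (v y))" using assms(1) by simp
      then show ?thesis using H by (simp add: JJ_prod)
    qed
  qed
  then show ?thesis by simp
qed

lemma card_cart_basis [simp]: "card (cart_basis :: ('k::field, 'n::finite) vec set) = CARD('n)"
  using vec_dim_card[where ?'a = 'k and ?'n = 'n] by simp

lemma vec_dim_le: "vec.dim (K :: ('k::field, 'n::finite) vec set) \<le> CARD('n)"
  using vec.dim_subset[of K UNIV] by simp

lemma vec_dim_eq_UNIV:
  fixes K :: "('k::field, 'n::finite) vec set"
  assumes "vec.subspace K" "vec.dim K = CARD('n)"
  shows "K = UNIV"
  using assms vec.dim_eq_full[of K] by (metis card_cart_basis vec.dimension_def vec.span_eq_iff)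

text \<open>Deletion and contraction: modulo the linear form \<open>x\<close> the ideal contains the one of the
  contraction by \<open>x\<close>, and multiplication by \<open>x\<close> carries the ideal of the deletion into it.\<close>

lemma homog_in_JJ:
  fixes v :: "'y \<Rightarrow> ('k::field, 'n::{finite,linorder}) vec"
  assumes "finite Y" "vec.subspace K" "homog N f"
    "card {y\<in>Y. v y \<notin> K} + vec.dim K < N + CARD('n)"
  shows "f \<in> JJ K Y v"
  using assms
proof (induction "card {y\<in>Y. v y \<notin> K}" arbitrary: K Y N f rule: less_induct)
  case less
  \<comment> \<open>With no vector left outside \<open>K\<close>, either \<open>K\<close> is
    everything and \<open>N > 0\<close>, so each monomial of \<open>f\<close> contains a variable,
    or a hyperplane above \<open>K\<close> contributes the empty product \<open>1\<close>.\<close>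
  show ?case
  proof (cases "{y\<in>Y. v y \<notin> K} = {}")
    case True
    show ?thesis
    proof (cases "K = UNIV")
      case True
      then have "N > 0" using less.prems(4) by simp
      have "single m c \<in> JJ K Y v" if "mdeg m = N" for m c
      proof -
        have "m \<noteq> 0" using that \<open>N > 0\<close> by auto
        then obtain i where "lookup m i \<noteq> 0" by (metis lookup_zero poly_mapping_eqI)
        then have "Xv i ^ 1 dvd single m c"
          unfolding Xv_power_dvd_iff by (auto simp: lookup_single when_def)
        then obtain g where "single m c = g * linform (axis i 1)"
          by (auto simp: mult.commute elim!: dvdE)
        then show ?thesis using True by (simp add: JJ_scale JJ_linform del: linform_axis)
      qed
      note sm = this
      have "(\<Sum>m\<in>A. single m (lookup f m)) \<in> JJ K Y v" if A: "A \<subseteq> keys f" for A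
        using finite_subset[OF A finite_keys] A
      proof (induction A rule: finite_induct)
        case (insert m A)
        have "mdeg m = N" using insert.prems less.prems(3) by (auto simp: homog_def)
        then show ?case using insert by (simp add: JJ_add sm)
      qed (simp add: JJ_0)
      from this[of "keys f"] show ?thesis by (simp add: sum_singles)
    next
      case False
      obtain H where H: "H \<in> hyperplanes" "K \<subseteq> H"
        by (rule ex_hyperplane_superset[OF less.prems(2) False])
      then have "{y\<in>Y. v y \<notin> H} = {}" using True by auto
      then have "1 \<in> JJ K Y v" using JJ_prod[OF H, of v Y] by (simp only: prod.empty)
      then show ?thesis using JJ_scale[of 1 K Y v f] by simp
    qed
  next
    case False
    then obtain x where x: "x \<in> Y" "v x \<notin> K" by auto
    let ?K = "vec.span (insert (v x) K)"
    have fin: "finite {y\<in>Y. v y \<notin> K}" using less.prems(1) by simp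
    have K_sub: "K \<subseteq> ?K" using vec.span_superset[of "insert (v x) K"] by auto
    have xK: "v x \<in> ?K" by (simp add: vec.span_base)
    have card': "card {y\<in>Y. v y \<notin> ?K} < card {y\<in>Y. v y \<notin> K}"
      by (rule psubset_card_mono[OF fin]) (use x K_sub xK in auto)
    have dim': "vec.dim ?K = Suc (vec.dim K)"
      using x(2) vec.span_eq_iff[THEN iffD2, OF less.prems(2)] by (simp add: vec.dim_insert del: vec.span_eq_iff)
    \<comment> \<open>Contraction loses at least one vector and gains one dimension, so the strict
      bound persists in the same degree.\<close>
    have "f \<in> JJ ?K Y v"
      by (rule less.hyps[OF card' less.prems(1) vec.subspace_span less.prems(3)])
        (use less.prems(4) card' dim' in linarith)
    from JJ_contract[where v=v, OF less.prems(2) this]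
    obtain g where g: "f - g * linform (v x) \<in> JJ K Y v" by (elim exE)
    \<comment> \<open>\<open>g\<close> need not be homogeneous. Passing to degree \<open>N\<close>
      keeps only its component of degree \<open>N - 1\<close>, to which the deletion of
      \<open>x\<close> applies.\<close>
    have "hc N (f - g * linform (v x)) = f - hc N (linform (v x) * g)"
      by (rule hc_diff_homog[OF less.prems(3)])
    then have fg: "f - hc N (linform (v x) * g) \<in> JJ K Y v" using hc_JJ[OF g, of N] by simp
    have "hc N (linform (v x) * g) \<in> JJ K Y v"
    proof (cases N)
      case 0
      then show ?thesis by (simp add: hc_mult_homog[OF homog_linform] JJ_0)
    next
      case (Suc N')
      have "{y\<in>Y - {x}. v y \<notin> K} = {y\<in>Y. v y \<notin> K} - {x}" by auto
      then have card'': "Suc (card {y\<in>Y - {x}. v y \<notin> K}) = card {y\<in>Y. v y \<notin> K}"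
        using card_Suc_Diff1[OF fin, of x] x by simp
      have "hc N' g \<in> JJ K (Y - {x}) v"
        by (rule less.hyps[OF _ _ less.prems(2) homog_hc]) (use less.prems card'' Suc in auto)
      then show ?thesis
        using linform_mult_JJ[OF less.prems(1) x(1)] Suc by (simp add: hc_mult_homog[OF homog_linform])
    qed
    from JJ_add[OF fg this] show ?thesis by simp
  qed
qed

text \<open>By spanning and counting, \<open>b\<close> indexes a basis of a complement of
  \<open>K\<close>; the elements are the product of all forms outside \<open>K\<close> divided by
  such a basis.\<close>

definition Bs :: "('k::field, 'n::finite) vec set \<Rightarrow> 'y set \<Rightarrow> ('y \<Rightarrow> ('k, 'n) vec) \<Rightarrow> ('k, 'n) sympoly set" where
  "Bs K Y v = {\<Prod>y\<in>{y\<in>Y. v y \<notin> K} - b. linform (v y) | b. b \<subseteq> {y\<in>Y. v y \<notin> K} \<and>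
     card b + vec.dim K = CARD('n) \<and> vec.span (K \<union> v ` b) = UNIV}"

definition TT :: "('k::field, 'n::finite) vec set \<Rightarrow> 'y set \<Rightarrow> ('y \<Rightarrow> ('k, 'n) vec) \<Rightarrow> ('k, 'n) sympoly set" where
  "TT K Y v = fsp.span (JJ K Y v \<union> Bs K Y v)"

lemma TT_add: "f \<in> TT K Y v \<Longrightarrow> g \<in> TT K Y v \<Longrightarrow> f + g \<in> TT K Y v"
  unfolding TT_def by (rule fsp.span_add)

lemma TT_0: "0 \<in> TT K Y v"
  unfolding TT_def by (rule fsp.span_zero)

lemma TT_scale: "f \<in> TT K Y v \<Longrightarrow> pconst c * f \<in> TT K Y v"
  unfolding TT_def by (rule fsp.span_scale)

lemma TT_minimal:
  assumes "f \<in> TT K Y v" "fsp.subspace I" "JJ K Y v \<subseteq> I" "Bs K Y v \<subseteq> I"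
  shows "f \<in> I"
  using assms fsp.span_minimal[of "JJ K Y v \<union> Bs K Y v" I] unfolding TT_def by blast

lemma JJ_TT: "f \<in> JJ K Y v \<Longrightarrow> f \<in> TT K Y v"
  unfolding TT_def by (simp add: fsp.span_base)

lemma Bs_TT: "f \<in> Bs K Y v \<Longrightarrow> f \<in> TT K Y v"
  unfolding TT_def by (simp add: fsp.span_base)

lemma hc_TT:
  fixes v :: "'y \<Rightarrow> ('k::field, 'n::{finite,linorder}) vec"
  assumes "f \<in> TT K Y v" "finite Y" "N + CARD('n) = card {y\<in>Y. v y \<notin> K} + vec.dim K"
  shows "hc N f \<in> TT K Y v"
proof -
  have "f \<in> {f. hc N f \<in> TT K Y v}"
    using assms(1)
  proof (rule TT_minimal)
    show "fsp.subspace {f. hc N f \<in> TT K Y v}"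
      by (rule fsp.subspaceI) (auto simp: TT_0 hc_add TT_add hc_mult_homog[OF homog_pconst] TT_scale)
    show "JJ K Y v \<subseteq> {f. hc N f \<in> TT K Y v}" using hc_JJ JJ_TT by blast
    show "Bs K Y v \<subseteq> {f. hc N f \<in> TT K Y v}"
    proof
      fix f assume f: "f \<in> Bs K Y v"
      then obtain b where b: "f = (\<Prod>y\<in>{y\<in>Y. v y \<notin> K} - b. linform (v y))"
        "b \<subseteq> {y\<in>Y. v y \<notin> K}" "card b + vec.dim K = CARD('n)" by (auto simp: Bs_def)
      have "card ({y\<in>Y. v y \<notin> K} - b) = N"
        using b assms(2,3) by (simp add: card_Diff_subset finite_subset[OF b(2)])
      then have "homog N f" using homog_prod_linform[of "{y\<in>Y. v y \<notin> K} - b" v] b(1) by simp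
      then show "f \<in> {f. hc N f \<in> TT K Y v}" using f by (simp add: hc_homog Bs_TT)
    qed
  qed
  then show ?thesis by simp
qed

lemma linform_mult_TT:
  fixes v :: "'y \<Rightarrow> ('k::field, 'n::finite) vec"
  assumes "finite Y" "x \<in> Y" "v x \<notin> K" "f \<in> TT K (Y - {x}) v"
  shows "linform (v x) * f \<in> TT K Y v"
proof -
  have "f \<in> {f. linform (v x) * f \<in> TT K Y v}"
    using assms(4)
  proof (rule TT_minimal)
    show "fsp.subspace {f. linform (v x) * f \<in> TT K Y v}"
      by (rule fsp.subspaceI) (auto simp: TT_0 distrib_left TT_add mult.left_commute[of "linform (v x)"] TT_scale)
    show "JJ K (Y - {x}) v \<subseteq> {f. linform (v x) * f \<in> TT K Y v}"
      using linform_mult_JJ[OF assms(1,2)] JJ_TT by blast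
    show "Bs K (Y - {x}) v \<subseteq> {f. linform (v x) * f \<in> TT K Y v}"
    proof
      fix f assume "f \<in> Bs K (Y - {x}) v"
      then obtain b where b: "f = (\<Prod>y\<in>{y\<in>Y - {x}. v y \<notin> K} - b. linform (v y))"
        "b \<subseteq> {y\<in>Y - {x}. v y \<notin> K}" "card b + vec.dim K = CARD('n)" "vec.span (K \<union> v ` b) = UNIV"
        unfolding Bs_def by blast
      have "{y\<in>Y. v y \<notin> K} - b = insert x ({y\<in>Y - {x}. v y \<notin> K} - b)"
        using assms(2,3) b(2) by auto
      then have "linform (v x) * f = (\<Prod>y\<in>{y\<in>Y. v y \<notin> K} - b. linform (v y))"
        using b(1) assms(1) by simp
      moreover have "\<dots> \<in> Bs K Y v" unfolding Bs_def using b by blast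
      ultimately show "f \<in> {f. linform (v x) * f \<in> TT K Y v}" by (simp add: Bs_TT)
    qed
  qed
  then show ?thesis by simp
qed

text \<open>The same recursion in the critical degree. If contraction by \<open>x\<close> removes no
  other vector, the degree stays critical; if it removes more, the degree exceeds the bound for the
  contraction and \<open>homog_in_JJ\<close> applies.\<close>

lemma homog_in_TT:
  fixes v :: "'y \<Rightarrow> ('k::field, 'n::{finite,linorder}) vec"
  assumes "finite Y" "vec.subspace K" "homog N f"
    "N + CARD('n) = card {y\<in>Y. v y \<notin> K} + vec.dim K"
  shows "f \<in> TT K Y v"
  using assms
proof (induction "card {y\<in>Y. v y \<notin> K}" arbitrary: K Y N f rule: less_induct)
  case less
  show ?case
  proof (cases "{y\<in>Y. v y \<notin> K} = {}")
    case True
    then have "N = 0" "vec.dim K = CARD('n)"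
      using less.prems(4) vec_dim_le[of K] by (simp_all only: card.empty)
    then have "K = UNIV" "f = pconst (lookup f 0)"
      using vec_dim_eq_UNIV[OF less.prems(2)] homog_0D less.prems(3) by auto
    moreover have "1 \<in> Bs K Y v"
      unfolding Bs_def using \<open>K = UNIV\<close> \<open>vec.dim K = CARD('n)\<close>
      by (intro CollectI exI[of _ "{}"]) (auto simp: vec.span_UNIV)
    ultimately show ?thesis using TT_scale[OF Bs_TT, of 1 K Y v "lookup f 0"] by simp
  next
    case False
    then obtain x where x: "x \<in> Y" "v x \<notin> K" by auto
    let ?K = "vec.span (insert (v x) K)"
    have fin: "finite {y\<in>Y. v y \<notin> K}" using less.prems(1) by simp
    have K_sub: "K \<subseteq> ?K" using vec.span_superset[of "insert (v x) K"] by auto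
    have xK: "v x \<in> ?K" by (simp add: vec.span_base)
    have sub: "{y\<in>Y. v y \<notin> ?K} \<subseteq> {y\<in>Y. v y \<notin> K} - {x}" using K_sub xK by auto
    have card': "card {y\<in>Y. v y \<notin> ?K} < card {y\<in>Y. v y \<notin> K}"
      by (rule psubset_card_mono[OF fin]) (use x K_sub xK in auto)
    have card1: "Suc (card ({y\<in>Y. v y \<notin> K} - {x})) = card {y\<in>Y. v y \<notin> K}"
      using card_Suc_Diff1[OF fin, of x] x by simp
    have dim': "vec.dim ?K = Suc (vec.dim K)"
      using x(2) vec.span_eq_iff[THEN iffD2, OF less.prems(2)] by (simp add: vec.dim_insert del: vec.span_eq_iff)
    have contr: "\<exists>g. h - g * linform (v x) \<in> TT K Y v" if "h \<in> JJ ?K Y v" for h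
      using JJ_contract[OF less.prems(2) that] JJ_TT by blast
    have "\<exists>g. f - g * linform (v x) \<in> TT K Y v"
    proof (cases "{y\<in>Y. v y \<notin> ?K} = {y\<in>Y. v y \<notin> K} - {x}")
      case True
      have "f \<in> TT ?K Y v"
        using less.prems card1 dim' True by (intro less.hyps[OF card' less.prems(1) _ less.prems(3)]) auto
      then have "f \<in> {f. \<exists>g. f - g * linform (v x) \<in> TT K Y v}"
      proof (rule TT_minimal)
        show "fsp.subspace {f. \<exists>g. f - g * linform (v x) \<in> TT K Y v}"
        proof (rule fsp.subspaceI)
          fix c h assume "h \<in> {f. \<exists>g. f - g * linform (v x) \<in> TT K Y v}"
          then obtain g where "h - g * linform (v x) \<in> TT K Y v" by auto
          then have "pconst c * h - (pconst c * g) * linform (v x) \<in> TT K Y v"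
            using TT_scale[of "h - g * linform (v x)" K Y v c] by (simp add: algebra_simps)
          then show "pconst c * h \<in> {f. \<exists>g. f - g * linform (v x) \<in> TT K Y v}" by blast
        next
          fix h h' assume "h \<in> {f. \<exists>g. f - g * linform (v x) \<in> TT K Y v}" "h' \<in> {f. \<exists>g. f - g * linform (v x) \<in> TT K Y v}"
          then obtain g g' where "h - g * linform (v x) \<in> TT K Y v" "h' - g' * linform (v x) \<in> TT K Y v" by auto
          from TT_add[OF this] have "(h + h') - (g + g') * linform (v x) \<in> TT K Y v"
            by (simp add: algebra_simps)
          then show "h + h' \<in> {f. \<exists>g. f - g * linform (v x) \<in> TT K Y v}" by blast
        qed (use TT_0 in \<open>auto intro!: exI[of _ 0]\<close>)
        show "JJ ?K Y v \<subseteq> {f. \<exists>g. f - g * linform (v x) \<in> TT K Y v}" using contr by blast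
        show "Bs ?K Y v \<subseteq> {f. \<exists>g. f - g * linform (v x) \<in> TT K Y v}"
        proof
          fix h assume "h \<in> Bs ?K Y v"
          then obtain b where b: "h = (\<Prod>y\<in>{y\<in>Y. v y \<notin> ?K} - b. linform (v y))"
            "b \<subseteq> {y\<in>Y. v y \<notin> ?K}" "card b + vec.dim ?K = CARD('n)" "vec.span (?K \<union> v ` b) = UNIV"
            by (auto simp: Bs_def)
          have "x \<notin> b" using b(2) sub by blast
          \<comment> \<open>Since only \<open>x\<close> was absorbed, adjoining \<open>x\<close> to
            \<open>b\<close> gives a basis of a complement of \<open>K\<close> and leaves the
            product unchanged.\<close>
          have "{y\<in>Y. v y \<notin> ?K} - b = {y\<in>Y. v y \<notin> K} - insert x b" using True by auto
          moreover have "insert x b \<subseteq> {y\<in>Y. v y \<notin> K}" using b(2) sub x by blast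
          moreover have "card (insert x b) + vec.dim K = CARD('n)"
            using b(3) dim' \<open>x \<notin> b\<close> finite_subset[OF b(2)] less.prems(1) by simp
          moreover have "vec.span (K \<union> v ` insert x b) = UNIV"
          proof -
            have "?K \<union> v ` b \<subseteq> vec.span (K \<union> v ` insert x b)"
              using vec.span_mono[of "insert (v x) K" "K \<union> v ` insert x b"]
                vec.span_superset[of "K \<union> v ` insert x b"] by auto
            then have "vec.span (?K \<union> v ` b) \<subseteq> vec.span (K \<union> v ` insert x b)"
              by (simp add: vec.span_minimal)
            then show ?thesis using b(4) by auto
          qed
          ultimately have "h \<in> Bs K Y v" unfolding Bs_def b(1) by (intro CollectI exI[of _ "insert x b"]) auto
          then show "h \<in> {f. \<exists>g. f - g * linform (v x) \<in> TT K Y v}" using Bs_TT by (auto intro!: exI[of _ 0])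
        qed
      qed
      then show ?thesis by simp
    next
      case False
      then have "card {y\<in>Y. v y \<notin> ?K} < card ({y\<in>Y. v y \<notin> K} - {x})"
        using sub fin by (intro psubset_card_mono) auto
      then have "f \<in> JJ ?K Y v"
        using less.prems card1 dim' by (intro homog_in_JJ[OF less.prems(1) _ less.prems(3)]) auto
      then show ?thesis by (rule contr)
    qed
    then obtain g where g: "f - g * linform (v x) \<in> TT K Y v" by blast
    have "hc N (f - g * linform (v x)) = f - hc N (linform (v x) * g)"
      by (rule hc_diff_homog[OF less.prems(3)])
    then have fg: "f - hc N (linform (v x) * g) \<in> TT K Y v"
      using hc_TT[OF g less.prems(1,4)] by simp
    have "hc N (linform (v x) * g) \<in> TT K Y v"
    proof (cases N)
      case 0
      then show ?thesis by (simp add: hc_mult_homog[OF homog_linform] TT_0)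
    next
      case (Suc N')
      have "{y\<in>Y - {x}. v y \<notin> K} = {y\<in>Y. v y \<notin> K} - {x}" by auto
      then have card'': "Suc (card {y\<in>Y - {x}. v y \<notin> K}) = card {y\<in>Y. v y \<notin> K}"
        using card1 by simp
      have "hc N' g \<in> TT K (Y - {x}) v"
        by (rule less.hyps[OF _ _ less.prems(2) homog_hc]) (use less.prems card'' Suc in simp_all)
      then show ?thesis
        using linform_mult_TT[where v=v, OF less.prems(1) x] Suc by (simp add: hc_mult_homog[OF homog_linform])
    qed
    from TT_add[OF fg this] show ?thesis by simp
  qed
qed

section \<open>The ideal \<open>Iid k\<close> as a cocircuit ideal\<close>

lemma Iid_eq_span: "(Iid k :: ('k::{field,finite}, 'n::finite) sympoly set) = idl.span ((\<lambda>H. VH H ^ k) ` hyperplanes)"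
proof
  show "Iid k \<subseteq> idl.span ((\<lambda>H. VH H ^ k) ` (hyperplanes :: ('k, 'n) vec set set))"
  proof
    fix f :: "('k, 'n) sympoly" assume "f \<in> Iid k"
    then obtain c where f: "f = (\<Sum>H\<in>hyperplanes. c H * VH H ^ k)" unfolding Iid_def by blast
    show "f \<in> idl.span ((\<lambda>H. VH H ^ k) ` hyperplanes)"
      unfolding f by (intro idl.span_sum idl.span_scale idl.span_base imageI)
  qed
  show "idl.span ((\<lambda>H. VH H ^ k) ` (hyperplanes :: ('k, 'n) vec set set)) \<subseteq> Iid k"
  proof (rule idl.span_minimal)
    show "(\<lambda>H. VH H ^ k) ` hyperplanes \<subseteq> (Iid k :: ('k, 'n) sympoly set)"
    proof
      fix f assume "f \<in> (\<lambda>H. VH H ^ k) ` (hyperplanes :: ('k, 'n) vec set set)"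
      then obtain H where H: "H \<in> hyperplanes" "f = VH H ^ k" by auto
      have "f = (\<Sum>H'\<in>hyperplanes. (if H' = H then 1 else 0) * VH H' ^ k)"
        using H by (simp add: if_distrib[of "\<lambda>c. c * _"] cong: if_cong)
      then show "f \<in> Iid k" unfolding Iid_def by (intro CollectI exI[of _ "\<lambda>H'. if H' = H then 1 else 0"])
    qed
    show "idl.subspace (Iid k :: ('k, 'n) sympoly set)"
    proof (rule idl.subspaceI)
      have "0 = (\<Sum>H\<in>hyperplanes. 0 * VH H ^ k :: ('k, 'n) sympoly)" by simp
      then show "(0 :: ('k, 'n) sympoly) \<in> Iid k" unfolding Iid_def by (intro CollectI exI[of _ "\<lambda>_. 0"])
    next
      fix f g :: "('k, 'n) sympoly" assume "f \<in> Iid k" "g \<in> Iid k"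
      then obtain c c' where "f = (\<Sum>H\<in>hyperplanes. c H * VH H ^ k)" "g = (\<Sum>H\<in>hyperplanes. c' H * VH H ^ k)"
        unfolding Iid_def by blast
      then have "f + g = (\<Sum>H\<in>hyperplanes. (c H + c' H) * VH H ^ k)"
        by (simp add: distrib_right sum.distrib)
      then show "f + g \<in> Iid k" unfolding Iid_def by (intro CollectI exI[of _ "\<lambda>H. c H + c' H"])
    next
      fix a f :: "('k, 'n) sympoly" assume "f \<in> Iid k"
      then obtain c where "f = (\<Sum>H\<in>hyperplanes. c H * VH H ^ k)" unfolding Iid_def by blast
      then have "a * f = (\<Sum>H\<in>hyperplanes. (a * c H) * VH H ^ k)"
        by (simp add: sum_distrib_left mult.assoc)
      then show "a * f \<in> Iid k" unfolding Iid_def by (intro CollectI exI[of _ "\<lambda>H. a * c H"])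
    qed
  qed
qed

lemma Iid_0 [simp]: "0 \<in> Iid k"
  unfolding Iid_eq_span by (rule idl.span_zero)

lemma Iid_add: "f \<in> Iid k \<Longrightarrow> g \<in> Iid k \<Longrightarrow> f + g \<in> Iid k"
  unfolding Iid_eq_span by (rule idl.span_add)

lemma Iid_scale: "f \<in> Iid k \<Longrightarrow> c * f \<in> Iid k"
  unfolding Iid_eq_span by (rule idl.span_scale)

lemma Iid_VH: "H \<in> hyperplanes \<Longrightarrow> VH H ^ k \<in> Iid k"
  unfolding Iid_eq_span by (rule idl.span_base) simp

lemma hyperplane_subspace: "H \<in> hyperplanes \<Longrightarrow> vec.subspace H"
  by (simp add: hyperplanes_def)

lemma prod_copies:
  fixes F :: "'b \<Rightarrow> 'c::comm_semiring_1"
  shows "(\<Prod>y\<in>A \<times> {..<k}. F (fst y)) = (\<Prod>u\<in>A. F u) ^ (k::nat)"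
proof -
  have "(\<Prod>y\<in>A \<times> {..<k}. F (fst y)) = (\<Prod>u\<in>A. \<Prod>_\<in>{..<k}. F u)"
    unfolding prod.cartesian_product by (simp add: case_prod_unfold)
  then show ?thesis by (simp add: prod_power_distrib[symmetric])
qed

text \<open>For \<open>k\<close> copies of every monic vector and nothing contracted, the cocircuit
  products are the powers \<open>VH H ^ k\<close> up to scalars.\<close>

lemma JJ_subset_Iid:
  "JJ {0} ((Mons :: ('k::{field,finite}, 'n::{finite,linorder}) vec set) \<times> {..<k}) fst \<subseteq> Iid k"
proof
  fix f assume "f \<in> JJ {0} ((Mons :: ('k, 'n) vec set) \<times> {..<k}) fst"
  then show "f \<in> Iid k"
  proof (rule JJ_minimal)
    show "idl.subspace (Iid k :: ('k, 'n) sympoly set)" unfolding Iid_eq_span by (rule idl.subspace_span)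
    fix H :: "('k, 'n) vec set" assume H: "H \<in> hyperplanes"
    obtain c where c: "c \<noteq> 0" "VH H = pconst c * (\<Prod>u\<in>Mons - H. linform u)"
      by (rule VH_eq[OF hyperplane_subspace[OF H]])
    have "{y \<in> Mons \<times> {..<k}. fst y \<notin> H} = (Mons - H) \<times> {..<k}" by auto
    then have "(\<Prod>y\<in>{y \<in> Mons \<times> {..<k}. fst y \<notin> H}. linform (fst y)) = (\<Prod>u\<in>Mons - H. linform u) ^ k"
      by (simp add: prod_copies)
    also have "\<dots> = pconst (inverse c ^ k) * VH H ^ k"
      using c(1) unfolding c(2) power_mult_distrib pconst_power mult.assoc[symmetric]
      by (simp add: pconst_mult[symmetric] pconst_power[symmetric] power_mult_distrib[symmetric])
    also have "\<dots> \<in> Iid k" by (intro Iid_scale Iid_VH H)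
    finally show "(\<Prod>y\<in>{y \<in> Mons \<times> {..<k}. fst y \<notin> H}. linform (fst y)) \<in> Iid k" .
  qed simp
qed

lemma card_copies_nonzero:
  "card {y \<in> (Mons :: ('k::{field,finite}, 'n::{finite,linorder}) vec set) \<times> {..<k}. fst y \<notin> {0}}
    = k * card (Mons :: ('k, 'n) vec set)"
proof -
  have "{y \<in> (Mons :: ('k, 'n) vec set) \<times> {..<k}. fst y \<notin> {0}} = Mons \<times> {..<k}"
    by (auto dest: Mons_neq_0)
  then show ?thesis by simp
qed

text \<open>The bound of \<open>homog_in_JJ\<close> for \<open>k\<close> copies of the monic
  vectors; its critical degree is \<open>d\<close>, so this is the vanishing above
  \<open>d\<close>.\<close>

lemma homog_in_Iid:
  fixes f :: "('k::{field,finite}, 'n::{finite,linorder}) sympoly"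
  assumes "homog N f" "k * card (Mons :: ('k, 'n) vec set) < N + CARD('n)"
  shows "f \<in> Iid k"
proof -
  have "f \<in> JJ {0} ((Mons :: ('k, 'n) vec set) \<times> {..<k}) fst"
    by (rule homog_in_JJ[OF _ _ assms(1)]) (use assms(2) card_copies_nonzero[where ?'k = 'k and ?'n = 'n, of k] in
        \<open>simp_all add: vec.dim_insert vec.subspace_0\<close>)
  then show ?thesis using JJ_subset_Iid by blast
qed

text \<open>For \<open>k \<ge> 1\<close> this is the quotient of \<open>Lam ^ k\<close> by the
  product of all variables, possible since the axis vectors are monic.\<close>

definition Ek :: "nat \<Rightarrow> ('k::{field,finite}, 'n::{finite,linorder}) sympoly" where
  "Ek k = Lam ^ (k - 1) * (\<Prod>u\<in>Mons - range (\<lambda>i. axis i 1). linform u)"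

lemma Ek_mult:
  assumes "k \<ge> 1"
  shows "(Ek k :: ('k::{field,finite}, 'n::{finite,linorder}) sympoly) * (\<Prod>i\<in>UNIV. Xv i) = Lam ^ k"
proof -
  have sub: "range (\<lambda>i. axis i 1) \<subseteq> (Mons :: ('k, 'n) vec set)"
    by (auto simp: Mons_def Mon_def axis_def)
  have "(\<Prod>u\<in>range (\<lambda>i. axis i 1). linform (u :: ('k, 'n) vec)) = (\<Prod>i\<in>UNIV. Xv i)"
    by (subst prod.reindex) (auto simp: inj_def axis_eq_axis)
  then have "(\<Prod>u\<in>Mons - range (\<lambda>i. axis i 1). linform (u :: ('k, 'n) vec)) * (\<Prod>i\<in>UNIV. Xv i) = Lam"
    unfolding Lam_def using prod.subset_diff[OF sub finite, of linform] by simp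
  then show ?thesis using assms unfolding Ek_def mult.assoc by (simp flip: power_Suc2)
qed

section \<open>Leading indices and unitriangular matrices\<close>

lemma invertible_span:
  fixes g :: "(('k::field, 'n::finite) vec, 'n) vec"
  assumes "vec.span (range (($) g)) = UNIV"
  shows "invertible g"
proof -
  have d: "vec.dim (UNIV :: ('k, 'n) vec set) = CARD('n)" by (rule vec_dim_card)
  have "CARD('n) \<le> card (range (($) g))"
    using vec.dim_le_card[of UNIV "range (($) g)"] assms d by simp
  then have c: "card (range (($) g)) = CARD('n)" using card_image_le[of UNIV "($) g"] by simp
  moreover have "vec.independent (range (($) g))"
    using vec.card_le_dim_spanning[of "range (($) g)" UNIV] assms c d by simp
  ultimately show ?thesis by (simp add: invertible_rows eq_card_imp_inj_on)
qed

text \<open>A permutation preserves the sum of all positions, while moving an index upwards lowers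
  its position.\<close>

lemma inj_ge_imp_id:
  fixes \<rho> :: "'n::{finite,linorder} \<Rightarrow> 'n"
  assumes "inj \<rho>" "\<And>i. i \<le> \<rho> i"
  shows "\<rho> i = i"
proof -
  have "bij \<rho>" using assms(1) by (simp add: bij_def finite_UNIV_inj_surj)
  then have "(\<Sum>i\<in>UNIV. pos (\<rho> i)) = (\<Sum>i\<in>UNIV. pos (i :: 'n))"
    using sum.reindex_bij_betw[of \<rho> UNIV UNIV pos] by simp
  moreover have le: "pos (\<rho> i) \<le> pos i" for i
    using assms(2)[of i] pos_less_iff[of i "\<rho> i"] by (cases "\<rho> i = i") auto
  ultimately have "pos (\<rho> i) = pos i"
    using sum_strict_mono_ex1[of UNIV "\<lambda>i. pos (\<rho> i)" pos] by (metis UNIV_I finite le_neq_implies_less less_irrefl)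
  then show ?thesis by (simp add: pos_inj)
qed

lemma det_upper:
  fixes A :: "(('a::comm_ring_1, 'n::{finite,linorder}) vec, 'n) vec"
  assumes "\<And>i j. j < i \<Longrightarrow> A $ i $ j = 0"
  shows "det A = (\<Prod>i\<in>UNIV. A $ i $ i)"
proof -
  have "of_int (sign p) * (\<Prod>i\<in>UNIV. A $ i $ p i) = (if p = id then \<Prod>i\<in>UNIV. A $ i $ i else 0)"
    if p: "p permutes UNIV" for p
  proof (cases "p = id")
    case False
    then obtain i where "p i < i" using inj_ge_imp_id[OF permutes_inj[OF p]] by (metis eq_id_iff not_less)
    then have "A $ i $ p i = 0" using assms by simp
    then have "(\<Prod>i\<in>UNIV. A $ i $ p i) = 0" by (meson UNIV_I finite prod_zero)
    then show ?thesis using False by simp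
  qed (simp add: sign_id)
  then have "det A = (\<Sum>p | p permutes (UNIV :: 'n set). if p = id then \<Prod>i\<in>UNIV. A $ i $ i else 0)"
    unfolding det_def by (intro sum.cong) auto
  then show ?thesis by (simp add: permutes_id finite_permutations)
qed

lemma ly_ex:
  fixes v :: "('k::field, 'n::{finite,linorder}) vec"
  assumes "v \<noteq> 0"
  shows "\<exists>!l. v $ l \<noteq> 0 \<and> (\<forall>j<l. v $ j = 0)"
proof -
  obtain l where "v $ l \<noteq> 0" "\<And>j. j < l \<Longrightarrow> v $ j = 0" using lead_ex[OF assms] by blast
  then show ?thesis by (intro ex1I[of _ l]) (use not_less_iff_gr_or_eq in blast)+
qed

text \<open>The index of the first nonzero entry, which is determined for nonzero vectors.\<close>

definition ly :: "('k::field, 'n::{finite,linorder}) vec \<Rightarrow> 'n" where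
  "ly v = (THE l. v $ l \<noteq> 0 \<and> (\<forall>j<l. v $ j = 0))"

lemma ly_props:
  fixes v :: "('k::field, 'n::{finite,linorder}) vec"
  assumes "v \<noteq> 0"
  shows "v $ ly v \<noteq> 0" "j < ly v \<Longrightarrow> v $ j = 0"
  using theI'[OF ly_ex[OF assms], folded ly_def] by blast+

lemma ly_greater:
  fixes v :: "('k::field, 'n::{finite,linorder}) vec"
  assumes "v \<noteq> 0" "\<And>j. j \<le> l \<Longrightarrow> v $ j = 0"
  shows "l < ly v"
  using ly_props(1)[OF assms(1)] assms(2)[of "ly v"] by (meson not_less)

lemma Unip_iff: "u \<in> Unip \<longleftrightarrow> (\<forall>i. u $ i \<in> Mon i)"
proof
  assume u: "\<forall>i. u $ i \<in> Mon i"
  then have "det u = (\<Prod>i\<in>UNIV. u $ i $ i)" by (intro det_upper) (auto simp: Mon_def)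
  then have "det u = 1" using u by (simp add: Mon_def)
  then show "u \<in> Unip" using u by (auto simp: Unip_def Borel_def GLn_def invertible_det_nz Mon_def)
qed (auto simp: Unip_def Borel_def Mon_def)

lemma det_Unip: "u \<in> Unip \<Longrightarrow> det u = 1"
  using det_upper[of u] by (auto simp: Unip_def Borel_def)

lemma invertible_row_nonzero:
  fixes g :: "(('k::field, 'n::finite) vec, 'n) vec"
  assumes "invertible g"
  shows "g $ i \<noteq> 0"
  using assms unfolding invertible_rows by (metis rangeI vec.dependent_zero)

lemma det_row_comb:
  fixes g :: "(('k::field, 'n::finite) vec, 'n) vec"
  assumes "i \<noteq> j"
  shows "det (\<chi> r. if r = i then b *s g $ i - a *s g $ j else g $ r) = b * det g"
proof -
  have "det (\<chi> r. if r = i then b *s g $ i - a *s g $ j else g $ r)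
    = det (\<chi> r. if r = i then b *s g $ i + (- a) *s g $ j else g $ r)"
    by (rule arg_cong[of _ _ det]) (simp add: vec_eq_iff)
  also have "\<dots> = b * det (\<chi> r. if r = i then g $ i else g $ r) - a * det (\<chi> r. if r = i then g $ j else g $ r)"
    unfolding det_row_add det_row_mul by simp
  also have "det (\<chi> r. if r = i then g $ j else g $ r) = 0"
    by (rule det_identical_rows[OF assms]) (use assms in \<open>simp add: row_def vec_eq_iff\<close>)
  also have "(\<chi> r. if r = i then g $ i else g $ r) = g" by (simp add: vec_eq_iff)
  finally show ?thesis by simp
qed

context fq
begin

text \<open>Obtained by applying \<open>g\<close> to the relation in \<open>Ek_mult\<close>. Thus
  the quotients of \<open>Lam ^ k\<close> by the rows of invertible matrices are, up to scalars, the
  translates of \<open>Ek k\<close>.\<close>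

lemma Ek_gl_act:
  fixes g :: "(('k, 'n::{finite,linorder}) vec, 'n) vec"
  assumes "k \<ge> 1"
  shows "gl_act (Ek k) g * (\<Prod>i\<in>UNIV. linform (g $ i)) = pconst (det g ^ k) * Lam ^ k"
proof -
  have "gl_act (Ek k * (\<Prod>i\<in>UNIV. Xv i)) g = gl_act (Lam ^ k) g" by (simp add: Ek_mult[OF assms])
  then show ?thesis
    by (simp add: gl_act_simps gl_act_Xv gl_act_Lam power_mult_distrib pconst_power)
qed

text \<open>For copies of the monic vectors the basis indexed by \<open>b\<close> forms the rows of
  an invertible matrix, and the element of \<open>Bs\<close> is the quotient of
  \<open>Lam ^ k\<close> by these rows.\<close>

lemma homog_in_span_Ek:
  fixes f :: "('k, 'n::{finite,linorder}) sympoly"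
  assumes "k \<ge> 1" "homog N f" "N + CARD('n) = k * card (Mons :: ('k, 'n) vec set)"
  shows "f \<in> fsp.span (Iid k \<union> {P. \<exists>g\<in>GLn. P * (\<Prod>i\<in>UNIV. linform (g $ i)) = Lam ^ k})"
    (is "_ \<in> fsp.span (_ \<union> ?Q)")
proof -
  let ?Y = "(Mons :: ('k, 'n) vec set) \<times> {..<k}"
  have "f \<in> TT {0} ?Y fst"
    by (rule homog_in_TT[OF _ _ assms(2)])
      (use assms(3) card_copies_nonzero[where ?'k = 'k and ?'n = 'n, of k] in
        \<open>simp_all add: vec.dim_insert vec.subspace_0\<close>)
  then show ?thesis
  proof (rule TT_minimal)
    show "fsp.subspace (fsp.span (Iid k \<union> ?Q))" by (rule fsp.subspace_span)
    show "JJ {0} ?Y fst \<subseteq> fsp.span (Iid k \<union> ?Q)"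
      using JJ_subset_Iid fsp.span_superset[of "Iid k \<union> ?Q"] by blast
    show "Bs {0} ?Y fst \<subseteq> fsp.span (Iid k \<union> ?Q)"
    proof
      fix P assume "P \<in> Bs {0} ?Y fst"
      moreover have nz: "{y \<in> ?Y. fst y \<notin> {0}} = ?Y" by (auto dest: Mons_neq_0)
      ultimately obtain b where b: "P = (\<Prod>y\<in>?Y - b. linform (fst y))" "b \<subseteq> ?Y"
        "card b = CARD('n)" "vec.span ({0} \<union> fst ` b) = UNIV"
        unfolding Bs_def nz by (auto simp: vec.dim_insert)
      have fb: "finite b" using b(2) by (rule finite_subset) simp
      obtain \<beta> where \<beta>: "bij_betw \<beta> (UNIV :: 'n set) b"
        using b(3) fb by (metis finite finite_same_card_bij)
      define g :: "(('k, 'n) vec, 'n) vec" where "g = (\<chi> i. fst (\<beta> i))"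
      have r: "range (($) g) = fst ` b"
        using \<beta> unfolding g_def bij_betw_def by auto
      have "vec.span (insert 0 (fst ` b)) = vec.span (fst ` b)"
        by (rule vec.span_insert_0)
      then have "invertible g" by (intro invertible_span) (use b(4) r in simp)
      moreover have "P * (\<Prod>i\<in>UNIV. linform (g $ i)) = Lam ^ k"
      proof -
        have "(\<Prod>i\<in>UNIV. linform (g $ i)) = (\<Prod>y\<in>b. linform (fst y))"
          using prod.reindex_bij_betw[OF \<beta>, of "\<lambda>y. linform (fst y)"] by (simp add: g_def)
        then have "P * (\<Prod>i\<in>UNIV. linform (g $ i)) = (\<Prod>y\<in>?Y. linform (fst y))"
          unfolding b(1) using prod.subset_diff[OF b(2), of "\<lambda>y. linform (fst y)"] by simp
        then show ?thesis by (simp add: prod_copies Lam_def)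
      qed
      ultimately have "P \<in> ?Q" by (auto simp: GLn_def)
      then show "P \<in> fsp.span (Iid k \<union> ?Q)" by (simp add: fsp.span_base)
    qed
  qed
qed

text \<open>If rows \<open>i\<close> and \<open>j\<close> share a leading index, then
  \<open>w = b g_i - a g_j\<close> has a later one, and
  \<open>1 / (g_i g_j) = b / (w g_j) - a / (g_i w)\<close> writes \<open>P\<close> in terms of two
  quotients with smaller sum of positions. If the leading indices are distinct, sorting and scaling
  the rows gives a unitriangular matrix.\<close>

lemma straighten:
  fixes g :: "(('k, 'n::{finite,linorder}) vec, 'n) vec"
  assumes "k \<ge> 1" "invertible g" "P * (\<Prod>i\<in>UNIV. linform (g $ i)) = Lam ^ k"
  shows "P \<in> fsp.span (gl_act (Ek k) ` Unip)"
  using assms(2,3)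
proof (induction "\<Sum>i\<in>UNIV. pos (ly (g $ i))" arbitrary: g P rule: less_induct)
  case less
  note nz = invertible_row_nonzero[OF less.prems(1)]
  show ?case
  proof (cases "inj (\<lambda>i. ly (g $ i))")
    case False
    then obtain i j where ij: "i \<noteq> j" "ly (g $ i) = ly (g $ j)" by (auto simp: inj_def)
    define l a b where "l = ly (g $ i)" and "a = g $ i $ l" and "b = g $ j $ l"
    have ab: "a \<noteq> 0" "b \<noteq> 0" using ly_props(1)[OF nz[of i]] ly_props(1)[OF nz[of j]] ij by (auto simp: a_def b_def l_def)
    define w where "w = b *s g $ i - a *s g $ j"
    have w0: "w $ m = 0" if "m \<le> l" for m
      using ly_props(2)[OF nz[of i], of m] ly_props(2)[OF nz[of j], of m] ij that
      by (cases "m = l") (auto simp: w_def a_def b_def l_def)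
    define g1 g2 :: "(('k, 'n) vec, 'n) vec"
      where "g1 = (\<chi> r. if r = i then w else g $ r)" and "g2 = (\<chi> r. if r = j then w else g $ r)"
    \<comment> \<open>The signs adapt \<open>w\<close> to \<open>det_row_comb\<close> with the roles
      of \<open>i\<close> and \<open>j\<close> exchanged.\<close>
    have g2w: "(- a) *s g $ j - (- b) *s g $ i = b *s g $ i - a *s g $ j" by (simp add: vec_eq_iff)
    have "det g1 = b * det g" unfolding g1_def w_def by (rule det_row_comb[OF ij(1)])
    moreover have "det g2 = - (a * det g)"
      using det_row_comb[of j i "- a" g "- b"] ij(1) unfolding g2_def w_def g2w by simp
    ultimately have inv: "invertible g1" "invertible g2"
      using ab less.prems(1) by (simp_all add: invertible_det_nz)
    have "g1 $ i = w" by (simp add: g1_def)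
    then have "w \<noteq> 0" using invertible_row_nonzero[OF inv(1), of i] by simp
    then have "l < ly w" using w0 by (rule ly_greater)
    then have lyw: "pos (ly w) < pos l" by (rule pos_less)
    have m1: "(\<Sum>r\<in>UNIV. pos (ly (g1 $ r))) < (\<Sum>r\<in>UNIV. pos (ly (g $ r)))"
      by (rule sum_strict_mono_ex1) (use lyw in \<open>auto simp: g1_def l_def\<close>)
    have m2: "(\<Sum>r\<in>UNIV. pos (ly (g2 $ r))) < (\<Sum>r\<in>UNIV. pos (ly (g $ r)))"
      by (rule sum_strict_mono_ex1) (use lyw ij in \<open>auto simp: g2_def l_def\<close>)
    have quot: "\<exists>P. P * (\<Prod>i\<in>UNIV. linform (h $ i)) = Lam ^ k" if "invertible h" for h :: "(('k, 'n) vec, 'n) vec"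
    proof
      have "det h \<noteq> 0" using that by (simp add: invertible_det_nz)
      then have "pconst (inverse (det h ^ k)) * pconst (det h ^ k) = (1 :: ('k, 'n) sympoly)"
        by (simp flip: pconst_mult)
      then show "(pconst (inverse (det h ^ k)) * gl_act (Ek k) h) * (\<Prod>i\<in>UNIV. linform (h $ i)) = Lam ^ k"
        unfolding mult.assoc Ek_gl_act[OF assms(1)] by (simp flip: mult.assoc)
    qed
    obtain P1 P2 where P12: "P1 * (\<Prod>i\<in>UNIV. linform (g1 $ i)) = Lam ^ k" "P2 * (\<Prod>i\<in>UNIV. linform (g2 $ i)) = Lam ^ k"
      using quot[OF inv(1)] quot[OF inv(2)] by blast
    let ?R = "\<Prod>r\<in>UNIV - {i} - {j}. linform (g $ r)"
    have split: "(\<Prod>r\<in>UNIV. F r) = F i * (F j * (\<Prod>r\<in>UNIV - {i} - {j}. F r))" for F :: "'n \<Rightarrow> ('k, 'n) sympoly"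
      using ij(1) prod.remove[of UNIV i F] prod.remove[of "UNIV - {i}" j F] by simp
    have e: "P * (linform (g $ i) * (linform (g $ j) * ?R)) = Lam ^ k"
      using less.prems(2) unfolding split .
    have "(\<Prod>i\<in>UNIV. linform (g1 $ i)) = linform w * (linform (g $ j) * ?R)"
      unfolding split using ij(1) by (simp add: g1_def)
    then have e1: "P1 * (linform w * (linform (g $ j) * ?R)) = Lam ^ k" using P12(1) by simp
    have "(\<Prod>i\<in>UNIV. linform (g2 $ i)) = linform (g $ i) * (linform w * ?R)"
      unfolding split using ij(1) by (simp add: g2_def)
    then have e2: "P2 * (linform (g $ i) * (linform w * ?R)) = Lam ^ k" using P12(2) by simp
    have lw: "linform w = pconst b * linform (g $ i) - pconst a * linform (g $ j)"
      by (simp add: w_def linform_diff linform_scale)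
    \<comment> \<open>The partial fraction identity with all denominators cleared.\<close>
    have "(pconst b * P1 - pconst a * P2) * (linform w * (linform (g $ i) * (linform (g $ j) * ?R)))
      = pconst b * linform (g $ i) * (P1 * (linform w * (linform (g $ j) * ?R)))
        - pconst a * linform (g $ j) * (P2 * (linform (g $ i) * (linform w * ?R)))"
      by (simp only: left_diff_distrib right_diff_distrib ac_simps)
    also have "\<dots> = linform w * Lam ^ k"
      unfolding e1 e2 by (simp only: lw left_diff_distrib)
    also have "\<dots> = P * (linform w * (linform (g $ i) * (linform (g $ j) * ?R)))"
      unfolding e[symmetric] by (simp only: ac_simps)
    finally have "pconst b * P1 - pconst a * P2 = P"
    proof (rule mult_right_cancel[THEN iffD1, rotated])
      show "linform w * (linform (g $ i) * (linform (g $ j) * ?R)) \<noteq> 0"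
        using \<open>w \<noteq> 0\<close> nz by simp
    qed
    moreover have "P1 \<in> fsp.span (gl_act (Ek k) ` Unip)" "P2 \<in> fsp.span (gl_act (Ek k) ` Unip)"
      using less.hyps[OF m1 inv(1) P12(1)] less.hyps[OF m2 inv(2) P12(2)] by auto
    ultimately show ?thesis by (metis fsp.span_diff fsp.span_scale)
  next
    case True
    then have bij: "bij (\<lambda>i. ly (g $ i))" by (simp add: bij_def finite_UNIV_inj_surj)
    \<comment> \<open>\<open>\<rho> l\<close> is the row whose leading index is
      \<open>l\<close>.\<close>
    define \<rho> where "\<rho> = inv (\<lambda>i. ly (g $ i))"
    have bij': "bij \<rho>" unfolding \<rho>_def using bij by (rule bij_imp_bij_inv)
    have ly\<rho>: "ly (g $ \<rho> l) = l" for l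
      unfolding \<rho>_def using bij by (simp add: bij_is_surj surj_f_inv_f[where f="\<lambda>i. ly (g $ i)"])
    define c where "c l = g $ \<rho> l $ l" for l
    have c: "c l \<noteq> 0" for l using ly_props(1)[OF nz[of "\<rho> l"]] by (simp add: c_def ly\<rho>)
    define u :: "(('k, 'n) vec, 'n) vec" where "u = (\<chi> l. inverse (c l) *s g $ \<rho> l)"
    have "u $ l \<in> Mon l" for l
      using c[of l] ly_props(2)[OF nz[of "\<rho> l"]] by (simp add: u_def Mon_def ly\<rho> c_def)
    then have u: "u \<in> Unip" by (simp add: Unip_iff)
    have "(\<Prod>i\<in>UNIV. linform (g $ i)) = (\<Prod>l\<in>UNIV. linform (g $ \<rho> l))"
      by (rule prod.reindex_bij_betw[OF bij', symmetric])
    also have "\<dots> = (\<Prod>l\<in>UNIV. pconst (c l) * linform (u $ l))"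
      using c by (intro prod.cong refl) (simp add: u_def vector_smult_assoc flip: linform_scale)
    also have "\<dots> = pconst (\<Prod>l\<in>UNIV. c l) * (\<Prod>l\<in>UNIV. linform (u $ l))"
      by (simp add: prod.distrib pconst_prod)
    finally have "(P * pconst (\<Prod>l\<in>UNIV. c l)) * (\<Prod>l\<in>UNIV. linform (u $ l)) = Lam ^ k"
      using less.prems(2) by (simp add: mult.assoc)
    also have "\<dots> = gl_act (Ek k) u * (\<Prod>l\<in>UNIV. linform (u $ l))"
      using Ek_gl_act[OF assms(1), of u] by (simp add: det_Unip[OF u])
    finally have Pu: "P * pconst (\<Prod>l\<in>UNIV. c l) = gl_act (Ek k) u"
    proof (rule mult_right_cancel[THEN iffD1, rotated])
      have "u $ l \<noteq> 0" for l using u Mons_neq_0 unfolding Unip_iff Mons_def by blast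
      then show "(\<Prod>l\<in>UNIV. linform (u $ l)) \<noteq> 0" by simp
    qed
    have "pconst (inverse (\<Prod>l\<in>UNIV. c l)) * gl_act (Ek k) u
      = P * (pconst (inverse (\<Prod>l\<in>UNIV. c l)) * pconst (\<Prod>l\<in>UNIV. c l))"
      unfolding Pu[symmetric] by (simp only: ac_simps)
    also have "\<dots> = P" using c by (simp flip: pconst_mult)
    finally have "P = pconst (inverse (\<Prod>l\<in>UNIV. c l)) * gl_act (Ek k) u" ..
    then show ?thesis using u by (simp add: fsp.span_base fsp.span_scale)
  qed
qed

lemma homog_top_decomp:
  fixes f :: "('k, 'n::{finite,linorder}) sympoly"
  assumes "k \<ge> 1" "homog N f" "N + CARD('n) = k * card (Mons :: ('k, 'n) vec set)"
  obtains c h where "h \<in> Iid k" "f = (\<Sum>u\<in>Unip. pconst (c u) * gl_act (Ek k) u) + h"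
proof -
  let ?Q = "{P. \<exists>g\<in>GLn. P * (\<Prod>i\<in>UNIV. linform (g $ i)) = (Lam :: ('k, 'n) sympoly) ^ k}"
  let ?U = "gl_act (Ek k) ` (Unip :: (('k, 'n) vec, 'n) vec set)"
  have "?Q \<subseteq> fsp.span ?U" using straighten[OF assms(1)] by (auto simp: GLn_def)
  then have "fsp.span (Iid k \<union> ?Q) \<subseteq> fsp.span (?U \<union> Iid k)"
    using fsp.span_mono[of ?U "?U \<union> Iid k"] fsp.span_superset[of "?U \<union> Iid k"]
    by (intro fsp.span_minimal fsp.subspace_span) blast
  then have "f \<in> fsp.span (?U \<union> Iid k)" using homog_in_span_Ek[OF assms] by blast
  then obtain a h where ah: "a \<in> fsp.span ?U" "h \<in> fsp.span (Iid k)" "f = a + h"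
    unfolding fsp.span_Un by auto
  have "fsp.subspace (Iid k :: ('k, 'n) sympoly set)"
    by (rule fsp.subspaceI) (auto simp: Iid_add Iid_scale)
  then have h: "h \<in> Iid k" using ah(2) fsp.span_minimal[of "Iid k" "Iid k"] by blast
  let ?S = "{a. \<exists>c. a = (\<Sum>u\<in>(Unip :: (('k, 'n) vec, 'n) vec set). pconst (c u) * gl_act (Ek k) u)}"
  have "fsp.span ?U \<subseteq> ?S"
  proof (rule fsp.span_minimal)
    show "?U \<subseteq> ?S"
    proof
      fix a assume "a \<in> ?U"
      then obtain u where u: "u \<in> Unip" "a = gl_act (Ek k) u" by (elim imageE)
      have "a = (\<Sum>u'\<in>Unip. if u' = u then gl_act (Ek k) u' else 0)" using u by simp
      also have "\<dots> = (\<Sum>u'\<in>Unip. pconst (if u' = u then 1 else 0) * gl_act (Ek k) u')"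
        by (intro sum.cong) auto
      finally show "a \<in> ?S" by (intro CollectI exI[of _ "\<lambda>u'. if u' = u then 1 else 0"])
    qed
    show "fsp.subspace ?S"
    proof (rule fsp.subspaceI)
      have "0 = (\<Sum>u\<in>(Unip :: (('k, 'n) vec, 'n) vec set). pconst 0 * gl_act (Ek k) u)" by simp
      then show "0 \<in> ?S" by (intro CollectI exI[of _ "\<lambda>_. 0"])
    next
      fix x y assume "x \<in> ?S" "y \<in> ?S"
      then obtain c d where "x = (\<Sum>u\<in>Unip. pconst (c u) * gl_act (Ek k) u)"
        "y = (\<Sum>u\<in>Unip. pconst (d u) * gl_act (Ek k) u)" by blast
      then have "x + y = (\<Sum>u\<in>Unip. pconst (c u + d u) * gl_act (Ek k) u)"
        by (simp add: pconst_add distrib_right sum.distrib)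
      then show "x + y \<in> ?S" by (intro CollectI exI[of _ "\<lambda>u. c u + d u"])
    next
      fix e x assume "x \<in> ?S"
      then obtain c where "x = (\<Sum>u\<in>Unip. pconst (c u) * gl_act (Ek k) u)" by blast
      then have "pconst e * x = (\<Sum>u\<in>Unip. pconst (e * c u) * gl_act (Ek k) u)"
        by (simp add: sum_distrib_left)
      then show "pconst e * x \<in> ?S" by (intro CollectI exI[of _ "\<lambda>u. e * c u"])
    qed
  qed
  then obtain c where "a = (\<Sum>u\<in>Unip. pconst (c u) * gl_act (Ek k) u)" using ah(1) by blast
  then show ?thesis using that[OF h, of c] ah(3) by simp
qed

end

section \<open>Monomial ideals\<close>

text \<open>The ideal generated by the pure powers \<open>Xv j ^ T j\<close>; being monomial, it is
  described by a condition on each exponent.\<close>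

definition MI :: "('n \<Rightarrow> nat) \<Rightarrow> ('k::comm_ring_1, 'n::finite) sympoly set" where
  "MI T = {f. \<forall>m. lookup f m \<noteq> 0 \<longrightarrow> (\<exists>j. T j \<le> lookup m j)}"

lemma MI_0 [simp]: "0 \<in> MI T"
  by (simp add: MI_def)

lemma MI_add:
  assumes "f \<in> MI T" "g \<in> MI T"
  shows "f + g \<in> MI T"
  unfolding MI_def
proof (intro CollectI allI impI)
  fix m assume "lookup (f + g) m \<noteq> 0"
  then have "lookup f m \<noteq> 0 \<or> lookup g m \<noteq> 0" by (auto simp: lookup_add)
  then show "\<exists>j. T j \<le> lookup m j" using assms by (auto simp: MI_def)
qed

lemma MI_scale:
  assumes f: "f \<in> MI T"
  shows "h * f \<in> MI T"
proof (induction h rule: poly_mapping_induct)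
  case (single m c)
  show ?case
    unfolding MI_def
  proof (intro CollectI allI impI)
    fix l assume "lookup (single m c * f) l \<noteq> 0"
    then have "l \<in> keys (single m c * f)" by (simp add: in_keys_iff)
    then obtain a b where ab: "l = a + b" "a \<in> keys (single m c)" "b \<in> keys f"
      using keys_mult by blast
    then obtain j where "T j \<le> lookup b j" using f by (auto simp: MI_def in_keys_iff)
    then show "\<exists>j. T j \<le> lookup l j" by (intro exI[of _ j]) (simp add: ab(1) lookup_add)
  qed
qed (simp add: distrib_right MI_add)

lemma MI_uminus: "f \<in> MI T \<Longrightarrow> - f \<in> MI T"
  using MI_scale[of f T "- 1"] by simp

lemma MI_diff: "f \<in> MI T \<Longrightarrow> g \<in> MI T \<Longrightarrow> f - g \<in> MI T"
  using MI_add[OF _ MI_uminus] by fastforce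

lemma MI_Xv_power: "T i \<le> e \<Longrightarrow> Xv i ^ e \<in> MI T"
  by (auto simp: MI_def Xv_power lookup_single when_def)

lemma MI_cong_power:
  assumes "a - b \<in> MI T"
  shows "a ^ e - b ^ e \<in> MI T"
proof -
  obtain c where "a ^ e - b ^ e = c * (a - b)"
    using dvd_power_same by (metis dvdE dvd_def mult.commute power_diff_sumr2)
  then show ?thesis using assms by (simp add: MI_scale)
qed

section \<open>Products over blocks of monic vectors\<close>

definition idx :: "nat \<Rightarrow> 'n::{finite,linorder}" where
  "idx m = inv_into UNIV pos m"

lemma idx_pos [simp]: "idx (pos i) = i"
  unfolding idx_def using bij_pos by (intro inv_into_f_f) (auto simp: bij_betw_def)

lemma pos_idx [simp]: "m < CARD('n) \<Longrightarrow> pos (idx m :: 'n::{finite,linorder}) = m"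
  unfolding idx_def using bij_pos[where ?'n = 'n] by (intro f_inv_into_f) (auto simp: bij_betw_def)

lemma pos_less_card [simp]: "pos (i :: 'n::{finite,linorder}) < CARD('n)"
  using bij_pos[where ?'n = 'n] by (auto simp: bij_betw_def)

definition WW :: "nat \<Rightarrow> ('k::field, 'n::{finite,linorder}) vec set" where
  "WW m = {w. \<forall>j. m \<le> pos j \<longrightarrow> w $ j = 0}"

text \<open>For a linear form \<open>x\<close> and \<open>m \<le> CARD('n)\<close> this is the
  product of all \<open>x + w\<close> with \<open>w\<close> in the span of the last \<open>m\<close>
  variables, see \<open>prod_WW\<close>. The recursion adjoins one variable at a time by means of
  \<open>prod_shift\<close>.\<close>

primrec vst :: "nat \<Rightarrow> ('k::{field,finite}, 'n::{finite,linorder}) sympoly \<Rightarrow> ('k, 'n) sympoly" where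
  "vst 0 x = x"
| "vst (Suc m) x = vst m x ^ CARD('k) - vst m x * vst m (Xv (idx m)) ^ (CARD('k) - 1)"

text \<open>As polynomials in \<open>X\<close> both sides are monic of degree
  \<open>CARD('k)\<close> and vanish at all multiples of \<open>Y\<close> by field elements; their
  difference has too many roots for its degree.\<close>

lemma prod_shift:
  fixes X Y :: "('k::{field,finite}, 'n::{finite,linorder}) sympoly"
  shows "(\<Prod>c\<in>UNIV. X + pconst c * Y) = X ^ CARD('k) - X * Y ^ (CARD('k) - 1)"
proof -
  let ?q = "CARD('k)"
  have q2: "?q \<ge> 2" by (rule card_field_ge_2)
  have "(\<Prod>c\<in>UNIV. X - pconst c * Y) = X ^ ?q - X * Y ^ (?q - 1)"
  \<comment> \<open>For \<open>Y = 0\<close> the roots counted below would coincide.\<close>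
  proof (cases "Y = 0")
    case True
    then show ?thesis using q2 by (simp add: power_0_left)
  next
    case False
    define P where "P = monom 1 ?q - monom (Y ^ (?q - 1)) 1"
    define Q where "Q = (\<Prod>c\<in>(UNIV :: 'k set). [:- (pconst c * Y), 1:])"
    have dQ: "degree Q = ?q" unfolding Q_def by (subst degree_prod_eq_sum_degree) auto
    have "lead_coeff Q = 1" unfolding Q_def by (subst lead_coeff_prod) simp
    then have c0: "coeff (P - Q) ?q = 0" using q2 dQ by (simp add: P_def)
    have "degree P \<le> ?q" unfolding P_def
      by (rule degree_diff_le) (use q2 in \<open>simp_all add: degree_monom_le order.trans[OF degree_monom_le]\<close>)
    then have dD: "degree (P - Q) \<le> ?q" using dQ by (intro degree_diff_le) auto
    have "P - Q = 0"
    proof (rule ccontr)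
      assume nz: "P - Q \<noteq> 0"
      then have "degree (P - Q) < ?q" using eq_zero_or_degree_less[OF dD c0] by blast
      moreover have "(\<lambda>c. pconst c * Y) ` UNIV \<subseteq> {x. poly (P - Q) x = 0}"
      proof
        fix x assume "x \<in> (\<lambda>c. pconst c * Y) ` UNIV"
        then obtain c where x: "x = pconst c * Y" by blast
        have "poly Q x = 0" unfolding Q_def poly_prod x by (rule prod_zero) auto
        moreover have "poly P x = 0"
        proof -
          have "pconst c ^ ?q = (pconst c :: ('k, 'n) sympoly)" by (simp add: field_power_card flip: pconst_power)
          moreover have "Y ^ ?q = Y * Y ^ (?q - 1)" using q2 by (cases ?q) auto
          ultimately show ?thesis by (simp add: P_def x poly_monom power_mult_distrib)
        qed
        ultimately show "x \<in> {x. poly (P - Q) x = 0}" by simp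
      qed
      then have "card ((\<lambda>c. pconst c * Y) ` (UNIV :: 'k set)) \<le> card {x. poly (P - Q) x = 0}"
        by (intro card_mono poly_roots_finite nz)
      moreover have "card ((\<lambda>c. pconst c * Y) ` (UNIV :: 'k set)) = ?q"
        by (rule card_image) (use False in \<open>auto simp: inj_def\<close>)
      ultimately show False using card_poly_roots_bound[OF nz] by linarith
    qed
    then have "poly P X = poly Q X" by simp
    then show ?thesis by (simp add: P_def Q_def poly_prod poly_monom mult.commute)
  qed
  moreover have "(\<Prod>c\<in>UNIV. X - pconst c * Y) = (\<Prod>c\<in>UNIV. X + pconst c * Y)"
    by (rule prod.reindex_bij_witness[of _ uminus uminus]) (auto simp: pconst_uminus)
  ultimately show ?thesis by simp
qed

lemma WW_Suc:
  assumes "m < CARD('n)"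
  shows "bij_betw (\<lambda>(c, w). w + c *s axis (idx m) 1) (UNIV \<times> WW m)
    (WW (Suc m) :: ('k::field, 'n::{finite,linorder}) vec set)"
proof (rule bij_betw_byWitness[where f' = "\<lambda>v. (v $ idx m, v - v $ idx m *s axis (idx m) 1)"])
  have *: "w $ (idx m :: 'n) = 0" if "w \<in> WW m" for w :: "('k, 'n) vec"
    using that assms by (simp add: WW_def)
  then show "\<forall>x\<in>UNIV \<times> (WW m :: ('k, 'n) vec set). (\<lambda>v. (v $ idx m, v - v $ idx m *s axis (idx m) 1))
      ((\<lambda>(c, w). w + c *s axis (idx m) 1) x) = x" by (auto simp: axis_def)
  show "(\<lambda>(c, w). w + c *s axis (idx m) 1) ` (UNIV \<times> WW m) \<subseteq> (WW (Suc m) :: ('k, 'n) vec set)"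
    using assms by (auto simp: WW_def axis_def)
  show "(\<lambda>v. (v $ idx m, v - v $ idx m *s axis (idx m) 1)) ` WW (Suc m)
    \<subseteq> UNIV \<times> (WW m :: ('k, 'n) vec set)"
  proof
    fix x assume "x \<in> (\<lambda>v. (v $ idx m, v - v $ idx m *s axis (idx m) 1)) ` (WW (Suc m) :: ('k, 'n) vec set)"
    then obtain v where v: "v \<in> WW (Suc m)" "x = (v $ idx m, v - v $ idx m *s axis (idx m) 1)" by blast
    have "(v - v $ idx m *s axis (idx m) 1) $ j = 0" if j: "m \<le> pos j" for j :: 'n
    proof (cases "j = idx m")
      case False
      then have "pos j \<noteq> m" using idx_pos[of j] by auto
      then show ?thesis using v(1) j False by (simp add: WW_def axis_def)
    qed (simp add: axis_def)
    then show "x \<in> UNIV \<times> WW m" by (simp add: v(2) WW_def)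
  qed
qed (simp)

lemma Mon_eq_WW: "bij_betw (\<lambda>w. axis i 1 + w) (WW (pos i)) (Mon i :: ('k::field, 'n::{finite,linorder}) vec set)"
proof (rule bij_betw_byWitness[where f' = "\<lambda>v. v - axis i 1"])
  have le: "pos i \<le> pos j \<longleftrightarrow> j \<le> i" for j :: 'n
    using pos_less_iff[of j i] by (metis not_less pos_less_iff)
  show "(\<lambda>w. axis i 1 + w) ` WW (pos i) \<subseteq> (Mon i :: ('k, 'n) vec set)"
    by (auto simp: WW_def Mon_def le axis_def)
  show "(\<lambda>v. v - axis i 1) ` Mon i \<subseteq> (WW (pos i) :: ('k, 'n) vec set)"
    unfolding WW_def le Mon_def by (auto simp: axis_def le_less)
qed auto

context fq
begin

lemma vst_add: "vst m (x + y) = vst m x + (vst m y :: ('k, 'n::{finite,linorder}) sympoly)"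
proof (induction m arbitrary: x y)
  case (Suc m)
  show ?case using frob_add[of "vst m x" "vst m y" 1] by (simp add: Suc algebra_simps)
qed simp

lemma vst_scale: "vst m (pconst c * x) = pconst c * (vst m x :: ('k, 'n::{finite,linorder}) sympoly)"
proof (induction m arbitrary: x)
  case (Suc m)
  have "(pconst c :: ('k, 'n) sympoly) ^ CARD('k) = pconst c" by (simp add: field_power_card flip: pconst_power)
  then show ?case by (simp add: Suc power_mult_distrib right_diff_distrib mult.assoc)
qed simp

lemma prod_WW:
  fixes z :: "('k, 'n::{finite,linorder}) vec"
  assumes "m \<le> CARD('n)"
  shows "(\<Prod>w\<in>WW m. linform (z + w)) = vst m (linform z)"
  using assms
proof (induction m arbitrary: z)
  case 0
  have "WW 0 = {0 :: ('k, 'n) vec}" by (auto simp: WW_def vec_eq_iff)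
  then show ?case by simp
next
  case (Suc m)
  have "(\<Prod>w\<in>WW (Suc m). linform (z + w)) = (\<Prod>(c, w)\<in>UNIV \<times> WW m. linform (z + (w + c *s axis (idx m) 1)))"
    using prod.reindex_bij_betw[OF WW_Suc[of m, where ?'k = 'k and ?'n = 'n], of "\<lambda>w. linform (z + w)"] Suc.prems
    by (simp add: case_prod_unfold)
  also have "\<dots> = (\<Prod>c\<in>UNIV. \<Prod>w\<in>WW m. linform ((z + c *s axis (idx m) 1) + w))"
    unfolding prod.cartesian_product by (simp add: ac_simps)
  also have "\<dots> = (\<Prod>c\<in>UNIV. vst m (linform z) + pconst c * vst m (Xv (idx m)))"
    using Suc.prems by (simp add: Suc.IH linform_add[of z] linform_scale vst_add vst_scale)
  also have "\<dots> = vst (Suc m) (linform z)" by (simp add: prod_shift)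
  finally show ?case .
qed

lemma prod_Mon: "(\<Prod>v\<in>Mon i. linform v) = vst (pos i) (Xv (i :: 'n::{finite,linorder}) :: ('k, 'n) sympoly)"
  using prod.reindex_bij_betw[OF Mon_eq_WW[of i, where ?'k = 'k], of linform]
    prod_WW[of "pos i" "axis i 1"] pos_less_card[of i] by (simp del: pos_less_card)

text \<open>In the recursion the second term carries a power of \<open>vst m (Xv (idx m))\<close>
  that is, by induction, congruent to a pure power of \<open>Xv (idx m)\<close>. As
  \<open>r \<le> CARD('k) - 1\<close>, that power lies in the ideal, so only the Frobenius term
  survives.\<close>

lemma vst_power_MI:
  assumes "r \<le> CARD('k) - 1" "m \<le> CARD('n)"
  shows "vst m x ^ (CARD('k) ^ a) - x ^ (CARD('k) ^ a * CARD('k) ^ m)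
    \<in> (MI (\<lambda>i. CARD('k) ^ a * r * CARD('k) ^ pos i) :: ('k, 'n::{finite,linorder}) sympoly set)"
  using assms(2)
proof (induction m arbitrary: x)
  case (Suc m)
  let ?q = "CARD('k)" and ?M = "MI (\<lambda>i. CARD('k) ^ a * r * CARD('k) ^ pos i) :: ('k, 'n) sympoly set"
  let ?A = "?q ^ a" and ?v = "vst m x" and ?w = "vst m (Xv (idx m)) :: ('k, 'n) sympoly"
  have m: "m < CARD('n)" "m \<le> CARD('n)" using Suc.prems by auto
  have x: "?v ^ ?A - x ^ (?A * ?q ^ m) \<in> ?M" by (rule Suc.IH[OF m(2)])
  have y: "?w ^ ?A - Xv (idx m) ^ (?A * ?q ^ m) \<in> ?M" by (rule Suc.IH[OF m(2)])
  have "(?w ^ ?A) ^ (?q - 1) - (Xv (idx m) ^ (?A * ?q ^ m)) ^ (?q - 1) \<in> ?M"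
    using y by (rule MI_cong_power)
  moreover have "(Xv (idx m) ^ (?A * ?q ^ m)) ^ (?q - 1) \<in> ?M"
    unfolding power_mult[symmetric]
    by (rule MI_Xv_power) (use m assms(1) in \<open>simp add: mult.assoc mult.commute[of _ "?q ^ m"]\<close>)
  ultimately have "(?w ^ ?A) ^ (?q - 1) \<in> ?M" using MI_add by fastforce
  then have 1: "?v ^ ?A * (?w ^ ?A) ^ (?q - 1) \<in> ?M" by (rule MI_scale)
  have 2: "(?v ^ ?A) ^ ?q - (x ^ (?A * ?q ^ m)) ^ ?q \<in> ?M" using x by (rule MI_cong_power)
  have "vst (Suc m) x ^ ?A = (?v ^ ?q) ^ ?A - (?v * ?w ^ (?q - 1)) ^ ?A"
  proof -
    have "((?v ^ ?q - ?v * ?w ^ (?q - 1)) + ?v * ?w ^ (?q - 1)) ^ ?A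
      = (?v ^ ?q - ?v * ?w ^ (?q - 1)) ^ ?A + (?v * ?w ^ (?q - 1)) ^ ?A" by (rule frob_add)
    then show ?thesis by (simp add: algebra_simps)
  qed
  also have "(?v ^ ?q) ^ ?A = (?v ^ ?A) ^ ?q" by (simp add: mult.commute flip: power_mult)
  also have "(?v * ?w ^ (?q - 1)) ^ ?A = ?v ^ ?A * (?w ^ ?A) ^ (?q - 1)"
    by (simp add: power_mult_distrib mult.commute flip: power_mult)
  finally have "vst (Suc m) x ^ ?A - x ^ (?A * ?q ^ Suc m)
     = ((?v ^ ?A) ^ ?q - (x ^ (?A * ?q ^ m)) ^ ?q) - ?v ^ ?A * (?w ^ ?A) ^ (?q - 1)"
    by (simp add: ac_simps flip: power_mult)
  then show ?case using MI_diff[OF 2 1] by (simp only:)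
qed simp

text \<open>The congruence for \<open>x = Xv i\<close>, raised to the power \<open>r\<close>: what
  remains is exactly a generator of the monomial ideal.\<close>

lemma prod_Mon_power_MI:
  assumes "r \<le> CARD('k) - 1" "L = CARD('k) ^ a * r"
  shows "(\<Prod>v\<in>Mon i. linform v) ^ L \<in> (MI (\<lambda>i. L * CARD('k) ^ pos i) :: ('k, 'n::{finite,linorder}) sympoly set)"
proof -
  let ?q = "CARD('k)" and ?M = "MI (\<lambda>i. L * CARD('k) ^ pos i) :: ('k, 'n) sympoly set"
  have "(vst (pos i) (Xv i) ^ (?q ^ a)) ^ r - (Xv i ^ (?q ^ a * ?q ^ pos i)) ^ r \<in> ?M"
    unfolding assms(2) by (rule MI_cong_power[OF vst_power_MI[OF assms(1)]]) (simp add: less_imp_le)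
  moreover have "(Xv i ^ (?q ^ a * ?q ^ pos i)) ^ r \<in> ?M"
    unfolding power_mult[symmetric] by (rule MI_Xv_power) (simp add: assms(2) ac_simps)
  ultimately have "(vst (pos i) (Xv i) ^ (?q ^ a)) ^ r \<in> ?M" using MI_add by fastforce
  then show ?thesis by (simp add: prod_Mon assms(2) power_mult)
qed

end

section \<open>Leading monomials\<close>

text \<open>An upper bound for the exponents of \<open>f\<close> in the lexicographic order, where
  smaller indices weigh more. It is the leading exponent once its coefficient is known to be
  nonzero.\<close>

definition lead :: "('n \<Rightarrow>\<^sub>0 nat) \<Rightarrow> ('k::comm_ring_1, 'n::{finite,linorder}) sympoly \<Rightarrow> bool" where
  "lead m f \<longleftrightarrow> (\<forall>m'. lookup f m' \<noteq> 0 \<longrightarrow> m' \<le> m)"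

lemma lead_unique: "lead m f \<Longrightarrow> lookup f m \<noteq> 0 \<Longrightarrow> lead m' f \<Longrightarrow> lookup f m' \<noteq> 0 \<Longrightarrow> m = m'"
  by (auto simp: lead_def intro: order_antisym)

lemma lead_mult:
  assumes "lead m f" "lead l g"
  shows "lead (m + l) (f * g)" "lookup (f * g) (m + l) = lookup f m * lookup g l"
proof -
  have le: "a \<le> m" if "a \<in> keys f" for a using that assms(1) by (auto simp: lead_def in_keys_iff)
  have le': "b \<le> l" if "b \<in> keys g" for b using that assms(2) by (auto simp: lead_def in_keys_iff)
  show "lead (m + l) (f * g)"
    unfolding lead_def
  proof (intro allI impI)
    fix c assume "lookup (f * g) c \<noteq> 0"
    then have "c \<in> keys (f * g)" by (simp add: in_keys_iff)
    then obtain a b where "c = a + b" "a \<in> keys f" "b \<in> keys g" using keys_mult by blast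
    then show "c \<le> m + l" using le le' by (simp add: add_mono)
  qed
  \<comment> \<open>Without its term at \<open>m\<close>, \<open>f\<close> has only strictly smaller
    exponents, so it cannot contribute at \<open>m + l\<close>.\<close>
  let ?f = "f - single m (lookup f m)"
  have "lookup (?f * g) (m + l) = 0"
  proof (rule ccontr)
    assume "lookup (?f * g) (m + l) \<noteq> 0"
    then have "m + l \<in> keys (?f * g)" by (simp add: in_keys_iff)
    then obtain a b where ab: "m + l = a + b" "a \<in> keys ?f" "b \<in> keys g" using keys_mult by blast
    have "a \<noteq> m" using ab(2) by (auto simp: in_keys_iff lookup_minus)
    then have "a \<in> keys f" using ab(2) by (auto simp: in_keys_iff lookup_minus lookup_single when_def)
    then have "a + b < m + l" using le le' ab(3) \<open>a \<noteq> m\<close> by (intro add_less_le_mono) (auto simp: order.not_eq_order_implies_strict)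
    then show False using ab(1) by simp
  qed
  moreover have "f * g = ?f * g + single m (lookup f m) * g" by (simp add: algebra_simps)
  then have "lookup (f * g) (m + l) = lookup (?f * g) (m + l) + lookup (single m (lookup f m) * g) (m + l)"
    by (simp only: lookup_add)
  ultimately show "lookup (f * g) (m + l) = lookup f m * lookup g l"
    by (simp add: lookup_single_times)
qed

lemma lead_prod:
  assumes "\<And>y. y \<in> A \<Longrightarrow> lead (m y) (f y)"
  shows "lead (\<Sum>y\<in>A. m y) (\<Prod>y\<in>A. f y) \<and> lookup (\<Prod>y\<in>A. f y) (\<Sum>y\<in>A. m y) = (\<Prod>y\<in>A. lookup (f y) (m y))"
  using assms
proof (induction A rule: infinite_finite_induct)
  case (insert x F)
  then show ?case using lead_mult[of "m x" "f x" "\<Sum>y\<in>F. m y" "\<Prod>y\<in>F. f y"] by simp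
qed (auto simp: lead_def lookup_one when_def)

lemma single_less: "i < j \<Longrightarrow> single j (1::nat) < single i 1"
  by (auto simp: less_poly_mapping.rep_eq less_fun_def lookup_single when_def intro!: exI[of _ i])

lemma lead_linform:
  assumes "\<And>j. j < i \<Longrightarrow> v $ j = 0"
  shows "lead (single i 1) (linform v)"
  unfolding lead_def
proof (intro allI impI)
  fix m assume "lookup (linform v) m \<noteq> 0"
  then obtain j where j: "v $ j \<noteq> 0" "m = single j 1" using keys_linform[of m v] by (auto simp: in_keys_iff)
  then have "i \<le> j" using assms by (meson not_less)
  then show "m \<le> single i 1" using single_less[of i j] j(2) by (cases "i = j") (auto intro: less_imp_le)
qed

lemma lead_ex_monomial:
  fixes f :: "('k::comm_ring_1, 'n::{finite,linorder}) sympoly"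
  assumes "f \<noteq> 0"
  obtains m where "lead m f" "lookup f m \<noteq> 0"
proof
  have ne: "finite (keys f)" "keys f \<noteq> {}" using assms by auto
  show "lead (Max (keys f)) f" using ne by (auto simp: lead_def in_keys_iff)
  show "lookup f (Max (keys f)) \<noteq> 0" using Max_in[OF ne] by (simp add: in_keys_iff)
qed

lemma sum_single_const: "(\<Sum>y\<in>A. single i (1::nat)) = single i (card A)"
  by (induction A rule: infinite_finite_induct) (simp_all flip: single_add)

text \<open>Every form in \<open>Mon i\<close> has leading term \<open>Xv i\<close> with coefficient
  \<open>1\<close>, and there are \<open>CARD('k) ^ pos i\<close> of them.\<close>

lemma lead_Lam_power:
  "lead (\<Sum>i\<in>UNIV. single i (L * CARD('k) ^ pos i)) ((Lam :: ('k::{field,finite}, 'n::{finite,linorder}) sympoly) ^ L)"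
  "lookup ((Lam :: ('k, 'n) sympoly) ^ L) (\<Sum>i\<in>UNIV. single i (L * CARD('k) ^ pos i)) = 1"
proof -
  let ?Y = "\<lambda>i. (Mon i :: ('k, 'n) vec set) \<times> {..<L}"
  have Lm: "(Lam :: ('k, 'n) sympoly) ^ L = (\<Prod>i\<in>UNIV. \<Prod>y\<in>?Y i. linform (fst y))"
    by (simp add: Lam_eq prod_copies prod_power_distrib)
  have 1: "lead (\<Sum>y\<in>?Y i. single i 1) (\<Prod>y\<in>?Y i. linform (fst y)) \<and>
      lookup (\<Prod>y\<in>?Y i. linform (fst y)) (\<Sum>y\<in>?Y i. single i 1) = 1" for i :: 'n
  proof -
    have "lead (\<Sum>y\<in>?Y i. single i 1) (\<Prod>y\<in>?Y i. linform (fst y)) \<and>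
      lookup (\<Prod>y\<in>?Y i. linform (fst y)) (\<Sum>y\<in>?Y i. single i 1) = (\<Prod>y\<in>?Y i. lookup (linform (fst y)) (single i 1))"
      by (rule lead_prod) (auto simp: Mon_def simp del: One_nat_def intro!: lead_linform)
    moreover have "(\<Prod>y\<in>?Y i. lookup (linform (fst y)) (single i 1)) = 1"
      by (rule prod.neutral) (auto simp: Mon_def)
    ultimately show ?thesis by simp
  qed
  have 2: "(\<Sum>y\<in>?Y i. single i (1::nat)) = single i (L * CARD('k) ^ pos i)" for i :: 'n
    unfolding sum_single_const by (simp add: card_Mon mult.commute)
  have "lead (\<Sum>i\<in>UNIV. single i (L * CARD('k) ^ pos i)) (\<Prod>i\<in>UNIV. \<Prod>y\<in>?Y i. linform (fst y)) \<and>
    lookup (\<Prod>i\<in>UNIV. \<Prod>y\<in>?Y i. linform (fst y)) (\<Sum>i\<in>UNIV. single i (L * CARD('k) ^ pos i))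
      = (\<Prod>i\<in>UNIV. lookup (\<Prod>y\<in>?Y i. linform (fst y)) (single i (L * CARD('k) ^ pos i)))"
    by (rule lead_prod) (use 1 2 in metis)
  then show "lead (\<Sum>i\<in>UNIV. single i (L * CARD('k) ^ pos i)) ((Lam :: ('k, 'n) sympoly) ^ L)"
    "lookup ((Lam :: ('k, 'n) sympoly) ^ L) (\<Sum>i\<in>UNIV. single i (L * CARD('k) ^ pos i)) = 1"
    unfolding Lm using 1 unfolding 2 by simp_all
qed

section \<open>Counting invertible and unitriangular matrices\<close>

lemma card_span_independent:
  fixes B :: "('k::{field,finite}, 'n::finite) vec set"
  assumes "vec.independent B"
  shows "card (vec.span B) = CARD('k) ^ card B"
proof -
  have "finite B" by simp
  then show ?thesis using assms
  proof (induction B rule: finite_induct)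
    case empty
    then show ?case by simp
  next
    case (insert x F)
    have x: "x \<notin> vec.span F" "vec.independent F"
      using insert.prems insert.hyps(2) by (simp_all add: vec.independent_insert)
    have "bij_betw (\<lambda>(c, v). c *s x + v) (UNIV \<times> vec.span F) (vec.span (insert x F))"
      unfolding bij_betw_def
    proof
      show "inj_on (\<lambda>(c, v). c *s x + v) (UNIV \<times> vec.span F)"
      proof (rule inj_onI, clarsimp)
        fix c v d w assume vw: "v \<in> vec.span F" "w \<in> vec.span F" and eq: "c *s x + v = d *s x + w"
        have "(c - d) *s x = w - v" using eq by (simp add: vec.scale_left_diff_distrib algebra_simps)
        then have "(c - d) *s x \<in> vec.span F" using vw by (simp add: vec.span_diff)
        then have "inverse (c - d) *s ((c - d) *s x) \<in> vec.span F" by (rule vec.span_scale)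
        then have "c = d" using x(1) by (cases "c = d") (simp_all only: vector_smult_assoc, simp)
        then show "c = d \<and> v = w" using eq by simp
      qed
      show "(\<lambda>(c, v). c *s x + v) ` (UNIV \<times> vec.span F) = vec.span (insert x F)"
      proof (intro equalityI subsetI)
        fix y assume "y \<in> (\<lambda>(c, v). c *s x + v) ` (UNIV \<times> vec.span F)"
        then obtain c v where "y = c *s x + v" "v \<in> vec.span F" by auto
        then show "y \<in> vec.span (insert x F)"
          unfolding vec.span_breakdown_eq by (intro exI[of _ c]) simp
      next
        fix y assume "y \<in> vec.span (insert x F)"
        then obtain c where c: "y - c *s x \<in> vec.span F" unfolding vec.span_breakdown_eq by blast
        then have "(c, y - c *s x) \<in> UNIV \<times> vec.span F" by simp
        then show "y \<in> (\<lambda>(c, v). c *s x + v) ` (UNIV \<times> vec.span F)"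
          by (rule rev_image_eqI) simp
      qed
    qed
    from bij_betw_same_card[OF this] show ?case
      using insert.IH[OF x(2)] insert.hyps by (simp add: card_cartesian_product)
  qed
qed

text \<open>The next vector may be any vector outside the span of those already chosen.\<close>

lemma card_independent_lists:
  "card {xs :: ('k::{field,finite}, 'n::finite) vec list. length xs = m \<and> distinct xs \<and> vec.independent (set xs)}
    = (\<Prod>t<m. CARD('k) ^ CARD('n) - CARD('k) ^ t)"
proof (induction m)
  case 0
  have "{xs :: ('k, 'n) vec list. length xs = 0 \<and> distinct xs \<and> vec.independent (set xs)} = {[]}"
    using vec.independent_empty by auto
  then show ?case by simp
next
  case (Suc m)
  let ?L = "\<lambda>m. {xs :: ('k, 'n) vec list. length xs = m \<and> distinct xs \<and> vec.independent (set xs)}"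
  have fin: "finite (?L m)"
    by (rule finite_subset[OF _ finite_lists_length_eq[of UNIV m]]) auto
  have "?L (Suc m) = (\<lambda>(xs, x). x # xs) ` (SIGMA xs:?L m. - vec.span (set xs))"
  proof (intro equalityI subsetI)
    fix ys assume ys: "ys \<in> ?L (Suc m)"
    then obtain x xs where xs: "ys = x # xs" by (cases ys) auto
    then have "(xs, x) \<in> (SIGMA xs:?L m. - vec.span (set xs))" using ys by (auto simp: vec.independent_insert)
    then show "ys \<in> (\<lambda>(xs, x). x # xs) ` (SIGMA xs:?L m. - vec.span (set xs))"
      by (rule rev_image_eqI) (simp add: xs)
  next
    fix ys assume "ys \<in> (\<lambda>(xs, x). x # xs) ` (SIGMA xs:?L m. - vec.span (set xs))"
    then obtain x xs where "ys = x # xs" "xs \<in> ?L m" "x \<notin> vec.span (set xs)" by auto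
    moreover have "x \<notin> set xs" using calculation(3) vec.span_base by blast
    ultimately show "ys \<in> ?L (Suc m)" using vec.independent_insert[of x "set xs"] by simp
  qed
  then have "card (?L (Suc m)) = card (SIGMA xs:?L m. - vec.span (set xs))"
    by (simp add: card_image inj_on_def)
  also have "\<dots> = (\<Sum>xs\<in>?L m. card (- vec.span (set xs)))"
    using fin by (intro card_SigmaI) auto
  also have "\<dots> = (\<Sum>xs\<in>?L m. CARD('k) ^ CARD('n) - CARD('k) ^ m)"
  proof (rule sum.cong)
    fix xs assume "xs \<in> ?L m"
    then have "card (vec.span (set xs)) = CARD('k) ^ m"
      using card_span_independent[of "set xs"] by (auto simp: distinct_card)
    moreover have "card (UNIV :: ('k, 'n) vec set) = CARD('k) ^ CARD('n)" by (simp add: CARD_vec)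
    ultimately show "card (- vec.span (set xs)) = CARD('k) ^ CARD('n) - CARD('k) ^ m"
      by (simp add: Compl_eq_Diff_UNIV card_Diff_subset)
  qed simp
  finally show ?case by (simp add: Suc mult.commute)
qed

lemma card_GLn:
  "card (GLn :: (('k::{field,finite}, 'n::{finite,linorder}) vec, 'n) vec set)
    = (\<Prod>t<CARD('n). CARD('k) ^ CARD('n) - CARD('k) ^ t)"
proof -
  let ?L = "{xs :: ('k, 'n) vec list. length xs = CARD('n) \<and> distinct xs \<and> vec.independent (set xs)}"
  have ran: "idx ` {0..<CARD('n)} = (UNIV :: 'n set)"
  proof (intro equalityI subsetI)
    fix i :: 'n
    have "pos i \<in> {0..<CARD('n)}" by simp
    then show "i \<in> idx ` {0..<CARD('n)}" by (rule rev_image_eqI) simp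
  qed simp
  have inji: "inj_on (idx :: nat \<Rightarrow> 'n) {0..<CARD('n)}" by (rule inj_on_inverseI[where g = pos]) simp
  have set: "set (map (\<lambda>t. g $ (idx t :: 'n)) [0..<CARD('n)]) = range (($) g)" for g :: "(('k, 'n) vec, 'n) vec"
    using ran by (simp flip: image_image)
  have dist: "distinct (map (\<lambda>t. g $ (idx t :: 'n)) [0..<CARD('n)]) \<longleftrightarrow> inj (($) g)" for g :: "(('k, 'n) vec, 'n) vec"
    using comp_inj_on_iff[OF inji, of "($) g"] by (simp add: distinct_map ran comp_def)
  have "bij_betw (\<lambda>g. map (\<lambda>t. g $ idx t) [0..<CARD('n)]) (GLn :: (('k, 'n) vec, 'n) vec set) ?L"
  proof (rule bij_betw_byWitness[where f' = "\<lambda>xs. \<chi> i. xs ! pos i"])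
    show "\<forall>g\<in>GLn. (\<chi> i. map (\<lambda>t. g $ (idx t :: 'n)) [0..<CARD('n)] ! pos i) = (g :: (('k, 'n) vec, 'n) vec)"
      by (simp add: vec_eq_iff)
    show inv: "\<forall>xs\<in>?L. map (\<lambda>t. (\<chi> i. xs ! pos i) $ (idx t :: 'n)) [0..<CARD('n)] = xs"
      by (auto intro!: nth_equalityI)
    show "(\<lambda>g. map (\<lambda>t. g $ (idx t :: 'n)) [0..<CARD('n)]) ` GLn \<subseteq> ?L"
      using set dist by (auto simp: GLn_def invertible_rows simp del: set_map)
    show "(\<lambda>xs. \<chi> i. xs ! pos i) ` ?L \<subseteq> (GLn :: (('k, 'n) vec, 'n) vec set)"
    proof
      fix g :: "(('k, 'n) vec, 'n) vec" assume "g \<in> (\<lambda>xs. \<chi> i. xs ! pos i) ` ?L"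
      then obtain xs where xs: "xs \<in> ?L" "g = (\<chi> i. xs ! pos i)" by blast
      then have "map (\<lambda>t. g $ (idx t :: 'n)) [0..<CARD('n)] = xs" using inv by blast
      then show "g \<in> GLn" using xs(1) set[of g] dist[of g] by (simp add: GLn_def invertible_rows)
    qed
  qed
  from bij_betw_same_card[OF this] show ?thesis by (simp only: card_independent_lists)
qed

lemma card_Unip: "card (Unip :: (('k::{field,finite}, 'n::{finite,linorder}) vec, 'n) vec set) = (\<Prod>t<CARD('n). CARD('k) ^ t)"
proof -
  have "bij_betw vec_nth (Unip :: (('k, 'n) vec, 'n) vec set) (PiE UNIV Mon)"
  proof (rule bij_betw_byWitness[where f' = vec_lambda])
    show "vec_nth ` (Unip :: (('k, 'n) vec, 'n) vec set) \<subseteq> PiE UNIV Mon"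
      unfolding Unip_iff PiE_iff by (intro image_subsetI) (simp add: Unip_iff PiE_iff)
    show "vec_lambda ` PiE UNIV Mon \<subseteq> (Unip :: (('k, 'n) vec, 'n) vec set)"
      by (intro image_subsetI) (simp add: Unip_iff PiE_iff)
  qed (simp_all add: vec_lambda_eta fun_eq_iff)
  then have "card (Unip :: (('k, 'n) vec, 'n) vec set) = card (PiE (UNIV :: 'n set) (Mon :: _ \<Rightarrow> ('k, 'n) vec set))"
    by (rule bij_betw_same_card)
  also have "\<dots> = (\<Prod>i\<in>(UNIV :: 'n set). CARD('k) ^ pos i)" by (simp add: card_PiE card_Mon)
  also have "\<dots> = (\<Prod>t<CARD('n). CARD('k) ^ t)"
    using prod.reindex_bij_betw[OF bij_pos, of "\<lambda>t. CARD('k) ^ t"] by simp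
  finally show ?thesis .
qed

text \<open>The index is the product of the numbers \<open>CARD('k) ^ m - 1\<close> for
  \<open>m\<close> from \<open>1\<close> to \<open>CARD('n)\<close>, each of which is
  \<open>- 1\<close> in the field. Hence the normalising scalar of the Steinberg idempotent is a
  genuine inverse.\<close>

lemma index_neq_0:
  "of_nat (card (GLn :: (('k::{field,finite}, 'n::{finite,linorder}) vec, 'n) vec set)
    div card (Unip :: (('k, 'n) vec, 'n) vec set)) \<noteq> (0 :: 'k)"
proof -
  have q: "CARD('k) > 0" by simp
  have "card (GLn :: (('k, 'n) vec, 'n) vec set)
    = (\<Prod>t<CARD('n). CARD('k) ^ t * (CARD('k) ^ (CARD('n) - t) - 1))"
    unfolding card_GLn by (intro prod.cong) (auto simp: diff_mult_distrib2 simp flip: power_add)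
  also have "\<dots> = card (Unip :: (('k, 'n) vec, 'n) vec set) * (\<Prod>t<CARD('n). CARD('k) ^ (CARD('n) - t) - 1)"
    by (simp add: prod.distrib card_Unip)
  finally have "card (GLn :: (('k, 'n) vec, 'n) vec set) div card (Unip :: (('k, 'n) vec, 'n) vec set)
    = (\<Prod>t<CARD('n). CARD('k) ^ (CARD('n) - t) - 1)"
    by (simp add: card_Unip)
  moreover have "of_nat (CARD('k) ^ (CARD('n) - t) - 1) = (- 1 :: 'k)" if "t < CARD('n)" for t
  proof -
    have "of_nat (CARD('k) ^ (CARD('n) - t) - 1) + (1 :: 'k) = of_nat (CARD('k) ^ (CARD('n) - t) - 1 + 1)" by simp
    also have "CARD('k) ^ (CARD('n) - t) - 1 + 1 = CARD('k) ^ (CARD('n) - t)" using q by simp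
    also have "of_nat (CARD('k) ^ (CARD('n) - t)) = (0 :: 'k)" using that by (simp add: of_nat_card_field)
    finally show ?thesis by (rule eq_neg_iff_add_eq_0[THEN iffD2])
  qed
  then have "of_nat (\<Prod>t<CARD('n). CARD('k) ^ (CARD('n) - t) - 1) = (\<Prod>t<CARD('n). (- 1 :: 'k))"
    unfolding of_nat_prod by (intro prod.cong) auto
  ultimately show ?thesis by simp
qed

section \<open>Triangular matrices\<close>

lemma matrix_inv_mult_self:
  assumes "invertible A"
  shows "matrix_inv A ** A = mat 1" "A ** matrix_inv A = mat 1"
  using someI_ex[OF assms[unfolded invertible_def], folded matrix_inv_def] by auto

lemma matrix_inv_eqI:
  fixes A B :: "'k::field ^ 'n::finite ^ 'n"
  assumes "A ** B = mat 1"
  shows "matrix_inv A = B" "matrix_inv B = A"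
proof -
  have BA: "B ** A = mat 1" using assms matrix_left_right_inverse by blast
  then have "invertible A" using assms by (auto simp: invertible_def)
  then have "matrix_inv A ** A = mat 1" by (rule matrix_inv_mult_self)
  then have "matrix_inv A ** (A ** B) = B" by (simp add: matrix_mul_assoc)
  then show "matrix_inv A = B" by (simp add: assms)
  have "invertible B" using assms BA by (auto simp: invertible_def)
  then have "matrix_inv B ** B = mat 1" by (rule matrix_inv_mult_self)
  then have "matrix_inv B ** (B ** A) = A" by (simp add: matrix_mul_assoc)
  then show "matrix_inv B = A" by (simp add: BA)
qed

lemma GLn_inv:
  assumes "x \<in> GLn"
  shows "x ** matrix_inv x = mat 1" "matrix_inv x ** x = mat 1" "matrix_inv x \<in> GLn"
    "matrix_inv (matrix_inv x) = x"
proof -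
  show *: "x ** matrix_inv x = mat 1" "matrix_inv x ** x = mat 1"
    using assms by (simp_all add: GLn_def matrix_inv_mult_self)
  then show "matrix_inv x \<in> GLn" by (auto simp: GLn_def invertible_def)
  show "matrix_inv (matrix_inv x) = x" by (rule matrix_inv_eqI(1)[OF *(2)])
qed

lemma GLn_mult: "x \<in> GLn \<Longrightarrow> y \<in> GLn \<Longrightarrow> x ** y \<in> GLn"
  by (simp add: GLn_def invertible_mult)

lemma GLn_mult_iff: "g \<in> GLn \<Longrightarrow> x ** g \<in> GLn \<longleftrightarrow> x \<in> (GLn :: ('k::field ^ 'n::finite ^ 'n) set)"
  by (simp add: GLn_def invertible_det_nz det_mul)

lemma GLn_mult_iff': "g \<in> GLn \<Longrightarrow> g ** x \<in> GLn \<longleftrightarrow> x \<in> (GLn :: ('k::field ^ 'n::finite ^ 'n) set)"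
  by (simp add: GLn_def invertible_det_nz det_mul)

lemma matrix_inv_mult:
  assumes "x \<in> GLn" "y \<in> GLn"
  shows "matrix_inv (x ** y) = matrix_inv y ** matrix_inv x"
proof (rule matrix_inv_eqI(1))
  have "x ** y ** (matrix_inv y ** matrix_inv x) = x ** (y ** matrix_inv y) ** matrix_inv x"
    by (simp only: matrix_mul_assoc)
  then show "x ** y ** (matrix_inv y ** matrix_inv x) = mat 1" using assms by (simp add: GLn_inv)
qed

lemma det_GLn_inv: "x \<in> GLn \<Longrightarrow> det x * det (matrix_inv x) = 1"
  by (metis GLn_inv(1) det_I det_mul)

lemma ly_eqI:
  assumes "v $ l \<noteq> 0" "\<And>j. j < l \<Longrightarrow> v $ j = 0"
  shows "ly v = l"
proof -
  have "v \<noteq> 0" using assms(1) by auto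
  from ly_ex[OF this] ly_props[OF this] assms show ?thesis by blast
qed

lemma Borel_iff: "b \<in> Borel \<longleftrightarrow> (\<forall>i. b $ i $ i \<noteq> 0 \<and> (\<forall>j<i. b $ i $ j = 0))"
  using det_upper[of b] by (auto simp: Borel_def GLn_def invertible_det_nz)

lemma ly_Borel: "b \<in> Borel \<Longrightarrow> ly (b $ i) = i"
  by (rule ly_eqI) (auto simp: Borel_iff)

text \<open>Right multiplication by \<open>b\<close> preserves the leading index of a row, and the
  rows of the product are those of the identity.\<close>

lemma Borel_inv:
  assumes b: "b \<in> Borel"
  shows "matrix_inv b \<in> Borel" "matrix_inv b $ i $ i * b $ i $ i = 1"
proof -
  have bG: "b \<in> GLn" using b by (simp add: Borel_def)
  let ?c = "matrix_inv b"
  have *: "ly (?c $ i) = i \<and> ?c $ i $ i * b $ i $ i = 1 \<and> ?c $ i \<noteq> 0" for i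
  proof -
    have nz: "?c $ i \<noteq> 0" using GLn_inv(3)[OF bG] by (simp add: GLn_def invertible_row_nonzero)
    let ?l = "ly (?c $ i)"
    have "(?c ** b) $ i $ ?l = (\<Sum>j\<in>UNIV. ?c $ i $ j * b $ j $ ?l)" by (simp add: matrix_matrix_mult_def)
    also have "\<dots> = (\<Sum>j\<in>UNIV. if j = ?l then ?c $ i $ ?l * b $ ?l $ ?l else 0)"
    proof (rule sum.cong)
      fix j
      show "?c $ i $ j * b $ j $ ?l = (if j = ?l then ?c $ i $ ?l * b $ ?l $ ?l else 0)"
        using ly_props(2)[OF nz, of j] b by (cases j ?l rule: linorder_cases) (auto simp: Borel_iff)
    qed simp
    also have "\<dots> = ?c $ i $ ?l * b $ ?l $ ?l" by simp
    finally have eq: "mat 1 $ i $ ?l = ?c $ i $ ?l * b $ ?l $ ?l" by (simp add: GLn_inv[OF bG])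
    moreover have "?c $ i $ ?l * b $ ?l $ ?l \<noteq> 0" using ly_props(1)[OF nz] b by (auto simp: Borel_iff)
    ultimately have "?l = i" by (auto simp: mat_def split: if_splits)
    then show ?thesis using eq nz by (simp add: mat_def)
  qed
  then show "?c $ i $ i * b $ i $ i = 1" by blast
  show "?c \<in> Borel" unfolding Borel_iff using * ly_props(2) by (metis mult_zero_left zero_neq_one)
qed

lemma Unip_GLn: "u \<in> Unip \<Longrightarrow> u \<in> GLn"
  by (simp add: Unip_def Borel_def)

lemma Unip_inv: "u \<in> Unip \<Longrightarrow> matrix_inv u \<in> Unip"
  using Borel_inv[of u] by (fastforce simp: Unip_def)

lemma Unip_mult:
  assumes "u \<in> Unip" "v \<in> Unip"
  shows "u ** v \<in> Unip"
proof -
  have u: "u $ i $ i = 1" "j < i \<Longrightarrow> u $ i $ j = 0" and v: "v $ i $ i = 1" "j < i \<Longrightarrow> v $ i $ j = 0" for i j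
    using assms by (auto simp: Unip_def Borel_def)
  have "(u ** v) $ i $ j = (if i = j then 1 else 0)" if ij: "j \<le> i" for i j
  proof -
    have "(u ** v) $ i $ j = (\<Sum>m\<in>UNIV. u $ i $ m * v $ m $ j)" by (simp add: matrix_matrix_mult_def)
    also have "\<dots> = (\<Sum>m\<in>UNIV. if m = i then (if i = j then 1 else 0) else 0)"
    proof (rule sum.cong)
      fix m
      show "u $ i $ m * v $ m $ j = (if m = i then (if i = j then 1 else 0) else 0)"
        using u v ij by (cases m i rule: linorder_cases) auto
    qed simp
    finally show ?thesis by simp
  qed
  then have "\<forall>i. (u ** v) $ i \<in> Mon i" by (auto simp: Mon_def)
  then show ?thesis by (simp add: Unip_iff)
qed

lemma perm_mat_mult: "(perm_mat \<pi> ** c) $ i = c $ \<pi> i"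
  by (simp add: vec_eq_iff matrix_matrix_mult_def perm_mat_def if_distrib[of "\<lambda>x. x * _"] cong: if_cong)

lemma perm_mat_GLn:
  assumes "\<pi> permutes (UNIV :: 'n::finite set)"
  shows "(perm_mat \<pi> :: 'k::field ^ 'n ^ 'n) \<in> GLn"
proof -
  have "perm_mat \<pi> ** perm_mat (inv \<pi>) = (mat 1 :: 'k ^ 'n ^ 'n)"
    unfolding vec_eq_iff perm_mat_mult
    using permutes_inverses[OF assms] by (auto simp: perm_mat_def mat_def)
  then have "invertible (perm_mat \<pi> :: 'k ^ 'n ^ 'n)" using invertible_right_inverse by blast
  then show ?thesis by (simp add: GLn_def)
qed

text \<open>In such a factorisation \<open>perm_mat \<sigma> ** matrix_inv x\<close> is the inverse
  of \<open>b\<close>, hence triangular, so row \<open>\<sigma> i\<close> of the inverse of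
  \<open>x\<close> has leading index \<open>i\<close>. This determines \<open>\<sigma>\<close> and
  \<open>b\<close>, and at most one term of the double sum in \<open>stein_idem\<close> survives at
  \<open>x\<close>.\<close>

lemma bruhat_iff:
  fixes x :: "(('k::field, 'n::{finite,linorder}) vec, 'n) vec"
  defines "\<rho> \<equiv> \<lambda>i. ly (matrix_inv x $ i)"
  assumes x: "x \<in> GLn" and \<sigma>: "\<sigma> permutes UNIV"
  shows "b \<in> Borel \<and> b ** perm_mat \<sigma> = x \<longleftrightarrow>
    inj \<rho> \<and> \<sigma> = inv \<rho> \<and> b = matrix_inv (perm_mat (inv \<rho>) ** matrix_inv x)"
proof
  note xi = GLn_inv[OF x]
  assume "b \<in> Borel \<and> b ** perm_mat \<sigma> = x"
  then have b: "b \<in> Borel" "b ** perm_mat \<sigma> = x" by auto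
  have "b ** (perm_mat \<sigma> ** matrix_inv x) = mat 1" by (simp add: matrix_mul_assoc b xi)
  note c = matrix_inv_eqI[OF this]
  have "\<rho> (\<sigma> i) = i" for i
    using ly_Borel[OF Borel_inv(1)[OF b(1)], of i] unfolding c(1) perm_mat_mult by (simp add: \<rho>_def)
  then have "\<rho> \<circ> \<sigma> = id" by auto
  moreover have "bij \<sigma>" using \<sigma> by (rule permutes_bij)
  ultimately have \<rho>: "\<rho> = inv \<sigma>"
    by (metis bij_is_surj comp_assoc comp_id id_comp surj_iff)
  then have "inj \<rho>" using \<open>bij \<sigma>\<close> by (simp add: bij_imp_bij_inv bij_is_inj)
  moreover have "inv \<rho> = \<sigma>" unfolding \<rho> using \<open>bij \<sigma>\<close> by (rule inv_inv_eq)
  ultimately show "inj \<rho> \<and> \<sigma> = inv \<rho> \<and> b = matrix_inv (perm_mat (inv \<rho>) ** matrix_inv x)"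
    using c(2) by simp
next
  note xi = GLn_inv[OF x]
  assume "inj \<rho> \<and> \<sigma> = inv \<rho> \<and> b = matrix_inv (perm_mat (inv \<rho>) ** matrix_inv x)"
  then have \<rho>: "inj \<rho>" "\<sigma> = inv \<rho>" and b: "b = matrix_inv (perm_mat \<sigma> ** matrix_inv x)" by auto
  then have "bij \<rho>" by (simp add: bij_def finite_UNIV_inj_surj)
  then have \<rho>\<sigma>: "\<rho> (\<sigma> i) = i" for i unfolding \<rho>(2) by (simp add: bij_is_surj surj_f_inv_f)
  let ?c = "perm_mat \<sigma> ** matrix_inv x"
  have nz: "matrix_inv x $ i \<noteq> 0" for i using xi(3) by (simp add: GLn_def invertible_row_nonzero)
  have c: "?c \<in> Borel"
    unfolding Borel_iff perm_mat_mult using \<rho>\<sigma> ly_props[OF nz] unfolding \<rho>_def by metis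
  have "b \<in> Borel" unfolding b by (rule Borel_inv(1)[OF c])
  moreover have "b ** perm_mat \<sigma> = x"
  proof -
    have cG: "?c \<in> GLn" using c by (simp add: Borel_def)
    have "?c ** x = perm_mat \<sigma>" by (simp add: xi flip: matrix_mul_assoc)
    then have "b ** perm_mat \<sigma> = b ** ?c ** x" by (simp flip: matrix_mul_assoc)
    also have "\<dots> = x" unfolding b GLn_inv(2)[OF cG] by simp
    finally show ?thesis .
  qed
  ultimately show "b \<in> Borel \<and> b ** perm_mat \<sigma> = x" by simp
qed

lemma stein_idem_outside: "x \<notin> GLn \<Longrightarrow> stein_idem x = 0"
proof -
  assume x: "x \<notin> GLn"
  have "(if b ** perm_mat \<pi> = x then of_int (sign \<pi>) else 0) = (0 :: 'a)"
    if "\<pi> permutes UNIV" "b \<in> Borel" for \<pi> b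
    using that x GLn_mult[OF _ perm_mat_GLn[OF that(1)], of b] by (auto simp: Borel_def)
  then have "(\<Sum>\<pi>\<in>{\<pi>. \<pi> permutes UNIV}. \<Sum>b\<in>Borel. if b ** perm_mat \<pi> = x then of_int (sign \<pi>) else 0) = (0 :: 'a)"
    by (intro sum.neutral ballI) simp
  then show ?thesis unfolding stein_idem_def by simp
qed

lemma stein_idem_GLn:
  fixes x :: "(('k::{field,finite}, 'n::{finite,linorder}) vec, 'n) vec"
  defines "\<rho> \<equiv> \<lambda>i. ly (matrix_inv x $ i)"
  assumes x: "x \<in> GLn"
  shows "stein_idem x = inverse (of_nat (card (GLn :: (('k, 'n) vec, 'n) vec set) div card (Unip :: (('k, 'n) vec, 'n) vec set)))
    * (if inj \<rho> then of_int (sign \<rho>) else 0)"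
proof -
  let ?b = "matrix_inv (perm_mat (inv \<rho>) ** matrix_inv x)"
  let ?S = "\<Sum>\<pi>\<in>{\<pi>. \<pi> permutes UNIV}. \<Sum>b\<in>Borel. if b ** perm_mat \<pi> = x then of_int (sign \<pi>) else (0 :: 'k)"
  have "?S = (if inj \<rho> then of_int (sign \<rho>) else 0)"
  proof (cases "inj \<rho>")
    case False
    then have "(if b ** perm_mat \<pi> = x then of_int (sign \<pi>) else 0) = (0 :: 'k)"
      if "\<pi> permutes UNIV" "b \<in> Borel" for \<pi> b
      using bruhat_iff[OF x that(1), of b] that(2) unfolding \<rho>_def by auto
    then have "?S = 0" by (intro sum.neutral ballI) simp
    then show ?thesis using False by simp
  next
    case True
    then have bij: "bij \<rho>" by (simp add: bij_def finite_UNIV_inj_surj)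
    have p: "\<rho> permutes UNIV" using bij_imp_permutes[OF bij] by simp
    have pi: "inv \<rho> permutes UNIV" using p by (rule permutes_inv)
    have iff: "b \<in> Borel \<and> b ** perm_mat \<pi> = x \<longleftrightarrow> \<pi> = inv \<rho> \<and> b = ?b"
      if "\<pi> permutes UNIV" for \<pi> b
      using bruhat_iff[OF x that, of b] True unfolding \<rho>_def by simp
    have bB: "?b \<in> Borel" using iff[OF pi, of ?b] by simp
    have "?S = (\<Sum>\<pi>\<in>{\<pi>. \<pi> permutes UNIV}. if \<pi> = inv \<rho> then of_int (sign (inv \<rho>)) else 0)"
    proof (rule sum.cong)
      fix \<pi> :: "'n \<Rightarrow> 'n" assume "\<pi> \<in> {\<pi>. \<pi> permutes UNIV}"
      then have \<pi>: "\<pi> permutes UNIV" by simp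
      have "(\<Sum>b\<in>Borel. if b ** perm_mat \<pi> = x then of_int (sign \<pi>) else (0 :: 'k))
        = (\<Sum>b\<in>Borel. if b = ?b then (if \<pi> = inv \<rho> then of_int (sign (inv \<rho>)) else 0) else 0)"
        by (intro sum.cong refl) (use iff[OF \<pi>] in auto)
      then show "(\<Sum>b\<in>Borel. if b ** perm_mat \<pi> = x then of_int (sign \<pi>) else (0 :: 'k))
        = (if \<pi> = inv \<rho> then of_int (sign (inv \<rho>)) else 0)" using bB by simp
    qed simp
    also have "\<dots> = of_int (sign (inv \<rho>))" using pi by (simp add: finite_permutations)
    also have "sign (inv \<rho>) = sign \<rho>" 
    proof (rule sign_inverse)
      show "permutation \<rho>" unfolding permutation_permutes using p by (intro exI[of _ UNIV]) simp
    qed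
    finally show ?thesis using True by simp
  qed
  then show ?thesis by (simp add: stein_idem_def)
qed

section \<open>The top degree and the Steinberg module\<close>

text \<open>For positive \<open>L\<close> and \<open>q\<close>, the componentwise largest exponent
  outside the monomial ideal of the powers \<open>L * q ^ pos i\<close>.\<close>

definition TM :: "nat \<Rightarrow> nat \<Rightarrow> 'n::{finite,linorder} \<Rightarrow>\<^sub>0 nat" where
  "TM q L = (\<Sum>i\<in>UNIV. single i (L * q ^ pos i - 1))"

definition phi :: "nat \<Rightarrow> nat \<Rightarrow> ('k::{field,finite}, 'n::{finite,linorder}) sympoly \<Rightarrow> 'k" where
  "phi L k f = lookup (f * Lam ^ (L - k)) (TM CARD('k) L)"

lemma phi_add: "phi L k (f + g) = phi L k f + phi L k g"
  by (simp add: phi_def distrib_right lookup_add)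

lemma phi_pconst: "phi L k (pconst c * f) = c * phi L k f"
  by (simp add: phi_def mult.assoc)

lemma phi_0 [simp]: "phi L k 0 = 0"
  by (simp add: phi_def)

lemma phi_sum: "phi L k (sum f A) = (\<Sum>x\<in>A. phi L k (f x))"
  by (induction A rule: infinite_finite_induct) (simp_all add: phi_add)

lemma lookup_TM_MI:
  assumes "f \<in> (MI (\<lambda>i. L * CARD('k) ^ pos i) :: ('k::{field,finite}, 'n::{finite,linorder}) sympoly set)" "L \<ge> 1"
  shows "lookup f (TM CARD('k) L) = 0"
proof (rule ccontr)
  assume "lookup f (TM CARD('k) L) \<noteq> 0"
  then obtain j :: 'n where "L * CARD('k) ^ pos j \<le> lookup (TM CARD('k) L) j"
    using assms(1) unfolding MI_def by blast
  moreover have "L * CARD('k) ^ pos j > 0" using assms(2) by simp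
  ultimately show False unfolding TM_def lookup_sum_single by linarith
qed

text \<open>Take the last \<open>i\<close> for which some vector supported from \<open>i\<close> on
  lies outside \<open>H\<close>. All vectors supported strictly after \<open>i\<close> lie in
  \<open>H\<close>, so a monic vector of \<open>H\<close> with leading index \<open>i\<close> would
  force that outside vector into \<open>H\<close>.\<close>

lemma ex_Mon_disjoint:
  fixes H :: "('k::field, 'n::{finite,linorder}) vec set"
  assumes H: "vec.subspace H" "H \<noteq> UNIV"
  obtains i where "Mon i \<inter> H = {}"
proof -
  let ?S = "\<lambda>i. {v :: ('k, 'n) vec. \<forall>j<i. v $ j = 0}"
  let ?I = "{i. \<not> ?S i \<subseteq> H}"
  have "\<not> j < Min (UNIV :: 'n set)" for j :: 'n by (rule leD) simp
  then have "UNIV \<subseteq> ?S (Min UNIV)" by blast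
  then have "\<not> ?S (Min UNIV) \<subseteq> H" using H(2) by (meson order.trans top.extremum_uniqueI)
  then have ne: "?I \<noteq> {}" by blast
  let ?i = "Max ?I"
  have "?i \<in> ?I" using ne by (intro Max_in) auto
  then obtain v where v: "\<And>j. j < ?i \<Longrightarrow> v $ j = 0" "v \<notin> H" by blast
  have above: "w \<in> H" if w: "\<And>j. j \<le> ?i \<Longrightarrow> w $ j = 0" for w
  proof (cases "w = 0")
    case False
    then have l: "?i < ly w" using w by (rule ly_greater)
    have "ly w \<notin> ?I"
    proof
      assume "ly w \<in> ?I"
      then have "ly w \<le> ?i" by (intro Max_ge finite)
      then show False using l by (rule leD[THEN notE])
    qed
    then show ?thesis using ly_props(2)[OF False] by blast
  qed (use H(1) vec.subspace_0 in simp)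
  have "Mon ?i \<inter> H = {}"
  proof (rule ccontr)
    assume "Mon ?i \<inter> H \<noteq> {}"
    then obtain u where u: "u \<in> Mon ?i" "u \<in> H" by blast
    have "(v - v $ ?i *s u) $ j = 0" if "j \<le> ?i" for j
      using that u(1) v(1)[of j] by (cases "j = ?i") (auto simp: Mon_def)
    then have "v - v $ ?i *s u \<in> H" by (rule above)
    then have "(v - v $ ?i *s u) + v $ ?i *s u \<in> H"
      using u(2) H(1) by (intro vec.subspace_add vec.subspace_scale)
    then show False using v(2) by simp
  qed
  then show ?thesis by (rule that)
qed

section \<open>Invariance of the ideal and the functional \<open>phi\<close>\<close>

lemma hyperplane_neq_UNIV: "(H :: ('k::field, 'n::finite) vec set) \<in> hyperplanes \<Longrightarrow> H \<noteq> UNIV"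
proof
  assume "H \<in> hyperplanes" "H = UNIV"
  then have "vec.dim (UNIV :: ('k, 'n) vec set) = CARD('n) - 1" by (simp add: hyperplanes_def)
  moreover have "vec.dim (UNIV :: ('k, 'n) vec set) = CARD('n)" by (rule vec_dim_card)
  moreover have "CARD('n) > 0" by simp
  ultimately show False by linarith
qed

lemma hyperplane_image:
  fixes g :: "(('k::field, 'n::finite) vec, 'n) vec"
  assumes "H \<in> hyperplanes" "g \<in> GLn"
  shows "(\<lambda>v. v v* g) ` H \<in> hyperplanes"
proof -
  have "inj (\<lambda>v. v v* g)"
  proof (rule inj_on_inverseI)
    show "(v v* g) v* matrix_inv g = v" for v
      using GLn_inv(1)[OF assms(2)] by (simp add: vector_matrix_mul_assoc)
  qed
  then have "vec.dim ((\<lambda>v. v v* g) ` H) = vec.dim H"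
    by (intro vec.dim_image_eq[OF linear_vmult]) (rule inj_on_subset, auto)
  then show ?thesis using assms(1) subspace_vmult_image[of H g] by (simp add: hyperplanes_def)
qed

lemma Iid_sum: "(\<And>x. x \<in> A \<Longrightarrow> f x \<in> Iid k) \<Longrightarrow> sum f A \<in> Iid k"
  by (induction A rule: infinite_finite_induct) (auto simp: Iid_add)

lemma Iid_gl_act:
  fixes f :: "('k::{field,finite}, 'n::{finite,linorder}) sympoly"
  assumes "f \<in> Iid k" "g \<in> GLn"
  shows "gl_act f g \<in> Iid k"
proof -
  obtain c where f: "f = (\<Sum>H\<in>hyperplanes. c H * VH H ^ k)" using assms(1) unfolding Iid_def by blast
  have "gl_act (c H * VH H ^ k) g \<in> Iid k" if H: "H \<in> hyperplanes" for H
  proof -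
    obtain b where "gl_act (VH H) g = pconst b * VH ((\<lambda>v. v v* g) ` H)"
      using VH_gl_act[OF hyperplane_subspace[OF H]] assms(2) unfolding GLn_def by blast
    then have "gl_act (c H * VH H ^ k) g = gl_act (c H) g * (pconst b ^ k * VH ((\<lambda>v. v v* g) ` H) ^ k)"
      by (simp add: gl_act_simps power_mult_distrib)
    then show ?thesis using hyperplane_image[OF H assms(2)] by (simp add: Iid_scale Iid_VH)
  qed
  then show ?thesis unfolding f gl_act_simps by (intro Iid_sum)
qed

lemma prime_elem_dvd_prod:
  assumes "prime_elem P" "P dvd (\<Prod>x\<in>A. f x)"
  shows "\<exists>x\<in>A. P dvd f x"
  using assms(2)
proof (induction A rule: infinite_finite_induct)
  case (insert x F)
  then show ?case using assms(1) by (auto simp: prime_elem_dvd_mult_iff)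
qed (use assms(1) in \<open>auto simp: prime_elem_def\<close>)

context fq
begin

text \<open>The factor \<open>Lam ^ (L - k)\<close> completes the \<open>k\<close>-th power of the
  block product to its \<open>L\<close>-th power, which lies in the monomial ideal.\<close>

lemma phi_Mon_power:
  fixes h :: "('k, 'n::{finite,linorder}) sympoly"
  assumes "L = CARD('k) ^ a * r" "1 \<le> r" "r \<le> CARD('k) - 1" "k \<le> L"
  shows "phi L k (h * (\<Prod>v\<in>Mon i. linform v) ^ k) = 0"
proof -
  let ?V = "\<Prod>v\<in>Mon i. linform v :: ('k, 'n) sympoly"
  obtain R where R: "Lam = ?V * R"
    unfolding Lam_eq using prod.remove[of UNIV i "\<lambda>i. \<Prod>v\<in>Mon i. linform v :: ('k, 'n) sympoly"] by auto
  have "?V ^ L = ?V ^ k * ?V ^ (L - k)" using assms(4) by (simp flip: power_add)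
  then have "(h * ?V ^ k) * Lam ^ (L - k) = (h * R ^ (L - k)) * ?V ^ L"
    unfolding R by (simp only: power_mult_distrib ac_simps)
  also have "\<dots> \<in> MI (\<lambda>i. L * CARD('k) ^ pos i)"
    by (rule MI_scale[OF prod_Mon_power_MI[OF assms(3,1)]])
  finally show ?thesis unfolding phi_def by (rule lookup_TM_MI) (use assms(1,2) in simp)
qed

text \<open>Every hyperplane misses a whole block \<open>Mon i\<close>, whose product therefore
  divides \<open>VH H\<close>.\<close>

lemma phi_Iid:
  fixes f :: "('k, 'n::{finite,linorder}) sympoly"
  assumes "L = CARD('k) ^ a * r" "1 \<le> r" "r \<le> CARD('k) - 1" "k \<le> L" "f \<in> Iid k"
  shows "phi L k f = 0"
proof -
  obtain c where f: "f = (\<Sum>H\<in>hyperplanes. c H * VH H ^ k)" using assms(5) unfolding Iid_def by blast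
  have "phi L k (c H * VH H ^ k) = 0" if H: "H \<in> hyperplanes" for H
  proof -
    obtain i where i: "Mon i \<inter> H = {}"
      using ex_Mon_disjoint[OF hyperplane_subspace[OF H] hyperplane_neq_UNIV[OF H]] by blast
    obtain b where b: "VH H = pconst b * (\<Prod>u\<in>Mons - H. linform u)"
      using VH_eq[OF hyperplane_subspace[OF H]] by blast
    have "Mon i \<subseteq> Mons - H" using i by (auto simp: Mons_def)
    then obtain R where R: "(\<Prod>u\<in>Mons - H. linform u) = R * (\<Prod>v\<in>Mon i. linform v)"
      using prod.subset_diff[of "Mon i" "Mons - H" linform] by auto
    have "c H * VH H ^ k = (c H * (pconst b * R) ^ k) * (\<Prod>v\<in>Mon i. linform v) ^ k"
      unfolding b R by (simp only: power_mult_distrib ac_simps)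
    then show ?thesis by (simp only: phi_Mon_power[OF assms(1-4)])
  qed
  then show ?thesis unfolding f phi_sum by (intro sum.neutral) simp
qed

text \<open>If no row has leading index \<open>l\<close>, the forms of \<open>Mon l\<close> keep
  multiplicity \<open>k\<close> in \<open>P\<close>, and \<open>phi\<close> vanishes. Otherwise the
  leading exponent of \<open>P * Lam ^ (L - k)\<close> is the exponent read off by
  \<open>phi\<close>, and its coefficient is found by comparing leading coefficients in
  \<open>Lam ^ L\<close>.\<close>

lemma phi_quotient:
  fixes g :: "(('k, 'n::{finite,linorder}) vec, 'n) vec"
  assumes "L = CARD('k) ^ a * r" "1 \<le> r" "r \<le> CARD('k) - 1" "k \<le> L"
    "\<And>i. g $ i \<noteq> 0" "P * (\<Prod>i\<in>UNIV. linform (g $ i)) = Lam ^ k"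
  shows "phi L k P = (if inj (\<lambda>i. ly (g $ i)) then inverse (\<Prod>i\<in>UNIV. g $ i $ ly (g $ i)) else 0)"
proof (cases "inj (\<lambda>i. ly (g $ i))")
  case False
  then have "\<not> surj (\<lambda>i. ly (g $ i))" using finite_UNIV_surj_inj[of "\<lambda>i. ly (g $ i)"] by auto
  then obtain l where l: "\<And>i. l \<noteq> ly (g $ i)" unfolding surj_def by blast
  have "(\<Prod>v\<in>Mon l. linform v) ^ k dvd P"
  proof (rule prod_linform_power_dvd)
    show "v \<noteq> 0" if "v \<in> Mon l" for v :: "('k, 'n) vec" using that Mons_neq_0[of v] by (auto simp: Mons_def)
    show "w = v" if "v \<in> Mon l" "w \<in> Mon l" "w = c *s v" for v w :: "('k, 'n) vec" and c
      using that Mons_scale[of v w c] by (auto simp: Mons_def)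
    show "linform v ^ k dvd P" if v: "v \<in> Mon l" for v
    proof (rule prime_power_dvd_cofactor)
      have v0: "v \<noteq> 0" using v Mons_neq_0[of v] by (auto simp: Mons_def)
      then show prime: "prime_elem (linform v)" by (rule prime_elem_linform)
      show "\<not> linform v dvd (\<Prod>i\<in>UNIV. linform (g $ i))"
      proof
        assume "linform v dvd (\<Prod>i\<in>UNIV. linform (g $ i))"
        then obtain i where "linform v dvd linform (g $ i)"
          using prime_elem_dvd_prod[OF prime] by blast
        then obtain c where c: "g $ i = c *s v" using linform_dvd_linform[OF v0] by blast
        then have "c \<noteq> 0" using assms(5)[of i] by auto
        then have "ly (g $ i) = l" unfolding c using v by (intro ly_eqI) (auto simp: Mon_def)
        then show False using l by blast
      qed
      have "linform v dvd (Lam :: ('k, 'n) sympoly)"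
        unfolding Lam_def using v by (intro dvd_prodI) (auto simp: Mons_def)
      then show "linform v ^ k dvd (\<Prod>i\<in>UNIV. linform (g $ i)) * P"
        unfolding mult.commute[of _ P] assms(6) by (rule dvd_power_same)
    qed
  qed simp
  then obtain h where "P = (\<Prod>v\<in>Mon l. linform v) ^ k * h" by (elim dvdE)
  then have "P = h * (\<Prod>v\<in>Mon l. linform v) ^ k" by (simp only: mult.commute)
  then have "phi L k P = 0" by (simp only: phi_Mon_power[OF assms(1-4)])
  then show ?thesis using False by simp
next
  case True
  let ?P = "P * Lam ^ (L - k)" and ?D = "\<Prod>i\<in>UNIV. linform (g $ i)"
  have PD: "?P * ?D = Lam ^ L"
  proof -
    have "?P * ?D = (P * ?D) * Lam ^ (L - k)" by (simp only: ac_simps)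
    then show ?thesis using assms(4) by (simp add: assms(6) flip: power_add)
  qed
  have bij: "bij (\<lambda>i. ly (g $ i))" using True by (simp add: bij_def finite_UNIV_inj_surj)
  have "(\<Sum>i\<in>UNIV. single (ly (g $ i)) (1::nat)) = (\<Sum>i\<in>UNIV. single i 1)"
    by (rule sum.reindex_bij_betw[OF bij, of "\<lambda>i. single i (1::nat)"])
  moreover have "lead (\<Sum>i\<in>UNIV. single (ly (g $ i)) 1) ?D
      \<and> lookup ?D (\<Sum>i\<in>UNIV. single (ly (g $ i)) 1) = (\<Prod>i\<in>UNIV. lookup (linform (g $ i)) (single (ly (g $ i)) 1))"
    by (rule lead_prod) (auto simp del: One_nat_def intro!: lead_linform ly_props(2)[OF assms(5)])
  ultimately have D: "lead (\<Sum>i\<in>UNIV. single i 1) ?D"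
    "lookup ?D (\<Sum>i\<in>UNIV. single i 1) = (\<Prod>i\<in>UNIV. g $ i $ ly (g $ i))"
    by (simp_all only: lookup_linform_single)
  have D0: "(\<Prod>i\<in>UNIV. g $ i $ ly (g $ i)) \<noteq> 0" using ly_props(1)[OF assms(5)] by simp
  have "?P \<noteq> 0" using PD by auto
  then obtain m where m: "lead m ?P" "lookup ?P m \<noteq> 0" by (rule lead_ex_monomial)
  let ?M = "\<Sum>i\<in>(UNIV :: 'n set). single i (L * CARD('k) ^ pos i)"
  note M = lead_Lam_power[of L, where ?'k = 'k and ?'n = 'n]
  have "m + (\<Sum>i\<in>UNIV. single i 1) = ?M"
    using lead_unique[OF _ _ M(1)] M(2) lead_mult[OF m(1) D(1)] m(2) D D0 unfolding PD by simp
  \<comment> \<open>The subtraction of one in each exponent of \<open>TM\<close> matches the one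
    variable contributed by each row.\<close>
  moreover have "?M = TM CARD('k) L + (\<Sum>i\<in>UNIV. single i 1)"
  proof -
    have "L * CARD('k) ^ pos i \<ge> 1" for i :: 'n using assms(1,2) by simp
    then show ?thesis unfolding TM_def sum.distrib[symmetric] by (simp flip: single_add)
  qed
  ultimately have "m = TM CARD('k) L" by simp
  then have "phi L k P = lookup ?P m" by (simp add: phi_def)
  moreover have "lookup ?P m * (\<Prod>i\<in>UNIV. g $ i $ ly (g $ i)) = 1"
    using lead_mult(2)[OF m(1) D(1)] \<open>m + (\<Sum>i\<in>UNIV. single i 1) = ?M\<close> unfolding PD D(2) by (simp add: M(2))
  ultimately show ?thesis using True D0 by (simp add: divide_simps flip: inverse_eq_divide) (simp add: field_simps)
qed

end

text \<open>The change of variables \<open>h = x ** matrix_inv g\<close> turns the convolution into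
  a combination of right translates of \<open>s\<close>, so \<open>Steinberg\<close> is the span of
  the translates of the idempotent.\<close>

lemma gconv_eq:
  fixes s :: "'k::{field,finite} ^ 'n::finite ^ 'n \<Rightarrow> 'k"
  assumes "a \<in> galg" "\<And>x. x \<notin> GLn \<Longrightarrow> s x = 0"
  shows "gconv s a x = (\<Sum>g\<in>GLn. a g * ract s g x)"
proof (cases "x \<in> GLn")
  case True
  show ?thesis
    unfolding gconv_def ract_def
  proof (rule sum.reindex_bij_witness[of _ "\<lambda>g. x ** matrix_inv g" "\<lambda>h. matrix_inv h ** x"])
    fix h :: "'k ^ 'n ^ 'n" assume h: "h \<in> GLn"
    show "x ** matrix_inv (matrix_inv h ** x) = h"
      using h True by (simp add: matrix_inv_mult GLn_inv matrix_mul_assoc)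
    show "matrix_inv h ** x \<in> GLn" using h True by (simp add: GLn_inv GLn_mult)
    show "a (matrix_inv h ** x) * s (x ** matrix_inv (matrix_inv h ** x)) = s h * a (matrix_inv h ** x)"
      using h True by (simp add: matrix_inv_mult GLn_inv matrix_mul_assoc)
  next
    fix g :: "'k ^ 'n ^ 'n" assume g: "g \<in> GLn"
    show "matrix_inv (x ** matrix_inv g) ** x = g"
      using g True by (simp add: matrix_inv_mult GLn_inv flip: matrix_mul_assoc)
    show "x ** matrix_inv g \<in> GLn" using g True by (simp add: GLn_inv GLn_mult)
  qed
next
  case False
  have "a (matrix_inv h ** x) = 0" if "h \<in> GLn" for h
    using that assms(1) False GLn_mult_iff'[OF GLn_inv(3)[OF that]] by (auto simp: galg_def)
  moreover have "s (x ** matrix_inv g) = 0" if "g \<in> GLn" for g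
    using that assms(2) False GLn_mult_iff[OF GLn_inv(3)[OF that]] by simp
  ultimately show ?thesis by (simp add: gconv_def ract_def)
qed

text \<open>The map realising the isomorphism in the top degree. The power of \<open>det x\<close>
  produces the twist, and the inverse of the index is the normalisation that sends
  \<open>Ek k\<close> to \<open>stein_idem\<close> itself.\<close>

definition psi :: "nat \<Rightarrow> nat \<Rightarrow> ('k::{field,finite}, 'n::{finite,linorder}) sympoly \<Rightarrow> (('k, 'n) vec, 'n) vec \<Rightarrow> 'k" where
  "psi L k f x = (if x \<in> GLn then
     inverse (of_nat (card (GLn :: (('k, 'n) vec, 'n) vec set) div card (Unip :: (('k, 'n) vec, 'n) vec set)))
     * det x ^ (k - 1) * phi L k (gl_act f (matrix_inv x)) else 0)"

lemma psi_lin: "psi L k (pconst a * f + pconst b * g) x = a * psi L k f x + b * psi L k g x"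
  by (simp add: psi_def gl_act_simps phi_add phi_pconst algebra_simps)

lemma psi_add: "psi L k (f + g) x = psi L k f x + psi L k g x"
  using psi_lin[of L k 1 f 1 g x] by simp

lemma psi_sum: "psi L k (\<Sum>y\<in>A. pconst (c y) * f y) x = (\<Sum>y\<in>A. c y * psi L k (f y) x)"
proof (induction A rule: infinite_finite_induct)
  case (insert y F)
  then show ?case using psi_lin[of L k "c y" "f y" 1 "\<Sum>y\<in>F. pconst (c y) * f y" x] by simp
qed (simp_all add: psi_def gl_act_simps)

lemma psi_gl_act:
  assumes "g \<in> GLn"
  shows "psi L k (gl_act f g) x = det g ^ (k - 1) * ract (psi L k f) g x"
proof (cases "x \<in> GLn")
  case True
  have "matrix_inv (x ** matrix_inv g) = g ** matrix_inv x"
    using assms True by (simp add: matrix_inv_mult GLn_inv)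
  moreover have "det g * det (x ** matrix_inv g) = det x * (det g * det (matrix_inv g))"
    by (simp only: det_mul ac_simps)
  then have "det x ^ (k - 1) = det g ^ (k - 1) * det (x ** matrix_inv g) ^ (k - 1)"
    by (simp only: det_GLn_inv[OF assms] mult_1_right flip: power_mult_distrib)
  ultimately show ?thesis
    using assms True by (simp add: psi_def ract_def gl_act_gl_act GLn_mult GLn_inv)
next
  case False
  then have "x ** matrix_inv g \<notin> GLn" using GLn_mult_iff[OF GLn_inv(3)[OF assms]] by simp
  then show ?thesis using False by (simp add: psi_def ract_def)
qed

lemma homog_Ek:
  assumes "k \<ge> 1" "d + CARD('n) = k * card (Mons :: ('k::{field,finite}, 'n::{finite,linorder}) vec set)"
  shows "homog d (Ek k :: ('k, 'n) sympoly)"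
proof -
  let ?A = "range (\<lambda>i. axis i 1) :: ('k, 'n) vec set"
  have sub: "?A \<subseteq> Mons" by (auto simp: Mons_def Mon_def axis_def)
  have "card ?A = CARD('n)" by (subst card_image) (auto simp: inj_def axis_eq_axis)
  then have c: "card (Mons - ?A) + CARD('n) = card (Mons :: ('k, 'n) vec set)"
    using sub card_mono[OF _ sub] by (simp add: card_Diff_subset)
  have "homog ((k - 1) * card (Mons :: ('k, 'n) vec set) + card (Mons - ?A)) (Ek k :: ('k, 'n) sympoly)"
    unfolding Ek_def by (intro homog_mult homog_power homog_Lam homog_prod_linform)
  moreover have "(k - 1) * card (Mons :: ('k, 'n) vec set) + card (Mons - ?A) = d"
    using c assms by (cases k) (auto simp: algebra_simps)
  ultimately show ?thesis by simp
qed

text \<open>The order-reversing involution, that is, the longest element of the symmetric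
  group.\<close>

definition flip_idx :: "'n::{finite,linorder} \<Rightarrow> 'n" where
  "flip_idx i = idx (CARD('n) - 1 - pos i)"

lemma pos_flip_idx: "pos (flip_idx i) = CARD('n) - 1 - pos (i :: 'n::{finite,linorder})"
proof -
  have "CARD('n) - 1 - pos i < CARD('n)" using pos_less_card[of i] by linarith
  then show ?thesis by (simp add: flip_idx_def)
qed

lemma flip_idx_flip_idx [simp]: "flip_idx (flip_idx i) = (i :: 'n::{finite,linorder})"
proof -
  have "pos (flip_idx (flip_idx i)) = pos i" unfolding pos_flip_idx using pos_less_card[of i] by linarith
  then show ?thesis by (simp add: pos_inj)
qed

lemma flip_idx_less: "i < j \<Longrightarrow> flip_idx j < flip_idx (i :: 'n::{finite,linorder})"
proof -
  assume "i < j"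
  then have "pos (flip_idx i) < pos (flip_idx j)"
    unfolding pos_flip_idx using pos_less[of i j] pos_less_card[of i] pos_less_card[of j] by linarith
  then show ?thesis by (simp only: pos_less_iff)
qed

lemma flip_idx_permutes: "flip_idx permutes (UNIV :: 'n::{finite,linorder} set)"
  by (rule bij_imp_permutes) (auto intro!: o_bij[of flip_idx])

lemma mult_perm_flip: "(v ** perm_mat flip_idx) $ i $ j = v $ i $ flip_idx (j :: 'n::{finite,linorder})"
proof -
  have "(v ** perm_mat flip_idx) $ i $ j = (\<Sum>m\<in>UNIV. if m = flip_idx j then v $ i $ m else 0)"
    unfolding matrix_matrix_mult_def perm_mat_def vec_lambda_beta
  proof (rule sum.cong)
    fix m
    have "flip_idx m = j \<longleftrightarrow> m = flip_idx j" by auto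
    then show "v $ i $ m * (if flip_idx m = j then 1 else 0) = (if m = flip_idx j then v $ i $ m else 0)" by simp
  qed simp
  then show ?thesis by simp
qed

text \<open>These points are dual to the unitriangular translates of the idempotent, which proves
  their independence. With \<open>v = u ** matrix_inv u'\<close>, nonvanishing means that the last
  nonzero entries of the rows of \<open>v\<close> lie in distinct columns. For unitriangular
  \<open>v\<close> the one in row \<open>i\<close> lies in column \<open>i\<close> or later, so it
  is the diagonal entry and \<open>v\<close> is the identity.\<close>

lemma stein_idem_flip:
  fixes u u' :: "(('k::{field,finite}, 'n::{finite,linorder}) vec, 'n) vec"
  assumes u: "u \<in> Unip" "u' \<in> Unip"
  shows "stein_idem (matrix_inv (matrix_inv u' ** perm_mat flip_idx) ** matrix_inv u) \<noteq> 0 \<longleftrightarrow> u = u'"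
proof -
  let ?w = "perm_mat flip_idx :: (('k, 'n) vec, 'n) vec"
  let ?v = "u ** matrix_inv u'"
  let ?x = "matrix_inv (matrix_inv u' ** ?w) ** matrix_inv u"
  have w: "?w \<in> GLn" by (rule perm_mat_GLn[OF flip_idx_permutes])
  have uG: "u \<in> GLn" "u' \<in> GLn" using u Unip_GLn by auto
  have yG: "matrix_inv u' ** ?w \<in> GLn" by (intro GLn_mult GLn_inv(3) uG w)
  have xG: "?x \<in> GLn" by (intro GLn_mult GLn_inv(3) uG yG)
  have xi: "matrix_inv ?x = ?v ** ?w"
    using uG yG by (simp add: matrix_inv_mult GLn_inv matrix_mul_assoc)
  have v: "?v \<in> Unip" by (intro Unip_mult Unip_inv u)
  let ?\<rho> = "\<lambda>i. ly ((?v ** ?w) $ i)"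
  have nz: "(?v ** ?w) $ i \<noteq> 0" for i
    using GLn_inv(3)[OF xG] unfolding xi by (simp add: GLn_def invertible_row_nonzero)
  have ne: "?v $ i $ flip_idx (?\<rho> i) \<noteq> 0" for i
    using ly_props(1)[OF nz[of i]] unfolding mult_perm_flip .
  have zero: "?v $ i $ m = 0" if "flip_idx (?\<rho> i) < m" for i m
    using ly_props(2)[OF nz[of i], of "flip_idx m"] flip_idx_less[OF that] unfolding mult_perm_flip by simp
  have "inj ?\<rho> \<longleftrightarrow> u = u'"
  proof
    assume inj: "inj ?\<rho>"
    have "inj (\<lambda>i. flip_idx (?\<rho> i))"
      using inj permutes_inj[OF flip_idx_permutes] by (auto simp: inj_def)
    moreover have "i \<le> flip_idx (?\<rho> i)" for i
    proof (rule ccontr)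
      assume "\<not> i \<le> flip_idx (?\<rho> i)"
      moreover have "?v $ i \<in> Mon i" using v by (simp only: Unip_iff)
      ultimately have "?v $ i $ flip_idx (?\<rho> i) = 0" unfolding Mon_def by (simp add: not_le)
      then show False using ne[of i] by simp
    qed
    ultimately have eq: "flip_idx (?\<rho> i) = i" for i by (rule inj_ge_imp_id)
    have "?v $ i $ m = (if i = m then 1 else 0)" for i m
    proof -
      have "?v $ i \<in> Mon i" using v by (simp only: Unip_iff)
      then show ?thesis using zero[of i m] unfolding eq Mon_def by (cases i m rule: linorder_cases) auto
    qed
    then have "?v = mat 1" by (simp add: vec_eq_iff mat_def)
    then have "u ** (matrix_inv u' ** u') = u'" by (simp add: matrix_mul_assoc)
    then show "u = u'" by (simp add: GLn_inv[OF uG(2)])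
  next
    assume "u = u'"
    then have v1: "?v = mat 1" by (simp add: GLn_inv[OF uG(2)])
    have "?\<rho> i = flip_idx i" for i
      unfolding v1 by (rule ly_eqI) (auto simp: perm_mat_def)
    then show "inj ?\<rho>" using permutes_inj[OF flip_idx_permutes] by simp
  qed
  moreover have "of_int (sign ?\<rho>) \<noteq> (0 :: 'k)" by (simp add: sign_def)
  moreover have "inverse N * (if P then S else 0) \<noteq> 0 \<longleftrightarrow> P" if "N \<noteq> 0" "S \<noteq> 0" for N S :: 'k and P
    using that by simp
  ultimately show ?thesis
    unfolding stein_idem_GLn[OF xG] xi using index_neq_0[where ?'k = 'k and ?'n = 'n] by (simp only:)
qed

context fq
begin

text \<open>By \<open>phi_quotient\<close> and the factor \<open>det x ^ (k - 1)\<close>, the value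
  is, up to the index, the determinant of the inverse of \<open>x\<close> divided by the product of
  its leading entries. Sorting the rows by leading index makes the matrix triangular and leaves the
  sign.\<close>

lemma psi_Ek:
  assumes "L = CARD('k) ^ a * r" "1 \<le> r" "r \<le> CARD('k) - 1" "1 \<le> k" "k \<le> L"
  shows "psi L k (Ek k :: ('k, 'n::{finite,linorder}) sympoly) = stein_idem"
proof
  fix x :: "(('k, 'n) vec, 'n) vec"
  show "psi L k (Ek k) x = stein_idem x"
  proof (cases "x \<in> GLn")
    case True
    let ?y = "matrix_inv x" and ?N = "of_nat (card (GLn :: (('k, 'n) vec, 'n) vec set) div card (Unip :: (('k, 'n) vec, 'n) vec set)) :: 'k"
    let ?\<rho> = "\<lambda>i. ly (?y $ i)"
    note y = GLn_inv[OF True]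
    have det: "det x * det ?y = 1" by (rule det_GLn_inv[OF True])
    then have dy: "det ?y \<noteq> 0" by auto
    have nz: "?y $ i \<noteq> 0" for i using y(3) by (simp add: GLn_def invertible_row_nonzero)
    let ?P = "pconst (inverse (det ?y ^ k)) * gl_act (Ek k) ?y"
    have "?P * (\<Prod>i\<in>UNIV. linform (?y $ i)) = pconst (inverse (det ?y ^ k)) * (pconst (det ?y ^ k) * Lam ^ k)"
      unfolding mult.assoc Ek_gl_act[OF assms(4)] ..
    also have "\<dots> = Lam ^ k" using dy by (simp flip: pconst_mult mult.assoc)
    finally have "phi L k ?P = (if inj ?\<rho> then inverse (\<Prod>i\<in>UNIV. ?y $ i $ ?\<rho> i) else 0)"
      by (rule phi_quotient[OF assms(1-3,5) nz])
    then have "phi L k (gl_act (Ek k) ?y) = det ?y ^ k * (if inj ?\<rho> then inverse (\<Prod>i\<in>UNIV. ?y $ i $ ?\<rho> i) else 0)"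
      unfolding phi_pconst using dy by (simp add: field_simps)
    \<comment> \<open>The exponent \<open>k - 1\<close> is what leaves exactly one determinant
      factor.\<close>
    moreover have "det x ^ (k - 1) * det ?y ^ k = det ?y"
    proof -
      have "det x ^ (k - 1) * det ?y ^ k = (det x * det ?y) ^ (k - 1) * det ?y"
        using assms(4) by (cases k) (simp_all add: power_mult_distrib)
      then show ?thesis by (simp add: det)
    qed
    ultimately have psi: "psi L k (Ek k) x = inverse ?N * (det ?y * (if inj ?\<rho> then inverse (\<Prod>i\<in>UNIV. ?y $ i $ ?\<rho> i) else 0))"
      unfolding psi_def using True by (simp only: if_True mult.assoc) (simp add: mult.assoc[symmetric])
    have "det ?y * inverse (\<Prod>i\<in>UNIV. ?y $ i $ ?\<rho> i) = of_int (sign ?\<rho>)" if inj: "inj ?\<rho>"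
    proof -
      have bij: "bij ?\<rho>" using inj by (simp add: bij_def finite_UNIV_inj_surj)
      have p: "?\<rho> permutes UNIV" using bij_imp_permutes[OF bij] by simp
      \<comment> \<open>The inverse of \<open>x\<close> with its rows sorted by leading
        index.\<close>
      define c :: "(('k, 'n) vec, 'n) vec" where "c = (\<chi> i. ?y $ inv ?\<rho> i)"
      have c\<rho>: "c $ ?\<rho> i = ?y $ i" for i using inv_f_f[OF inj, of i] by (simp add: c_def)
      have "?\<rho> (inv ?\<rho> i) = i" for i using bij by (simp add: bij_is_surj surj_f_inv_f[where f="?\<rho>"])
      then have "c $ i $ j = 0" if "j < i" for i j
        using ly_props(2)[OF nz[of "inv ?\<rho> i"], of j] that by (simp add: c_def)
      then have "det c = (\<Prod>i\<in>UNIV. c $ i $ i)" by (rule det_upper)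
      also have "\<dots> = (\<Prod>i\<in>UNIV. c $ ?\<rho> i $ ?\<rho> i)"
        using prod.reindex_bij_betw[OF bij, of "\<lambda>i. c $ i $ i"] by simp
      finally have dc: "det c = (\<Prod>i\<in>UNIV. ?y $ i $ ?\<rho> i)" unfolding c\<rho> .
      have "?y = (\<chi> i. c $ ?\<rho> i)" unfolding c\<rho> by (simp add: vec_eq_iff)
      then have "det ?y = of_int (sign ?\<rho>) * det c" using det_permute_rows[OF p, of c] by simp
      moreover have "det c \<noteq> 0" unfolding dc using ly_props(1)[OF nz] by simp
      ultimately show ?thesis unfolding dc by simp
    qed
    then show ?thesis unfolding psi stein_idem_GLn[OF True] by simp
  qed (simp add: psi_def stein_idem_outside)
qed

lemma psi_Iid:
  fixes f :: "('k, 'n::{finite,linorder}) sympoly"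
  assumes "L = CARD('k) ^ a * r" "1 \<le> r" "r \<le> CARD('k) - 1" "k \<le> L" "f \<in> Iid k"
  shows "psi L k f x = 0"
  using phi_Iid[OF assms(1-4) Iid_gl_act[OF assms(5) GLn_inv(3)]] by (simp add: psi_def)

text \<open>Modulo the ideal every form is a combination of unitriangular translates of
  \<open>Ek k\<close>, whose images are translates of \<open>stein_idem\<close>. Independence of
  these gives injectivity modulo the ideal, and translates by all of \<open>GLn\<close> give
  surjectivity.\<close>

lemma psi_top_degree:
  assumes L: "L = CARD('k) ^ a * r" "1 \<le> r" "r \<le> CARD('k) - 1" "k \<le> L"
    and k: "k \<ge> 1" "d + CARD('n) = k * card (Mons :: ('k, 'n::{finite,linorder}) vec set)"
  shows "psi L k ` (Hom d :: ('k, 'n) sympoly set) = Steinberg"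
    "f \<in> Hom d \<Longrightarrow> psi L k f = (\<lambda>x. 0) \<Longrightarrow> f \<in> (Iid k :: ('k, 'n) sympoly set)"
proof -
  let ?psi = "psi L k :: ('k, 'n) sympoly \<Rightarrow> ((('k, 'n) vec, 'n) vec \<Rightarrow> 'k)"
  let ?E = "Ek k :: ('k, 'n) sympoly"
  have E: "?psi ?E = stein_idem" by (rule psi_Ek[OF L(1-3) k(1) L(4)])
  have hE: "?E \<in> Hom d" using homog_Ek[OF k] by (simp add: Hom_def)
  have decomp: "\<exists>c h. h \<in> Iid k \<and> f = (\<Sum>u\<in>Unip. pconst (c u) * gl_act ?E u) + h
      \<and> ?psi f = (\<lambda>x. \<Sum>u\<in>Unip. c u * ract stein_idem u x)" if f: "f \<in> Hom d" for f
  proof -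
    obtain c h where ch: "h \<in> Iid k" "f = (\<Sum>u\<in>Unip. pconst (c u) * gl_act ?E u) + h"
      using homog_top_decomp[OF k(1) _ k(2)] f unfolding Hom_def by blast
    have "?psi f x = (\<Sum>u\<in>Unip. c u * ract stein_idem u x)" for x
      unfolding ch(2) psi_add psi_Iid[OF L ch(1)] psi_sum
      by (simp add: psi_gl_act[OF Unip_GLn] E det_Unip)
    then show ?thesis using ch by blast
  qed
  show "?psi ` Hom d = Steinberg"
  proof (intro equalityI subsetI)
    fix s assume "s \<in> ?psi ` Hom d"
    then obtain f where f: "f \<in> Hom d" "s = ?psi f" by blast
    obtain c h where c: "?psi f = (\<lambda>x. \<Sum>u\<in>Unip. c u * ract stein_idem u x)" using decomp[OF f(1)] by blast
    let ?a = "\<lambda>u. if u \<in> Unip then c u else 0"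
    have a: "?a \<in> galg" by (simp add: galg_def Unip_GLn)
    have "gconv stein_idem ?a = s"
    proof
      fix x
      have "gconv stein_idem ?a x = (\<Sum>g\<in>GLn. ?a g * ract stein_idem g x)"
        by (rule gconv_eq[OF a stein_idem_outside])
      also have "\<dots> = (\<Sum>u\<in>Unip. c u * ract stein_idem u x)"
        by (rule sum.mono_neutral_cong_right) (auto simp: Unip_GLn)
      finally show "gconv stein_idem ?a x = s x" by (simp add: f(2) c)
    qed
    then show "s \<in> Steinberg" unfolding Steinberg_def using a by blast
  next
    fix s :: "(('k, 'n) vec, 'n) vec \<Rightarrow> 'k" assume "s \<in> Steinberg"
    then obtain a where a: "a \<in> galg" "s = gconv stein_idem a" unfolding Steinberg_def by blast
    \<comment> \<open>The inverse determinant powers undo the twist of each translate.\<close>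
    let ?f = "\<Sum>g\<in>GLn. pconst (a g * inverse (det g ^ (k - 1))) * gl_act ?E g"
    have "?f \<in> Hom d"
      using hE unfolding Hom_def by (intro CollectI homog_sum homog_pconst_mult homog_gl_act) simp
    moreover have "?psi ?f = s"
    proof
      fix x
      have "?psi ?f x = (\<Sum>g\<in>GLn. a g * inverse (det g ^ (k - 1)) * (det g ^ (k - 1) * ract stein_idem g x))"
        unfolding psi_sum by (intro sum.cong refl) (simp add: psi_gl_act E)
      also have "\<dots> = (\<Sum>g\<in>GLn. a g * ract stein_idem g x)"
        by (intro sum.cong refl) (simp add: GLn_def invertible_det_nz)
      also have "\<dots> = s x" unfolding a(2) by (rule gconv_eq[OF a(1) stein_idem_outside, symmetric])
      finally show "?psi ?f x = s x" .
    qed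
    ultimately show "s \<in> ?psi ` Hom d" by blast
  qed
  show "f \<in> Iid k" if f: "f \<in> Hom d" "?psi f = (\<lambda>x. 0)" for f
  proof -
    obtain c h where ch: "h \<in> Iid k" "f = (\<Sum>u\<in>Unip. pconst (c u) * gl_act ?E u) + h"
      "?psi f = (\<lambda>x. \<Sum>u\<in>Unip. c u * ract stein_idem u x)" using decomp[OF f(1)] by blast
    have "c u' = 0" if u': "u' \<in> Unip" for u'
    proof -
      \<comment> \<open>By \<open>stein_idem_flip\<close>, evaluation here isolates the coefficient
        of \<open>u'\<close>.\<close>
      let ?x = "matrix_inv (matrix_inv u' ** perm_mat flip_idx) :: (('k, 'n) vec, 'n) vec"
      have "0 = (\<Sum>u\<in>Unip. c u * ract stein_idem u ?x)" using fun_cong[OF ch(3), of ?x] f(2) by simp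
      also have "\<dots> = (\<Sum>u\<in>Unip. if u = u' then c u' * ract stein_idem u' ?x else 0)"
        using stein_idem_flip[OF _ u'] by (intro sum.cong) (auto simp: ract_def)
      also have "\<dots> = c u' * ract stein_idem u' ?x" using u' by simp
      finally show ?thesis using stein_idem_flip[OF u' u'] by (simp add: ract_def)
    qed
    then have "f = h" using ch(2) by simp
    then show ?thesis using ch(1) by simp
  qed
qed

theorem top_degree_Steinberg:
  assumes "k \<ge> 1" "d + CARD('n) = k * card (Mons :: ('k, 'n::{finite,linorder}) vec set)"
  shows "\<exists>\<psi> :: ('k, 'n) sympoly \<Rightarrow> ((('k, 'n) vec, 'n) vec \<Rightarrow> 'k).
          (\<forall>f g a b. f \<in> Hom d \<and> g \<in> Hom d \<longrightarrow>
              \<psi> (pconst a * f + pconst b * g) = (\<lambda>x. a * \<psi> f x + b * \<psi> g x))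
        \<and> \<psi> ` Hom d = Steinberg
        \<and> {f \<in> Hom d. \<psi> f = (\<lambda>x. 0)} = Hom d \<inter> Iid k
        \<and> (\<forall>f g. f \<in> Hom d \<and> g \<in> GLn \<longrightarrow>
              \<psi> (gl_act f g) = (\<lambda>x. det g ^ (k - 1) * ract (\<psi> f) g x))"
proof -
  \<comment> \<open>Here \<open>k\<close> is arbitrary, and any power of the field order that is at
    least \<open>k\<close> is an admissible \<open>L\<close> with \<open>r = 1\<close>.\<close>
  define L where "L = CARD('k) ^ k"
  have q2: "CARD('k) \<ge> 2" by (rule card_field_ge_2)
  have "k < 2 ^ k" by (rule less_exp)
  also have "(2::nat) ^ k \<le> CARD('k) ^ k" using q2 by (rule power_mono) simp
  finally have L: "L = CARD('k) ^ k * 1" "(1::nat) \<le> 1" "1 \<le> CARD('k) - 1" "k \<le> L"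
    using q2 by (simp_all add: L_def)
  note psi = psi_top_degree[OF L assms]
  show ?thesis
  proof (intro exI[of _ "psi L k"] conjI allI impI)
    show "{f \<in> Hom d. psi L k f = (\<lambda>x. 0)} = (Hom d \<inter> Iid k :: ('k, 'n) sympoly set)"
      using psi(2) psi_Iid[OF L] by blast
  qed (use psi(1) psi_lin psi_gl_act in \<open>auto simp: fun_eq_iff\<close>)
qed

end

section \<open>The total Steenrod operation\<close>

text \<open>The series of all \<open>P^j t^j\<close>. The Cartan formula says that it is
  multiplicative, so it is determined by \<open>x \<mapsto> x + x^q t\<close> on variables.\<close>

definition tot :: "('k::{field,finite}, 'n::finite) sympoly \<Rightarrow> ('k, 'n) sympoly poly" where
  "tot = peval (\<lambda>c. [:pconst c:]) (\<lambda>i. [:Xv i, Xv i ^ CARD('k):])"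

lemma ring_hm_const_poly: "ring_hm h \<Longrightarrow> ring_hm (\<lambda>c. [:h c:])"
  by (simp add: ring_hm_def one_pCons)

lemma ring_hm_tot: "ring_hm tot"
  unfolding tot_def by (intro ring_hm_peval ring_hm_const_poly ring_hm_pconst)

lemma tot_pconst [simp]: "tot (pconst c) = [:pconst c:]"
  unfolding tot_def by (rule peval_pconst) (intro ring_hm_const_poly ring_hm_pconst)

lemma tot_Xv [simp]: "tot (Xv i :: ('k::{field,finite}, 'n::finite) sympoly) = [:Xv i, Xv i ^ CARD('k):]"
  unfolding tot_def by (rule peval_Xv) (intro ring_hm_const_poly ring_hm_pconst)

lemma coeff_prod_poly:
  fixes P :: "'n::finite \<Rightarrow> 'a::comm_ring_1 poly"
  shows "coeff (\<Prod>i\<in>UNIV. P i) j = (\<Sum>J\<in>{J. (\<Sum>i\<in>UNIV. J i) = j}. \<Prod>i\<in>UNIV. coeff (P i) (J i))"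
proof -
  \<comment> \<open>A common bound for \<open>j\<close> and all degrees, which makes the exponent
    functions range over a finite product.\<close>
  define D where "D = j + (\<Sum>i\<in>UNIV. degree (P i))"
  have "degree (P i) \<le> (\<Sum>i\<in>UNIV. degree (P i))" for i by (rule member_le_sum) auto
  then have dD: "degree (P i) \<le> D" for i unfolding D_def by (rule trans_le_add2)
  have "(\<Prod>i\<in>UNIV. P i) = (\<Prod>i\<in>UNIV. \<Sum>t\<in>{..D}. monom (coeff (P i) t) t)"
    using poly_as_sum_of_monoms'[OF dD] by simp
  also have "\<dots> = (\<Sum>J\<in>(UNIV :: 'n set) \<rightarrow>\<^sub>E {..D}. \<Prod>i\<in>UNIV. monom (coeff (P i) (J i)) (J i))"
    by (rule prod_sum_PiE) auto
  also have "\<dots> = (\<Sum>J\<in>(UNIV :: 'n set) \<rightarrow>\<^sub>E {..D}. monom (\<Prod>i\<in>UNIV. coeff (P i) (J i)) (\<Sum>i\<in>UNIV. J i))"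
  proof -
    have "(\<Prod>i\<in>A. monom (coeff (P i) (J i)) (J i)) = monom (\<Prod>i\<in>A. coeff (P i) (J i)) (\<Sum>i\<in>A. J i)" for A J
      by (induction A rule: infinite_finite_induct) (simp_all add: mult_monom)
    then show ?thesis by simp
  qed
  finally have "coeff (\<Prod>i\<in>UNIV. P i) j
    = (\<Sum>J\<in>(UNIV :: 'n set) \<rightarrow>\<^sub>E {..D}. if (\<Sum>i\<in>UNIV. J i) = j then \<Prod>i\<in>UNIV. coeff (P i) (J i) else 0)"
    by (simp add: coeff_sum)
  also have "\<dots> = (\<Sum>J\<in>{J. (\<Sum>i\<in>UNIV. J i) = j}. \<Prod>i\<in>UNIV. coeff (P i) (J i))"
  proof (rule sum.mono_neutral_cong_right)
    show "finite ((UNIV :: 'n set) \<rightarrow>\<^sub>E {..D})" by (rule finite_PiE) auto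
    show "{J. (\<Sum>i\<in>UNIV. J i) = j} \<subseteq> (UNIV :: 'n set) \<rightarrow>\<^sub>E {..D}"
    proof
      fix J :: "'n \<Rightarrow> nat" assume "J \<in> {J. (\<Sum>i\<in>UNIV. J i) = j}"
      moreover have "J i \<le> (\<Sum>i\<in>UNIV. J i)" for i by (rule member_le_sum) auto
      ultimately show "J \<in> UNIV \<rightarrow>\<^sub>E {..D}" by (auto simp: PiE_iff D_def intro: trans_le_add1)
    qed
  qed auto
  finally show ?thesis .
qed

lemma coeff_tot_Xv_power:
  "coeff ([:Xv i, Xv i ^ CARD('k):] ^ m) J
    = pconst (of_nat (m choose J)) * (Xv i :: ('k::{field,finite}, 'n::finite) sympoly) ^ (m + (CARD('k) - 1) * J)"
proof (cases "J \<le> m")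
  case True
  have "CARD('k) * J + (m - J) = m + (CARD('k) - 1) * J"
    using True card_field_ge_2[where ?'k = 'k] by (cases "CARD('k)") auto
  then show ?thesis
    using coeff_linear_poly_power[OF True, of "Xv i :: ('k, 'n) sympoly" "Xv i ^ CARD('k)"]
    by (simp add: mult.assoc pconst_of_nat flip: power_mult power_add)
next
  case False
  have "degree ([:Xv i, Xv i ^ CARD('k):] ^ m :: ('k, 'n) sympoly poly) \<le> 1 * m"
    by (rule order.trans[OF degree_power_le]) simp
  then show ?thesis using False by (simp add: coeff_eq_0 binomial_eq_0)
qed

lemma coeff_tot:
  fixes f :: "('a::{field,finite}, 'n::finite) sympoly"
  shows "coeff (tot f) j = steen j f"
proof -
  have "tot f = (\<Sum>m\<in>keys f. [:pconst (lookup f m):] * (\<Prod>i\<in>UNIV. [:Xv i, Xv i ^ CARD('a):] ^ lookup m i))"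
    by (simp add: tot_def peval_def)
  then have "coeff (tot f) j = (\<Sum>m\<in>keys f. pconst (lookup f m) * coeff (\<Prod>i\<in>UNIV. [:Xv i, Xv i ^ CARD('a):] ^ lookup m i) j)"
    by (simp add: coeff_sum)
  then show ?thesis unfolding steen_def by (simp only: coeff_prod_poly coeff_tot_Xv_power)
qed

lemma steen_add: "steen j (f + g) = steen j f + steen j g"
  unfolding coeff_tot[symmetric] by (simp add: ring_hmD[OF ring_hm_tot])

lemma steen_0_arg [simp]: "steen j 0 = 0"
  unfolding coeff_tot[symmetric] by (simp add: ring_hmD[OF ring_hm_tot])

lemma steen_pconst: "steen j (pconst c * f) = pconst c * steen j f"
  unfolding coeff_tot[symmetric] by (simp add: ring_hmD[OF ring_hm_tot])

lemma steen_mult: "steen j (f * g) = (\<Sum>i\<le>j. steen i f * steen (j - i) g)"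
  unfolding coeff_tot[symmetric] by (simp add: ring_hmD[OF ring_hm_tot] coeff_mult)

lemma steen_0 [simp]: "steen 0 f = (f :: ('k::{field,finite}, 'n::finite) sympoly)"
proof -
  have "ring_hm (\<lambda>f :: ('k, 'n) sympoly. coeff (tot f) 0)"
    by (simp add: ring_hm_def ring_hmD[OF ring_hm_tot] coeff_mult)
  from ring_hm_eqI[OF this ring_hm_id, of f] show ?thesis unfolding coeff_tot[symmetric] by simp
qed

lemma ring_hm_map_poly:
  assumes "ring_hm h"
  shows "ring_hm (map_poly h)"
proof -
  note h = ring_hmD[OF assms]
  show ?thesis
    by (auto simp: ring_hm_def poly_eq_iff coeff_map_poly h(4) h(2) h(3) h(8) h(1) coeff_mult one_pCons coeff_pCons split: nat.split)
qed

context fq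
begin

lemma tot_linform: "tot (linform v :: ('k, 'n::finite) sympoly) = [:linform v, linform v ^ CARD('k):]"
proof -
  have "(linform v :: ('k, 'n) sympoly) ^ CARD('k) = (\<Sum>i\<in>UNIV. pconst (v $ i) * Xv i ^ CARD('k))"
    using frob_sum[of "\<lambda>i. pconst (v $ i) * (Xv i :: ('k, 'n) sympoly)" UNIV 1]
    by (simp add: linform_def power_mult_distrib field_power_card flip: pconst_power)
  moreover have "tot (linform v :: ('k, 'n) sympoly) = (\<Sum>i\<in>UNIV. [:pconst (v $ i) * Xv i, pconst (v $ i) * Xv i ^ CARD('k):])"
    by (simp add: linform_def ring_hmD[OF ring_hm_tot] mult.commute)
  moreover have "(\<Sum>i\<in>A. [:a i, b i:]) = [:sum a A, sum b A:]" for A and a b :: "'n \<Rightarrow> ('k, 'n) sympoly"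
    by (induction A rule: infinite_finite_induct) auto
  ultimately show ?thesis by (simp add: linform_def)
qed

text \<open>Both composites are ring homomorphisms into polynomials in the series variable. They
  agree on variables because the Frobenius power is additive on linear forms.\<close>

lemma steen_gl_act:
  fixes f :: "('k, 'n::finite) sympoly"
  shows "steen j (gl_act f g) = gl_act (steen j f) g"
proof -
  have "tot (gl_act f g) = map_poly (\<lambda>f. gl_act f g) (tot f)"
  proof (rule ring_hm_eqI[of "\<lambda>f. tot (gl_act f g)" "\<lambda>f. map_poly (\<lambda>f. gl_act f g) (tot f)"])
    show "ring_hm (\<lambda>f. tot (gl_act f g))" by (rule ring_hm_comp[OF ring_hm_tot ring_hm_gl_act])
    show "ring_hm (\<lambda>f. map_poly (\<lambda>f. gl_act f g) (tot f))"
      by (rule ring_hm_comp[OF ring_hm_map_poly[OF ring_hm_gl_act] ring_hm_tot])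
  qed (simp_all add: gl_act_Xv tot_linform map_poly_pCons gl_act_simps)
  then show ?thesis unfolding coeff_tot[symmetric] by (simp add: coeff_map_poly gl_act_simps)
qed

end

lemma homog_steen:
  fixes f :: "('k::{field,finite}, 'n::finite) sympoly"
  assumes "homog N f"
  shows "homog (N + (CARD('k) - 1) * j) (steen j f)"
  unfolding steen_def
proof (intro homog_sum homog_pconst_mult)
  fix m J assume "m \<in> keys f" "J \<in> {J :: 'n \<Rightarrow> nat. (\<Sum>i\<in>UNIV. J i) = j}"
  then have mJ: "mdeg m = N" "(\<Sum>i\<in>UNIV. J i) = j" using assms by (auto simp: homog_def)
  have "homog (\<Sum>i\<in>UNIV. lookup m i + (CARD('k) - 1) * J i)
    (\<Prod>i\<in>UNIV. pconst (of_nat (lookup m i choose J i)) * (Xv i :: ('k, 'n) sympoly) ^ (lookup m i + (CARD('k) - 1) * J i))"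
    by (rule homog_prod, rule homog_pconst_mult) (metis homog_Xv homog_power mult.right_neutral One_nat_def)
  moreover have "(\<Sum>i\<in>UNIV. lookup m i + (CARD('k) - 1) * J i) = N + (CARD('k) - 1) * j"
    using mJ by (simp add: sum.distrib mdeg_def flip: sum_distrib_left)
  ultimately show "homog (N + (CARD('k) - 1) * j)
    (\<Prod>i\<in>UNIV. pconst (of_nat (lookup m i choose J i)) * (Xv i :: ('k, 'n) sympoly) ^ (lookup m i + (CARD('k) - 1) * J i))"
    by simp
qed

text \<open>If the total of \<open>J\<close> exceeds the degree, some \<open>J i\<close> exceeds the
  exponent of its variable and the binomial coefficient vanishes.\<close>

lemma steen_unstable:
  fixes f :: "('k::{field,finite}, 'n::finite) sympoly"
  assumes "homog N f" "N < j"
  shows "steen j f = 0"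
  unfolding steen_def
proof (rule sum.neutral, rule ballI)
  fix m assume "m \<in> keys f"
  then have m: "mdeg m = N" using assms by (auto simp: homog_def)
  have "(\<Prod>i\<in>UNIV. pconst (of_nat (lookup m i choose J i)) * (Xv i :: ('k, 'n) sympoly) ^ (lookup m i + (CARD('k) - 1) * J i)) = 0"
    if J: "(\<Sum>i\<in>UNIV. J i) = j" for J
  proof -
    have "\<exists>i. lookup m i < J i"
    proof (rule ccontr)
      assume "\<nexists>i. lookup m i < J i"
      then have "(\<Sum>i\<in>UNIV. J i) \<le> mdeg m" unfolding mdeg_def by (intro sum_mono) (simp add: not_less)
      then show False using J m assms(2) by simp
    qed
    then obtain i where "lookup m i < J i" ..
    then show ?thesis by (intro prod_zero) (auto simp: binomial_eq_0 intro!: exI[of _ i])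
  qed
  then show "pconst (lookup f m) * (\<Sum>J\<in>{J. (\<Sum>i\<in>UNIV. J i) = j}. \<Prod>i\<in>UNIV. pconst (of_nat (lookup m i choose J i)) * (Xv i :: ('k, 'n) sympoly) ^ (lookup m i + (CARD('k) - 1) * J i)) = 0"
    by simp
qed

lemma hc_steen:
  fixes f :: "('k::{field,finite}, 'n::finite) sympoly"
  shows "hc N (steen j f) = (if (CARD('k) - 1) * j \<le> N then steen j (hc (N - (CARD('k) - 1) * j) f) else 0)"
proof (induction f rule: poly_mapping_induct)
  case (single m c)
  show ?case
    using hc_homog[OF homog_steen[OF homog_single[of m "mdeg m" c]], of N j]
      hc_homog[OF homog_single[of m "mdeg m" c]] by auto
qed (simp add: steen_add hc_add)

section \<open>Closure properties of hit elements\<close>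

lemma Pplus_0: "0 \<in> Pplus"
  unfolding Pplus_def by (intro CollectI exI[of _ "{}"]) simp

lemma Pplus_steen: "j > 0 \<Longrightarrow> steen j f \<in> Pplus"
  unfolding Pplus_def by (intro CollectI exI[of _ "{j}"] exI[of _ "\<lambda>_. f"]) simp

lemma Pplus_add:
  assumes "f \<in> Pplus" "g \<in> Pplus"
  shows "f + g \<in> Pplus"
proof -
  obtain J F where J: "finite J" "\<forall>j\<in>J. 0 < j" "f = (\<Sum>j\<in>J. steen j (F j))" using assms(1) unfolding Pplus_def by blast
  obtain I G where I: "finite I" "\<forall>j\<in>I. 0 < j" "g = (\<Sum>j\<in>I. steen j (G j))" using assms(2) unfolding Pplus_def by blast
  let ?H = "\<lambda>j. (if j \<in> J then F j else 0) + (if j \<in> I then G j else 0)"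
  have "f = (\<Sum>j\<in>J \<union> I. steen j (if j \<in> J then F j else 0))"
    unfolding J(3) by (rule sum.mono_neutral_cong_left) (use J I in auto)
  moreover have "g = (\<Sum>j\<in>J \<union> I. steen j (if j \<in> I then G j else 0))"
    unfolding I(3) by (rule sum.mono_neutral_cong_left) (use J I in auto)
  ultimately have "f + g = (\<Sum>j\<in>J \<union> I. steen j (?H j))" by (simp add: steen_add sum.distrib)
  then show ?thesis unfolding Pplus_def using J I by (intro CollectI exI[of _ "J \<union> I"] exI[of _ ?H]) auto
qed

lemma Pplus_sum: "(\<And>x. x \<in> A \<Longrightarrow> f x \<in> Pplus) \<Longrightarrow> sum f A \<in> Pplus"
  by (induction A rule: infinite_finite_induct) (auto simp: Pplus_0 Pplus_add)

lemma Pplus_closed: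
  assumes "f \<in> Pplus" "h 0 = 0" "\<And>a b. h (a + b) = h a + h b" "\<And>j F. j > 0 \<Longrightarrow> h (steen j F) \<in> Pplus"
  shows "h f \<in> Pplus"
proof -
  obtain J F where J: "finite J" "\<forall>j\<in>J. 0 < j" "f = (\<Sum>j\<in>J. steen j (F j))" using assms(1) unfolding Pplus_def by blast
  have "h (\<Sum>j\<in>J. steen j (F j)) = (\<Sum>j\<in>J. h (steen j (F j)))"
    by (induction J rule: infinite_finite_induct) (auto simp: assms(2,3))
  then show ?thesis using J assms(4) by (auto intro!: Pplus_sum)
qed

lemma Pplus_pconst:
  assumes "f \<in> Pplus"
  shows "pconst c * f \<in> Pplus"
  using assms by (rule Pplus_closed) (auto simp: distrib_left intro: Pplus_steen simp flip: steen_pconst)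

lemma Pplus_uminus: "f \<in> Pplus \<Longrightarrow> - f \<in> Pplus"
  using Pplus_pconst[of f "- 1"] by (simp add: pconst_uminus)

lemma Pplus_hc: "f \<in> Pplus \<Longrightarrow> hc N f \<in> Pplus"
  by (rule Pplus_closed) (auto simp: hc_add hc_steen Pplus_steen Pplus_0)

lemma (in fq) Pplus_gl_act: "(f :: ('k, 'n::finite) sympoly) \<in> Pplus \<Longrightarrow> gl_act f g \<in> Pplus"
  by (rule Pplus_closed[of f "\<lambda>f. gl_act f g"]) (auto simp: gl_act_simps Pplus_steen simp flip: steen_gl_act)

section \<open>Binomial coefficients modulo the characteristic\<close>

context fq
begin

text \<open>With \<open>Q = CARD('k) ^ s\<close>, compare coefficients in \<open>(1 + X)^(Q \<alpha>
  + \<beta>) = (1 + X^Q)^\<alpha> (1 + X)^\<beta>\<close>. As both remainders are below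
  \<open>Q\<close>, only the term \<open>X^(Q \<gamma>)\<close> of the first factor
  contributes.\<close>

lemma lucas:
  assumes "\<beta> < CARD('k) ^ s" "\<delta> < CARD('k) ^ s"
  shows "(of_nat ((CARD('k) ^ s * \<alpha> + \<beta>) choose (CARD('k) ^ s * \<gamma> + \<delta>)) :: 'k)
    = of_nat (\<alpha> choose \<gamma>) * of_nat (\<beta> choose \<delta>)"
proof -
  let ?Q = "CARD('k) ^ s" and ?X = "[:1, 1:] :: 'k poly"
  have bin: "coeff (?X ^ N) j = of_nat (N choose j)" for N j
  proof (cases "j \<le> N")
    case False
    then have "degree (?X ^ N) < j" using degree_power_le[of ?X N] by simp
    then show ?thesis using False by (simp add: coeff_eq_0 binomial_eq_0)
  qed (simp add: coeff_linear_poly_power)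
  have Q0: "?Q > 0" by simp
  have "?X ^ ?Q = (1 + monom 1 1) ^ ?Q" by (simp add: monom_altdef one_pCons)
  also have "\<dots> = 1 + monom 1 ?Q"
  proof -
    have "(1 + monom 1 1) ^ ?Q = 1 ^ ?Q + (monom 1 1 :: 'k poly) ^ ?Q"
      by (rule freshmans_dream'[where n = "e * s"]) (simp_all add: CHAR_k prime_p card_k power_mult)
    then show ?thesis by (simp add: monom_power)
  qed
  finally have XQ: "?X ^ ?Q = 1 + monom 1 ?Q" .
  have "?X ^ (?Q * \<alpha> + \<beta>) = (monom 1 ?Q + 1) ^ \<alpha> * ?X ^ \<beta>"
    by (simp add: power_add power_mult XQ add.commute)
  also have "\<dots> = (\<Sum>i\<le>\<alpha>. of_nat (\<alpha> choose i) * monom 1 (?Q * i) * ?X ^ \<beta>)"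
    by (simp add: binomial_ring monom_power sum_distrib_right)
  finally have "of_nat ((?Q * \<alpha> + \<beta>) choose (?Q * \<gamma> + \<delta>))
    = coeff (\<Sum>i\<le>\<alpha>. of_nat (\<alpha> choose i) * monom 1 (?Q * i) * ?X ^ \<beta>) (?Q * \<gamma> + \<delta>)"
    by (simp add: bin[symmetric])
  also have "\<dots> = (\<Sum>i\<le>\<alpha>. of_nat (\<alpha> choose i) * (if ?Q * \<gamma> + \<delta> < ?Q * i then 0 else of_nat (\<beta> choose (?Q * \<gamma> + \<delta> - ?Q * i))))"
    unfolding coeff_sum by (intro sum.cong refl) (simp add: mult.assoc of_nat_poly coeff_monom_mult bin)
  also have "\<dots> = (\<Sum>i\<le>\<alpha>. if i = \<gamma> then of_nat (\<alpha> choose \<gamma>) * of_nat (\<beta> choose \<delta>) else 0)"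
  proof (rule sum.cong)
    fix i
    consider "i < \<gamma>" | "i = \<gamma>" | "\<gamma> < i" by linarith
    then show "of_nat (\<alpha> choose i) * (if ?Q * \<gamma> + \<delta> < ?Q * i then 0 else of_nat (\<beta> choose (?Q * \<gamma> + \<delta> - ?Q * i)))
      = (if i = \<gamma> then of_nat (\<alpha> choose \<gamma>) * of_nat (\<beta> choose \<delta>) else (0 :: 'k))"
    proof cases
      case 1
      then have "?Q * (i + 1) \<le> ?Q * \<gamma>" by (intro mult_le_mono2) simp
      then have "\<beta> < ?Q * \<gamma> + \<delta> - ?Q * i" using assms(1) by (simp add: algebra_simps)
      then show ?thesis using 1 by (simp add: binomial_eq_0)
    next
      case 3
      then have "?Q * (\<gamma> + 1) \<le> ?Q * i" by (intro mult_le_mono2) simp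
      then have "?Q * \<gamma> + \<delta> < ?Q * i" using assms(2) by (simp add: algebra_simps)
      then show ?thesis using 3 by simp
    qed simp
  qed simp
  also have "\<dots> = of_nat (\<alpha> choose \<gamma>) * of_nat (\<beta> choose \<delta>)"
    by (simp add: binomial_eq_0)
  finally show ?thesis .
qed

text \<open>Induction on the number of digits, by the last digit \<open>b\<close> of
  \<open>J\<close> in base \<open>CARD('k)\<close>. For \<open>b = 0\<close> the upper number ends
  in \<open>CARD('k) - 1\<close> and the digit can be stripped; for \<open>b > 0\<close> it ends in
  \<open>b - 1\<close>, too small to choose \<open>b\<close> from.\<close>

lemma binomial_top_zero:
  assumes "1 \<le> r" "r \<le> CARD('k) - 1"
  shows "0 < J \<Longrightarrow> (CARD('k) - 1) * J \<le> CARD('k) ^ s * r - 1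
    \<Longrightarrow> (of_nat ((CARD('k) ^ s * r - 1 - (CARD('k) - 1) * J) choose J) :: 'k) = 0"
proof (induction s arbitrary: J)
  case 0
  then have "(CARD('k) - 1) * 1 \<le> (CARD('k) - 1) * J" by (intro mult_le_mono2) simp
  moreover have "(CARD('k) - 1) * J \<le> r - 1" using 0(2) by simp
  ultimately have "CARD('k) - 1 \<le> r - 1" by linarith
  then have False using assms by linarith
  then show ?case ..
next
  case (Suc s)
  let ?q = "CARD('k)"
  have q2: "?q \<ge> 2" by (rule card_field_ge_2)
  define B b where "B = J div ?q" and "b = J mod ?q"
  have J: "J = ?q * B + b" "b < ?q" by (simp_all add: B_def b_def)
  define R where "R = ?q ^ s * r"
  have R: "?q ^ Suc s * r = ?q * R" by (simp add: R_def)
  have Rpos: "R > 0" using assms(1) by (simp add: R_def)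
  have le: "(?q - 1) * J \<le> ?q * R - 1" using Suc.prems(2) unfolding R .
  obtain q' where q': "?q = Suc q'" "q' \<ge> 1" using q2 by (cases ?q) auto
  show ?case
  proof (cases "b = 0")
    case True
    then have B: "B > 0" using Suc.prems(1) J by (cases B) auto
    have "?q * ((?q - 1) * B) \<le> ?q * R - 1" using le unfolding J(1) True by (simp add: ac_simps)
    moreover have "?q * R > 0" using Rpos by simp
    ultimately have "?q * ((?q - 1) * B) < ?q * R" by linarith
    then have lt: "(?q - 1) * B < R" by simp
    then have "?q * R - 1 - (?q - 1) * J = ?q * (R - 1 - (?q - 1) * B) + (?q - 1)"
    proof -
      obtain w where w: "R = (?q - 1) * B + 1 + w" using lt less_imp_Suc_add by fastforce
      have "?q * R = ?q * ((?q - 1) * B) + ?q + ?q * w"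
        unfolding w by (simp only: distrib_left mult_1_right)
      moreover have "(?q - 1) * J = ?q * ((?q - 1) * B)" unfolding J(1) True by (simp add: ac_simps)
      moreover have "R - 1 - (?q - 1) * B = w" by (simp add: w)
      ultimately show ?thesis using q2 by simp
    qed
    moreover have "(of_nat ((R - 1 - (?q - 1) * B) choose B) :: 'k) = 0"
      using Suc.IH[OF B] lt unfolding R_def by simp
    ultimately show ?thesis unfolding R using lucas[of "?q - 1" 1 0 "R - 1 - (?q - 1) * B" B] J(1) True q2 by simp
  next
    case False
    have lt: "(?q - 1) * B + b \<le> R"
    proof -
      have "?q * ((?q - 1) * B + b) - b = (?q - 1) * J" unfolding J(1) q' by (simp add: algebra_simps)
      then have "?q * ((?q - 1) * B + b) \<le> ?q * R - 1 + b" using le by linarith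
      then have "?q * ((?q - 1) * B + b) < ?q * (R + 1)" using J(2) by simp
      from this[unfolded mult_less_cancel1] show ?thesis by simp
    qed
    then obtain w where w: "R = (?q - 1) * B + b + w" using le_Suc_ex by blast
    have "?q * R - 1 - (?q - 1) * J = ?q * w + (b - 1)"
    proof -
      have "?q * R = (?q - 1) * J + b + ?q * w" unfolding w J(1) q' by (simp add: algebra_simps)
      then show ?thesis using False by simp
    qed
    then show ?thesis unfolding R
      using lucas[of "b - 1" 1 b w B] J False by (simp add: binomial_eq_0)
  qed
qed

text \<open>The upper number ends in the digit \<open>0\<close>, so \<open>m\<close> must too for a
  nonzero value; stripping the digit leads to a smaller instance.\<close>

lemma binomial_q_mult_zero: "0 < m \<Longrightarrow> (of_nat ((CARD('k) * m) choose m) :: 'k) = 0"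
proof (induction m rule: less_induct)
  case (less m)
  let ?q = "CARD('k)"
  have q2: "?q \<ge> 2" by (rule card_field_ge_2)
  have m: "m = ?q * (m div ?q) + m mod ?q" by simp
  have *: "(of_nat ((?q * m + 0) choose (?q * (m div ?q) + m mod ?q)) :: 'k)
    = of_nat (m choose (m div ?q)) * of_nat (0 choose (m mod ?q))"
    using lucas[of 0 1 "m mod ?q" m "m div ?q"] by simp
  show ?case
  proof (cases "m mod ?q = 0")
    case True
    then have "m = ?q * (m div ?q)" by (simp add: mod_0_imp_dvd)
    moreover have "m div ?q > 0" using less.prems True by (intro Nat.gr0I) auto
    moreover have "m div ?q < m" using less.prems q2 by simp
    ultimately have "(of_nat (m choose (m div ?q)) :: 'k) = 0" using less.IH by metis
    then show ?thesis using * by (simp flip: m)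
  next
    case False
    then show ?thesis using * by (simp add: binomial_eq_0 flip: m)
  qed
qed

end

section \<open>Conjugate operations\<close>

text \<open>Coefficients of the inverse of the total operation: \<open>chi\<close> solves the
  equations of a left inverse, \<open>chr\<close> below those of a right inverse.\<close>

fun chi :: "nat \<Rightarrow> ('k::{field,finite}, 'n::finite) sympoly \<Rightarrow> ('k, 'n) sympoly" where
  "chi m G = (if m = 0 then G else - (\<Sum>i\<in>{1..m}. chi (m - i) (steen i G)))"

fun chr :: "nat \<Rightarrow> ('k::{field,finite}, 'n::finite) sympoly \<Rightarrow> ('k, 'n) sympoly" where
  "chr m G = (if m = 0 then G else - (\<Sum>c<m. steen (m - c) (chr c G)))"

declare chi.simps [simp del] chr.simps [simp del]

lemma sum_chi: "(\<Sum>i\<le>m. chi (m - i) (steen i G)) = (if m = 0 then G else 0)"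
proof (cases "m = 0")
  case False
  have "{..m} = insert 0 {1..m}" by auto
  then show ?thesis using False chi.simps[of m G] by simp
qed (simp add: chi.simps)

lemma sum_chr: "(\<Sum>c\<le>m. steen (m - c) (chr c G)) = (if m = 0 then G else 0)"
proof (cases "m = 0")
  case False
  have "{..m} = insert m {..<m}" by auto
  then show ?thesis using False chr.simps[of m G] by simp
qed (simp add: chr.simps)

lemma chi_add: "chi m (F + G) = chi m F + chi m G"
proof (induction m arbitrary: F G rule: less_induct)
  case (less m)
  have "(\<Sum>i\<in>{1..m}. chi (m - i) (steen i (F + G))) = (\<Sum>i\<in>{1..m}. chi (m - i) (steen i F) + chi (m - i) (steen i G))"
    by (rule sum.cong) (auto simp: steen_add less)
  then show ?case by (simp add: chi.simps[of m] sum.distrib)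
qed

lemma chi_0_arg [simp]: "chi m 0 = 0"
  using chi_add[of m 0 0] by simp

lemma chi_sum: "chi m (sum F A) = (\<Sum>x\<in>A. chi m (F x))"
  by (induction A rule: infinite_finite_induct) (simp_all add: chi_add)

text \<open>A left and a right inverse agree: the triple composite of \<open>chi\<close>,
  \<open>steen\<close> and \<open>chr\<close> is summed in two orders.\<close>

lemma chr_eq_chi: "chr m G = chi m G"
proof -
  have "chi m G = (\<Sum>k\<le>m. chi (m - k) (if k = 0 then G else 0))"
    by (subst sum.mono_neutral_right[of _ "{0}"]) auto
  also have "\<dots> = (\<Sum>k\<le>m. \<Sum>c\<le>k. chi (m - (c + (k - c))) (steen (k - c) (chr c G)))"
    unfolding sum_chr[symmetric] chi_sum by (intro sum.cong) auto
  also have "\<dots> = (\<Sum>(c, b)\<in>{(c, b). c + b \<le> m}. chi (m - (c + b)) (steen b (chr c G)))"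
    by (rule sum.triangle_reindex_eq[symmetric])
  also have "{(c, b). c + b \<le> m} = Sigma {..m} (\<lambda>c. {..m - c})" by auto
  also have "(\<Sum>(c, b)\<in>Sigma {..m} (\<lambda>c. {..m - c}). chi (m - (c + b)) (steen b (chr c G)))
    = (\<Sum>c\<le>m. \<Sum>b\<le>m - c. chi (m - c - b) (steen b (chr c G)))"
    by (subst sum.Sigma) auto
  also have "\<dots> = (\<Sum>c\<le>m. if c = m then chr c G else 0)"
    unfolding sum_chi by (intro sum.cong) auto
  finally show ?thesis by simp
qed

lemma sum_triangle_swap:
  "(\<Sum>c\<le>m. \<Sum>a\<le>m - c. F c a) = (\<Sum>a\<le>m. \<Sum>c\<le>m - a. F c a)" for m :: nat
proof -
  have "(\<Sum>c\<le>m. \<Sum>a\<le>m - c. F c a) = (\<Sum>c\<le>m. \<Sum>a\<in>{a\<in>{..m}. c + a \<le> m}. F c a)"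
    by (intro sum.cong) auto
  also have "\<dots> = (\<Sum>a\<le>m. \<Sum>c\<in>{c\<in>{..m}. c + a \<le> m}. F c a)"
    by (rule sum.swap_restrict) auto
  also have "\<dots> = (\<Sum>a\<le>m. \<Sum>c\<le>m - a. F c a)"
    by (intro sum.cong) auto
  finally show ?thesis .
qed

text \<open>The \<open>\<chi>\<close>-trick: modulo the hit elements one may move an operation from one factor to its
  conjugate on the other one.\<close>

lemma sum_steen_mult_chi: "(\<Sum>c\<le>m. steen (m - c) (h * chi c G)) = steen m h * G"
proof -
  have "(\<Sum>c\<le>m. steen (m - c) (h * chi c G)) = (\<Sum>c\<le>m. \<Sum>a\<le>m - c. steen a h * steen (m - c - a) (chr c G))"
    by (simp add: steen_mult chr_eq_chi)
  also have "\<dots> = (\<Sum>a\<le>m. \<Sum>c\<le>m - a. steen a h * steen (m - a - c) (chr c G))"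
    by (subst sum_triangle_swap) (simp only: diff_commute[of m])
  also have "\<dots> = (\<Sum>a\<le>m. if a = m then steen m h * G else 0)"
    unfolding sum_distrib_left[symmetric] sum_chr by (intro sum.cong) auto
  finally show ?thesis by simp
qed

text \<open>By instability the right side \<open>steen m h * G\<close> of
  \<open>sum_steen_mult_chi\<close> vanishes, and all its summands with \<open>c < m\<close> are
  hit.\<close>

lemma mult_chi_in_Pplus:
  assumes "homog N h" "N < m"
  shows "h * chi m G \<in> Pplus"
proof -
  have "{..m} = insert m {..<m}" by auto
  then have "h * chi m G + (\<Sum>c<m. steen (m - c) (h * chi c G)) = 0"
    using sum_steen_mult_chi[of m h G] by (simp add: steen_unstable[OF assms])
  then have "h * chi m G = - (\<Sum>c<m. steen (m - c) (h * chi c G))" by (rule eq_neg_iff_add_eq_0[THEN iffD2])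
  also have "\<dots> \<in> Pplus" by (intro Pplus_uminus Pplus_sum Pplus_steen) simp
  finally show ?thesis .
qed

lemma homog_chi:
  fixes G :: "('k::{field,finite}, 'n::finite) sympoly"
  assumes "homog D G"
  shows "homog (D + (CARD('k) - 1) * m) (chi m G)"
  using assms
proof (induction m arbitrary: D G rule: less_induct)
  case (less m)
  show ?case
  proof (cases "m = 0")
    case False
    have "homog (D + (CARD('k) - 1) * m) (chi (m - i) (steen i G))" if i: "i \<in> {1..m}" for i
    proof -
      have "homog (D + (CARD('k) - 1) * i + (CARD('k) - 1) * (m - i)) (chi (m - i) (steen i G))"
        by (rule less.IH[OF _ homog_steen[OF less.prems]]) (use i in auto)
      moreover have "(CARD('k) - 1) * i + (CARD('k) - 1) * (m - i) = (CARD('k) - 1) * m"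
        using i by (simp flip: add_mult_distrib2)
      ultimately show ?thesis by (simp only: add.assoc)
    qed
    then show ?thesis unfolding chi.simps[of m G] using False by (auto intro!: homog_uminus homog_sum)
  qed (use less.prems in \<open>simp add: chi.simps\<close>)
qed

section \<open>Evaluation at rational points\<close>

definition ev :: "('k::comm_ring_1, 'n::finite) vec \<Rightarrow> ('k, 'n) sympoly \<Rightarrow> 'k" where
  "ev y = peval (\<lambda>c. c) (($) y)"

lemma ring_hm_ev: "ring_hm (ev y)"
  unfolding ev_def by (rule ring_hm_peval[OF ring_hm_id])

lemmas ev_simps = ring_hmD[OF ring_hm_ev]

lemma ev_pconst [simp]: "ev y (pconst c) = c"
  unfolding ev_def by (rule peval_pconst[OF ring_hm_id])

lemma ev_Xv [simp]: "ev y (Xv i) = y $ i"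
  unfolding ev_def by (rule peval_Xv[OF ring_hm_id])

lemma ev_linform: "ev y (linform v) = (\<Sum>i\<in>UNIV. v $ i * y $ i)"
  by (simp add: linform_def ev_simps)

lemma ev_gl_act: "ev y (gl_act f g) = ev (g *v y) f"
proof (rule ring_hm_eqI[OF ring_hm_comp[OF ring_hm_ev ring_hm_gl_act] ring_hm_ev])
  show "ev y (gl_act (Xv i) g) = ev (g *v y) (Xv i)" for i
    by (simp add: gl_act_Xv ev_linform matrix_vector_mult_def)
qed simp

text \<open>Rational points satisfy \<open>y^q = y\<close>, so there the total operation multiplies
  a form of degree \<open>N\<close> by \<open>(1 + t)^N\<close>.\<close>

lemma ev_steen:
  fixes f :: "('k::{field,finite}, 'n::finite) sympoly"
  assumes "homog N f"
  shows "ev y (steen j f) = of_nat (N choose j) * ev y f"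
proof -
  let ?X = "[:1, 1:] :: 'k poly"
  have bin: "coeff (?X ^ N) j = of_nat (N choose j)"
  proof (cases "j \<le> N")
    case False
    then have "degree (?X ^ N) < j" using degree_power_le[of ?X N] by simp
    then show ?thesis using False by (simp add: coeff_eq_0 binomial_eq_0)
  qed (simp add: coeff_linear_poly_power)
  have "map_poly (ev y) (tot f) = peval (\<lambda>c. [:c:]) (\<lambda>i. smult (y $ i) ?X) f"
  proof (rule ring_hm_eq_peval)
    show "ring_hm (\<lambda>f. map_poly (ev y) (tot f))"
      by (rule ring_hm_comp[OF ring_hm_map_poly[OF ring_hm_ev] ring_hm_tot])
    show "map_poly (ev y) (tot (Xv i)) = smult (y $ i) ?X" for i
      by (simp add: map_poly_pCons ev_simps field_power_card)
  qed (simp add: map_poly_pCons ev_simps)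
  also have "\<dots> = (\<Sum>m\<in>keys f. [:lookup f m:] * (smult (\<Prod>i\<in>UNIV. y $ i ^ lookup m i) (?X ^ N)))"
    unfolding peval_def
  proof (rule sum.cong)
    fix m assume "m \<in> keys f"
    then have "mdeg m = N" using assms by (simp add: homog_def)
    moreover have "(\<Prod>i\<in>A. smult (y $ i) ?X ^ lookup m i) = smult (\<Prod>i\<in>A. y $ i ^ lookup m i) (?X ^ (\<Sum>i\<in>A. lookup m i))" for A
      by (induction A rule: infinite_finite_induct) (simp_all add: smult_power power_add ac_simps del: smult_pCons)
    ultimately show "[:lookup f m:] * (\<Prod>i\<in>UNIV. smult (y $ i) ?X ^ lookup m i)
      = [:lookup f m:] * (smult (\<Prod>i\<in>UNIV. y $ i ^ lookup m i) (?X ^ N))" by (simp add: mdeg_def)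
  qed simp
  finally have "coeff (map_poly (ev y) (tot f)) j = (\<Sum>m\<in>keys f. lookup f m * ((\<Prod>i\<in>UNIV. y $ i ^ lookup m i) * of_nat (N choose j)))"
    by (simp add: coeff_sum bin ac_simps)
  also have "\<dots> = of_nat (N choose j) * ev y f"
    by (simp add: ev_def peval_def sum_distrib_left ac_simps)
  finally show ?thesis by (simp add: coeff_map_poly ev_simps coeff_tot)
qed

text \<open>Vandermonde convolution with a negative upper argument.\<close>

lemma binomial_identity:
  assumes "q \<ge> (1::nat)"
  shows "(\<Sum>i\<le>m. (- 1) ^ (m - i) * int ((D + q * m - i) choose (m - i)) * int (D choose i))
    = (- 1) ^ m * int ((q * m) choose m)"
proof -
  \<comment> \<open>Upper negation turns the binomial coefficient with upper number
    \<open>D + q * m - i\<close> into that of \<open>?a\<close>, independent of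
    \<open>i\<close>.\<close>
  let ?a = "- (real (D + (q - 1) * m) + 1)"
  have qm: "(q - 1) * m + m = q * m" using assms by (cases q) auto
  have neg: "(- (real e + 1)) gchoose j = (- 1) ^ j * real ((e + j) choose j)" for e j
  proof -
    have "(- (real e + 1)) gchoose j = (- 1) ^ j * ((real e + 1 + real j - 1) gchoose j)" by (rule gbinomial_minus)
    also have "real e + 1 + real j - 1 = real (e + j)" by simp
    also have "real (e + j) gchoose j = real ((e + j) choose j)" by (rule binomial_gbinomial[symmetric])
    finally show ?thesis .
  qed
  have "(\<Sum>i\<le>m. (- 1) ^ (m - i) * real ((D + q * m - i) choose (m - i)) * real (D choose i))
    = (\<Sum>i\<in>{0..m}. (real D gchoose i) * (?a gchoose (m - i)))"
  proof (rule sum.cong)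
    fix i assume "i \<in> {0..m}"
    then have "D + (q - 1) * m + (m - i) = D + q * m - i" using qm by simp
    then show "(- 1) ^ (m - i) * real ((D + q * m - i) choose (m - i)) * real (D choose i)
      = (real D gchoose i) * (?a gchoose (m - i))" unfolding neg by (simp add: binomial_gbinomial)
  qed auto
  also have "\<dots> = (real D + ?a) gchoose m" by (rule gbinomial_Vandermonde)
  also have "real D + ?a = - (real ((q - 1) * m) + 1)" by simp
  also have "\<dots> gchoose m = (- 1) ^ m * real ((q * m) choose m)" unfolding neg qm ..
  finally have "real_of_int (\<Sum>i\<le>m. (- 1) ^ (m - i) * int ((D + q * m - i) choose (m - i)) * int (D choose i))
    = real_of_int ((- 1) ^ m * int ((q * m) choose m))" by simp
  then show ?thesis by (simp only: of_int_eq_iff)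
qed

text \<open>The right side satisfies the recursion of \<open>chi\<close> by
  \<open>binomial_identity\<close>, whose value is zero in the field for
  \<open>m > 0\<close>.\<close>

lemma (in fq) ev_chi:
  fixes G :: "('k, 'n::finite) sympoly"
  assumes "homog D G"
  shows "ev y (chi m G) = (- 1) ^ m * of_nat ((D + CARD('k) * m) choose m) * ev y G"
  using assms
proof (induction m arbitrary: D G rule: less_induct)
  case (less m)
  let ?q = "CARD('k)"
  have q1: "?q \<ge> 1" by simp
  show ?case
  proof (cases "m = 0")
    case False
    let ?t = "\<lambda>i. (- 1) ^ (m - i) * of_nat ((D + ?q * m - i) choose (m - i)) * of_nat (D choose i) :: 'k"
    have "of_int (\<Sum>i\<le>m. (- 1) ^ (m - i) * int ((D + ?q * m - i) choose (m - i)) * int (D choose i)) = (0 :: 'k)"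
      unfolding binomial_identity[OF q1] using binomial_q_mult_zero[of m] False by simp
    then have "(\<Sum>i\<le>m. ?t i) = 0" by simp
    moreover have "{..m} = insert 0 {1..m}" by auto
    ultimately have t0: "?t 0 + (\<Sum>i\<in>{1..m}. ?t i) = 0" by simp
    have "ev y (chi (m - i) (steen i G)) = ?t i * ev y G" if i: "i \<in> {1..m}" for i
    proof -
      have "ev y (chi (m - i) (steen i G))
        = (- 1) ^ (m - i) * of_nat ((D + (?q - 1) * i + ?q * (m - i)) choose (m - i)) * ev y (steen i G)"
        by (rule less.IH[OF _ homog_steen[OF less.prems]]) (use i in auto)
      moreover have "D + (?q - 1) * i + ?q * (m - i) = D + ?q * m - i"
      proof -
        obtain w where "m = i + w" using i le_Suc_ex by auto
        moreover obtain q' where "?q = Suc q'" using q1 by (cases ?q) auto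
        ultimately show ?thesis by (simp add: algebra_simps)
      qed
      ultimately show ?thesis by (simp add: ev_steen[OF less.prems])
    qed
    then have "ev y (chi m G) = - (\<Sum>i\<in>{1..m}. ?t i) * ev y G"
      unfolding chi.simps[of m G] using False by (simp add: ev_simps sum_distrib_right)
    also have "- (\<Sum>i\<in>{1..m}. ?t i) = ?t 0" by (rule eq_neg_iff_add_eq_0[THEN iffD2, OF t0, symmetric])
    finally show ?thesis by simp
  qed (simp add: chi.simps)
qed

section \<open>A form supported on one rational line\<close>

definition Gp :: "nat \<Rightarrow> 'n \<Rightarrow> ('k::{field,finite}, 'n::finite) sympoly" where
  "Gp k i0 = Xv i0 ^ k * (\<Prod>i\<in>UNIV - {i0}. Xv i0 ^ (CARD('k) - 1) - Xv i ^ (CARD('k) - 1))"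

lemma homog_Gp: "homog (k + (CARD('n) - 1) * (CARD('k) - 1)) (Gp k i0 :: ('k::{field,finite}, 'n::finite) sympoly)"
proof -
  have X: "homog e ((Xv i :: ('k, 'n) sympoly) ^ e)" for e i using homog_power[OF homog_Xv, of e i] by simp
  have "homog (k + (\<Sum>i\<in>UNIV - {i0}. CARD('k) - 1)) (Gp k i0 :: ('k, 'n) sympoly)"
    unfolding Gp_def by (intro homog_mult homog_prod homog_diff X)
  then show ?thesis by simp
qed

lemma field_power_card_minus_1: "(x :: 'k::{field,finite}) ^ (CARD('k) - 1) = (if x = 0 then 0 else 1)"
proof -
  have "x * x ^ (CARD('k) - 1) = x" using field_power_card[of x] card_field_ge_2[where ?'k = 'k] by (cases "CARD('k)") auto
  then show ?thesis using card_field_ge_2[where ?'k = 'k] by (cases "x = 0") (auto simp: power_0_left)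
qed

text \<open>A power with exponent \<open>CARD('k) - 1\<close> only records whether a coordinate is
  zero.\<close>

lemma ev_Gp:
  assumes "k \<ge> 1"
  shows "ev y (Gp k i0) \<noteq> 0 \<longleftrightarrow> y $ i0 \<noteq> 0 \<and> (\<forall>i. i \<noteq> i0 \<longrightarrow> y $ i = 0)"
proof (cases "y $ i0 = 0")
  case True
  then show ?thesis using assms by (simp add: Gp_def ev_simps power_0_left)
next
  case False
  then show ?thesis by (auto simp: Gp_def ev_simps field_power_card_minus_1 simp del: One_nat_def)
qed

text \<open>The index of the operation is the solution \<open>C\<close> of
  \<open>k + (n - 1) * (q - 1) + (q - 1) * C = k * q ^ (n - 1)\<close>, the right side being the
  degree of \<open>VH H ^ k\<close>.\<close>

definition Hf :: "nat \<Rightarrow> 'n \<Rightarrow> ('k::{field,finite}, 'n::finite) sympoly" where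
  "Hf k i0 = chi (k * (\<Sum>t<CARD('n) - 1. CARD('k) ^ t) - (CARD('n) - 1)) (Gp k i0)"

lemma le_geometric:
  assumes "q \<ge> (1::nat)"
  shows "m \<le> (\<Sum>t<m. q ^ t)"
proof -
  have "(\<Sum>t<m. 1) \<le> (\<Sum>t<m. q ^ t)" using assms by (intro sum_mono) simp
  then show ?thesis by simp
qed

lemma homog_Hf:
  assumes "k \<ge> 1"
  shows "homog (k * CARD('k) ^ (CARD('n) - 1)) (Hf k i0 :: ('k::{field,finite}, 'n::finite) sympoly)"
proof -
  let ?q = "CARD('k)" and ?m = "CARD('n) - 1" and ?S = "\<Sum>t<CARD('n) - 1. CARD('k) ^ t"
  have q1: "?q \<ge> 1" by simp
  have "?m \<le> ?S" using q1 by (rule le_geometric)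
  then have le: "?m \<le> k * ?S" using assms mult_le_mono1[of 1 k ?S] by linarith
  have arith: "k + m * Q + Q * (X - m) = k + Q * X" if "m \<le> X" for m Q X :: nat
    using that by (auto simp: le_iff_add algebra_simps)
  have "k + ?m * (?q - 1) + (?q - 1) * (k * ?S - ?m) = k + (?q - 1) * (k * ?S)"
    by (rule arith[OF le])
  also have "\<dots> = k * ((?q - 1) * ?S + 1)" by (simp add: algebra_simps)
  also have "\<dots> = k * ?q ^ ?m" using geometric_nat[OF q1, of ?m] by simp
  finally show ?thesis using homog_chi[OF homog_Gp[of k i0, where ?'k = 'k], of "k * ?S - ?m"] by (simp add: Hf_def)
qed

text \<open>The upper number in \<open>ev_chi\<close> is \<open>q ^ s * r + C\<close> with
  \<open>C < q ^ s\<close> for \<open>s = a + n - 1\<close>, so by Lucas the binomial coefficient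
  over \<open>C\<close> is \<open>1\<close> and the values agree with those of \<open>Gp\<close> up
  to sign.\<close>

lemma (in fq) ev_Hf:
  assumes "k = CARD('k) ^ a * r" "1 \<le> r" "r \<le> CARD('k) - 1"
  shows "ev y (Hf k i0 :: ('k, 'n::finite) sympoly) \<noteq> 0 \<longleftrightarrow> y $ i0 \<noteq> 0 \<and> (\<forall>i. i \<noteq> i0 \<longrightarrow> y $ i = 0)"
proof -
  let ?q = "CARD('k)" and ?m = "CARD('n) - 1" and ?S = "\<Sum>t<CARD('n) - 1. CARD('k) ^ t"
  let ?C = "k * ?S - ?m" and ?s = "a + (CARD('n) - 1)"
  have q2: "?q \<ge> 2" by (rule card_field_ge_2)
  then have q1: "?q \<ge> 1" by simp
  have k1: "k \<ge> 1" using assms(1,2) by simp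
  have geo: "(?q - 1) * ?S + 1 = ?q ^ ?m" using q1 by (rule geometric_nat)
  have "?m \<le> ?S" using q1 by (rule le_geometric)
  then have le: "?m \<le> k * ?S" using k1 mult_le_mono1[of 1 k ?S] by linarith
  have "k * ?S \<le> ?q ^ a * (?q - 1) * ?S" unfolding assms(1) using assms(3) by (intro mult_le_mono1 mult_le_mono2)
  also have "\<dots> < ?q ^ a * ?q ^ ?m" unfolding mult.assoc geo[symmetric] using q1 by simp
  finally have "k * ?S < ?q ^ ?s" by (simp only: power_add)
  then have C: "?C < ?q ^ ?s" by linarith
  have "k + ?m * (?q - 1) + ?q * ?C = ?q ^ ?s * r + ?C"
  proof -
    obtain q' where q': "?q = Suc q'" using q1 by (cases ?q) auto
    obtain w where w: "k * ?S = ?m + w" using le le_Suc_ex by blast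
    have "k + ?m * q' + q' * w = k + q' * (k * ?S)" unfolding w by (simp only: add_mult_distrib2 ac_simps)
    also have "\<dots> = k * ((?q - 1) * ?S + 1)" unfolding q' by (simp add: algebra_simps)
    also have "\<dots> = ?q ^ ?s * r" unfolding geo assms(1) by (simp only: power_add ac_simps)
    finally show ?thesis using w unfolding q' by (simp add: algebra_simps)
  qed
  then have "(of_nat ((k + ?m * (?q - 1) + ?q * ?C) choose ?C) :: 'k) = 1"
    using lucas[OF C C, of r 0] by simp
  then have "ev y (Hf k i0) = (- 1) ^ ?C * ev y (Gp k i0 :: ('k, 'n) sympoly)"
    unfolding Hf_def ev_chi[OF homog_Gp] by simp
  then show ?thesis using ev_Gp[OF k1, of y i0] by simp
qed

lemma Hf_hit:
  fixes h :: "('k::{field,finite}, 'n::finite) sympoly"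
  assumes "homog N h" "N < k * (\<Sum>t<CARD('n) - 1. CARD('k) ^ t) - (CARD('n) - 1)"
  shows "h * Hf k i0 \<in> Pplus"
  unfolding Hf_def by (rule mult_chi_in_Pplus[OF assms])

section \<open>Indecomposability of the top degree\<close>

lemma lookup_sum_mapping: "lookup (sum f A) m = (\<Sum>x\<in>A. lookup (f x) m)"
  by (induction A rule: infinite_finite_induct) (simp_all add: lookup_add)

context fq
begin

text \<open>If the operation raises the exponent of some variable \<open>i\<close> to
  \<open>k * q ^ pos i - 1\<close>, the binomial coefficient of that variable vanishes by
  \<open>binomial_top_zero\<close> with \<open>s = a + pos i\<close>.\<close>

lemma lookup_TM_steen:
  fixes f :: "('k, 'n::{finite,linorder}) sympoly"
  assumes "k = CARD('k) ^ a * r" "1 \<le> r" "r \<le> CARD('k) - 1" "j > 0"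
  shows "lookup (steen j f) (TM CARD('k) k) = 0"
proof -
  let ?q = "CARD('k)"
  have "lookup (\<Prod>i\<in>UNIV. pconst (of_nat (lookup m i choose J i)) * (Xv i :: ('k, 'n) sympoly) ^ (lookup m i + (?q - 1) * J i)) (TM ?q k) = 0"
    if J: "(\<Sum>i\<in>UNIV. J i) = j" for m J
  proof -
    let ?e = "\<lambda>i. lookup m i + (?q - 1) * J i"
    have prod: "(\<Prod>i\<in>UNIV. pconst (of_nat (lookup m i choose J i)) * (Xv i :: ('k, 'n) sympoly) ^ ?e i)
      = pconst (\<Prod>i\<in>UNIV. of_nat (lookup m i choose J i)) * single (\<Sum>i\<in>UNIV. single i (?e i)) 1"
      by (simp only: prod.distrib pconst_prod Xv_power prod_single_1)
    show ?thesis
    proof (cases "(\<Sum>i\<in>UNIV. single i (?e i)) = TM ?q k")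
      case True
      have e: "?e i = k * ?q ^ pos i - 1" for i
        using arg_cong[OF True, of "\<lambda>m. lookup m i"] unfolding TM_def lookup_sum_single .
      obtain i where i: "J i > 0"
      proof (rule ccontr)
        assume "\<not> thesis"
        then have "J i = 0" for i using that by auto
        then show False using J assms(4) by simp
      qed
      have k: "k * ?q ^ pos i = ?q ^ (a + pos i) * r" by (simp add: assms(1) power_add ac_simps)
      have le: "(?q - 1) * J i \<le> ?q ^ (a + pos i) * r - 1" using e[of i] k by linarith
      have m: "lookup m i = ?q ^ (a + pos i) * r - 1 - (?q - 1) * J i" using e[of i] k by linarith
      have "of_nat (lookup m i choose J i) = (0 :: 'k)"
        unfolding m by (rule binomial_top_zero[OF assms(2,3) i le])
      then have "(\<Prod>i\<in>UNIV. of_nat (lookup m i choose J i)) = (0 :: 'k)" by (intro prod_zero) auto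
      then show ?thesis unfolding prod by simp
    qed (simp only: prod lookup_pconst_times lookup_single when_def if_False mult_zero_right)
  qed
  then show ?thesis unfolding steen_def lookup_sum_mapping lookup_pconst_times by (intro sum.neutral) simp
qed

lemma lookup_TM_Pplus:
  fixes f :: "('k, 'n::{finite,linorder}) sympoly"
  assumes "k = CARD('k) ^ a * r" "1 \<le> r" "r \<le> CARD('k) - 1" "f \<in> Pplus"
  shows "lookup f (TM CARD('k) k) = 0"
proof -
  obtain J F where J: "finite J" "\<forall>j\<in>J. 0 < j" "f = (\<Sum>j\<in>J. steen j (F j))" using assms(4) unfolding Pplus_def by blast
  show ?thesis unfolding J(3) lookup_sum_mapping using J(2)
    by (intro sum.neutral ballI lookup_TM_steen[OF assms(1-3)]) blast
qed

text \<open>For \<open>L = k\<close> no padding by \<open>Lam\<close> occurs, so \<open>psi\<close>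
  kills hit elements as well as the ideal, and it is injective modulo the ideal.\<close>

theorem top_degree_indecomposable:
  fixes f :: "('k, 'n::{finite,linorder}) sympoly"
  assumes "k = CARD('k) ^ a * r" "1 \<le> r" "r \<le> CARD('k) - 1"
    and d: "d + CARD('n) = k * card (Mons :: ('k, 'n) vec set)"
    and f: "f \<in> Hom d" "f \<in> setplus Pplus (Iid k)"
  shows "f \<in> Iid k"
proof -
  have k1: "k \<ge> 1" using assms(1,2) by simp
  obtain P h where Ph: "P \<in> Pplus" "h \<in> Iid k" "f = P + h" using f(2) unfolding setplus_def by blast
  have "psi k k P x = 0" for x
    using lookup_TM_Pplus[OF assms(1-3) Pplus_gl_act[OF Ph(1)]] by (simp add: psi_def phi_def)
  then have "psi k k f = (\<lambda>x. 0)"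
    unfolding Ph(3) psi_add psi_Iid[OF assms(1-3) order.refl Ph(2)] fun_eq_iff by simp
  then show ?thesis by (rule psi_top_degree(2)[OF assms(1-3) order.refl k1 d f(1)])
qed

end

section \<open>Hyperplane products are hit\<close>

text \<open>Freezes the exponents of the variables in \<open>S\<close> while the remaining
  coordinates are still being changed.\<close>

definition slice :: "'n set \<Rightarrow> ('n \<Rightarrow>\<^sub>0 nat) \<Rightarrow> ('k::comm_ring_1, 'n::finite) sympoly \<Rightarrow> ('k, 'n) sympoly" where
  "slice S m f = (\<Sum>l\<in>{l\<in>keys f. \<forall>j\<in>S. lookup l j = lookup m j}. single l (lookup f l))"

lemma lookup_slice: "lookup (slice S m f) l = (if \<forall>j\<in>S. lookup l j = lookup m j then lookup f l else 0)"
proof -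
  have "lookup (slice S m f) l = (\<Sum>l'\<in>{l\<in>keys f. \<forall>j\<in>S. lookup l j = lookup m j}. if l' = l then lookup f l else 0)"
    unfolding slice_def lookup_sum_mapping by (intro sum.cong) (auto simp: lookup_single when_def)
  then show ?thesis by (auto simp: in_keys_iff)
qed

definition indeg :: "'n \<Rightarrow> nat \<Rightarrow> ('k::comm_ring_1, 'n::finite) sympoly \<Rightarrow> bool" where
  "indeg j N f \<longleftrightarrow> (\<forall>m. lookup f m \<noteq> 0 \<longrightarrow> lookup m j = N)"

lemma indeg_mult:
  assumes "indeg j M f" "indeg j N g"
  shows "indeg j (M + N) (f * g)"
  unfolding indeg_def
proof (intro allI impI)
  fix m assume "lookup (f * g) m \<noteq> 0"
  then have "m \<in> keys (f * g)" by (simp add: in_keys_iff)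
  then obtain a b where "m = a + b" "a \<in> keys f" "b \<in> keys g" using keys_mult by blast
  then show "lookup m j = M + N" using assms by (auto simp: indeg_def in_keys_iff lookup_add)
qed

lemma indeg_1: "indeg j 0 1"
  by (auto simp: indeg_def lookup_one when_def)

lemma indeg_pconst: "indeg j 0 (pconst c)"
  by (auto simp: indeg_def pconst_def lookup_single when_def)

lemma indeg_power: "indeg j N f \<Longrightarrow> indeg j (e * N) (f ^ e)"
  by (induction e) (auto intro: indeg_mult simp: indeg_1)

lemma indeg_prod: "(\<And>x. x \<in> A \<Longrightarrow> indeg j (N x) (f x)) \<Longrightarrow> indeg j (\<Sum>x\<in>A. N x) (prod f A)"
  by (induction A rule: infinite_finite_induct) (auto intro: indeg_mult simp: indeg_1)

lemma indeg_linform: "v $ j = 0 \<Longrightarrow> indeg j 0 (linform v)"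
  unfolding indeg_def using keys_linform[of _ v] by (fastforce simp: in_keys_iff lookup_single when_def)

lemma indeg_Xv: "indeg j 1 (Xv j)"
  by (auto simp: indeg_def Xv_def lookup_single when_def split: if_splits)

lemma gl_act_sum_monomials: "gl_act f g = (\<Sum>l\<in>keys f. gl_act (single l (lookup f l)) g)"
  unfolding gl_act_simps(8)[symmetric] sum_singles ..

text \<open>A block matrix fixing the variables in \<open>S\<close> and not mixing them into the others
  preserves the \<open>S\<close>-part of every monomial.\<close>

lemma slice_gl_act:
  fixes f :: "('k::field, 'n::finite) sympoly"
  assumes h: "\<And>a. a \<in> S \<Longrightarrow> h $ a = axis a 1" "\<And>a b. a \<notin> S \<Longrightarrow> b \<in> S \<Longrightarrow> h $ a $ b = 0"
  shows "lookup (gl_act (slice S m f) h) l \<noteq> 0 \<Longrightarrow> \<forall>j\<in>S. lookup l j = lookup m j"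
    and "\<forall>j\<in>S. lookup l j = lookup m j \<Longrightarrow> lookup (gl_act (slice S m f) h) l = lookup (gl_act f h) l"
proof -
  have mono: "indeg j (lookup l j) (gl_act (single l c) h)" if j: "j \<in> S" for j l and c :: 'k
  proof -
    have "indeg j (\<Sum>i\<in>UNIV. lookup l i * (if i = j then 1 else 0)) (\<Prod>i\<in>UNIV. linform (h $ i) ^ lookup l i)"
    proof (rule indeg_prod, rule indeg_power)
      fix i
      show "indeg j (if i = j then 1 else 0) (linform (h $ i))"
      proof (cases "i = j")
        case True
        then have "linform (h $ i) = Xv j" using h(1)[OF j] by simp
        then show ?thesis using indeg_Xv[of j] True by simp
      next
        case False
        then have "h $ i $ j = 0" using h j by (cases "i \<in> S") (auto simp: axis_def)
        then show ?thesis using False by (simp add: indeg_linform)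
      qed
    qed
    moreover have "(\<Sum>i\<in>UNIV. lookup l i * (if i = j then 1 else 0)) = lookup l j"
      by (simp add: if_distrib[of "\<lambda>x. _ * x"] cong: if_cong)
    ultimately have "indeg j (lookup l j) (\<Prod>i\<in>UNIV. linform (h $ i) ^ lookup l i)" by simp
    from indeg_mult[OF indeg_pconst this] show ?thesis
      unfolding single_eq_prod[of l c] gl_act_simps gl_act_Xv gl_act_pconst by simp
  qed
  have zero: "lookup (gl_act (single l' c) h) l = 0" if "j \<in> S" "lookup l' j \<noteq> lookup l j" for l' c j
    using mono[OF that(1), of l' c] that(2) by (auto simp: indeg_def)
  have keys: "keys (slice S m f) = {l\<in>keys f. \<forall>j\<in>S. lookup l j = lookup m j}"
    by (auto simp: in_keys_iff lookup_slice split: if_splits)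
  have act: "lookup (gl_act (slice S m f) h) l
    = (\<Sum>l'\<in>{l\<in>keys f. \<forall>j\<in>S. lookup l j = lookup m j}. lookup (gl_act (single l' (lookup f l')) h) l)"
    unfolding gl_act_sum_monomials[of "slice S m f"] keys lookup_sum_mapping
    by (intro sum.cong) (auto simp: lookup_slice)
  show "\<forall>j\<in>S. lookup l j = lookup m j" if "lookup (gl_act (slice S m f) h) l \<noteq> 0"
  proof (rule ccontr)
    assume "\<not> (\<forall>j\<in>S. lookup l j = lookup m j)"
    then obtain j where j: "j \<in> S" "lookup l j \<noteq> lookup m j" by blast
    have "lookup (gl_act (slice S m f) h) l = 0"
      unfolding act by (intro sum.neutral) (use zero j in auto)
    then show False using that by simp
  qed
  show "lookup (gl_act (slice S m f) h) l = lookup (gl_act f h) l" if l: "\<forall>j\<in>S. lookup l j = lookup m j"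
    unfolding act gl_act_sum_monomials[of f] lookup_sum_mapping
    by (rule sum.mono_neutral_left) (use zero l in fastforce)+
qed

lemma homog_dvd_le:
  assumes "homog M P" "homog N f" "f \<noteq> 0" "P dvd f"
  shows "M \<le> N"
proof -
  obtain Q where Q: "f = P * Q" using assms(4) by (elim dvdE)
  have "f = hc N (P * Q)" using assms(2) by (simp add: hc_homog flip: Q)
  then show ?thesis using hc_mult_homog[OF assms(1), of N Q] assms(3) by (auto split: if_splits)
qed

text \<open>At a coordinate point only the pure power survives; this converts pure powers of
  translates into rational points.\<close>

lemma ev_axis:
  fixes f :: "('a::comm_ring_1, 'b::finite) sympoly"
  assumes "homog N f"
  shows "ev (axis i 1) f = lookup f (single i N)"
proof -
  have "(\<Prod>j\<in>UNIV. (axis i 1 :: ('a, 'b) vec) $ j ^ lookup m j) = (if m = single i N then 1 else 0)"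
    if m: "mdeg m = N" for m
  proof (cases "\<exists>j. j \<noteq> i \<and> lookup m j \<noteq> 0")
    case True
    then obtain j where j: "j \<noteq> i" "lookup m j \<noteq> 0" by blast
    then have "(\<Prod>j\<in>UNIV. (axis i 1 :: ('a, 'b) vec) $ j ^ lookup m j) = 0"
      by (intro prod_zero) (auto simp: axis_def power_0_left intro!: exI[of _ j])
    moreover have "m \<noteq> single i N" using j by (auto simp: lookup_single when_def)
    ultimately show ?thesis by simp
  next
    case False
    then have z: "lookup m j = 0" if "j \<noteq> i" for j using that by blast
    have "mdeg m = (\<Sum>j\<in>UNIV. if j = i then lookup m i else 0)"
      unfolding mdeg_def using z by (intro sum.cong) auto
    then have "lookup m i = N" using m by simp
    then have "m = single i N" using z by (intro poly_mapping_eqI) (auto simp: lookup_single when_def)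
    moreover have "(\<Prod>j\<in>UNIV. (axis i 1 :: ('a, 'b) vec) $ j ^ lookup m j) = 1"
      by (rule prod.neutral) (use z in \<open>auto simp: axis_def\<close>)
    ultimately show ?thesis by simp
  qed
  then have "ev (axis i 1) f = (\<Sum>m\<in>keys f. if m = single i N then lookup f m else 0)"
    unfolding ev_def peval_def using assms by (intro sum.cong) (auto simp: homog_def)
  then show ?thesis by (auto simp: in_keys_iff)
qed

lemma card_pos_ge: "card {j :: 'n::{finite,linorder}. s \<le> pos j} = CARD('n) - s"
proof -
  have "bij_betw pos {j :: 'n. s \<le> pos j} {s..<CARD('n)}"
    by (rule bij_betw_byWitness[where f' = idx]) auto
  then show ?thesis using bij_betw_same_card by fastforce
qed

text \<open>The vectors counted are supported on positions from \<open>s\<close> on. Those with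
  leading position \<open>CARD('n) - 1\<close> already give the stated power, and the axis vector of
  position \<open>s\<close> is one more.\<close>

lemma many_block_lines:
  assumes s: "s + 1 < CARD('n)"
  shows "CARD('k) ^ (CARD('n) - 1 - s) < card {v \<in> (Mons :: ('k::{field,finite}, 'n::{finite,linorder}) vec set). \<forall>j. pos j < s \<longrightarrow> v $ j = 0}"
proof -
  let ?i0 = "idx (CARD('n) - 1) :: 'n" and ?L = "{v \<in> (Mons :: ('k, 'n) vec set). \<forall>j. pos j < s \<longrightarrow> v $ j = 0}"
  let ?A = "{j :: 'n. s \<le> pos j} - {?i0}" and ?i1 = "idx s :: 'n"
  let ?B = "{v :: ('k, 'n) vec. \<forall>j. j \<notin> ?A \<longrightarrow> v $ j = axis ?i0 1 $ j}"
  have p0: "pos ?i0 = CARD('n) - 1" by simp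
  have p1: "pos ?i1 = s" using s by simp
  have ne: "?i0 \<noteq> ?i1" 
  proof
    assume "?i0 = ?i1"
    then have "pos ?i0 = pos ?i1" by (rule arg_cong)
    then show False using p0 p1 s by linarith
  qed
  have "card ?A = CARD('n) - s - 1" using card_pos_ge[of s, where ?'n = 'n] p0 s by (subst card_Diff_singleton) auto
  then have cB: "card ?B = CARD('k) ^ (CARD('n) - 1 - s)" using card_vec_fixed[of ?A "axis ?i0 (1 :: 'k)"] by simp
  have min: "\<not> j < ?i0" for j using pos_less[of j ?i0] pos_less_card[of j] p0 by linarith
  have "?B \<subseteq> ?L"
  proof
    fix v assume v: "v \<in> ?B"
    have "v $ ?i0 = 1" using v by (simp add: axis_def)
    then have "v \<in> Mon ?i0" using min by (auto simp: Mon_def)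
    moreover have "v $ j = 0" if "pos j < s" for j
    proof -
      have "j \<noteq> ?i0" using that p0 s by auto
      then show ?thesis using v that by (simp add: axis_def)
    qed
    ultimately show "v \<in> ?L" by (auto simp: Mons_def)
  qed
  moreover have "axis ?i1 1 \<in> ?L" using p1 by (auto simp: Mons_def Mon_def axis_def)
  moreover have "axis ?i1 1 \<notin> ?B" using ne by (auto simp: axis_def intro!: exI[of _ ?i0])
  ultimately have "?B \<subset> ?L" by blast
  then have "card ?B < card ?L" by (intro psubset_card_mono) auto
  then show ?thesis unfolding cB .
qed

lemma ex_small_exponent:
  fixes F :: "('k::field, 'n::{finite,linorder}) sympoly"
  assumes "\<not> linform v ^ T dvd F" "invertible h" "v v* h = axis i 1"
  shows "\<exists>m. lookup (gl_act F h) m \<noteq> 0 \<and> lookup m i < T"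
proof -
  have "gl_act (linform v ^ T) h = Xv i ^ T" by (simp add: gl_act_simps gl_act_linform assms(3))
  then have "\<not> Xv i ^ T dvd gl_act F h" using gl_act_dvd_iff[OF assms(2), of "linform v ^ T" F] assms(1) by simp
  then show ?thesis unfolding Xv_power_dvd_iff by (auto simp: not_le)
qed

text \<open>If not, \<open>u\<close> becomes the variable of position \<open>0\<close> and further
  variables are chosen by increasing position, so that a monomial of a translate stays below every
  bound except the last. Then \<open>large\<close> makes it a pure power, and the rational point it
  yields contradicts \<open>supp\<close> and \<open>u $ i0 \<noteq> 0\<close>.\<close>

lemma linform_power_dvd_if_supported:
  fixes f :: "('k::{field,finite}, 'n::{finite,linorder}) sympoly"
  defines "i0 \<equiv> idx (CARD('n) - 1) :: 'n"
  assumes k: "k \<ge> 1" and hom: "homog (k * CARD('k) ^ (CARD('n) - 1)) f"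
    and large: "\<And>g m. invertible g \<Longrightarrow> lookup (gl_act f g) m \<noteq> 0 \<Longrightarrow> \<exists>j. k * CARD('k) ^ pos j \<le> lookup m j"
    and supp: "\<And>y. ev y f \<noteq> 0 \<Longrightarrow> y $ i0 \<noteq> 0 \<and> (\<forall>i. i \<noteq> i0 \<longrightarrow> y $ i = 0)"
    and u: "u $ i0 \<noteq> 0"
  shows "linform u ^ k dvd f"
proof (rule ccontr)
  let ?q = "CARD('k)" and ?n = "CARD('n)" and ?mx = "idx 0 :: 'n"
  define N where "N = k * ?q ^ (?n - 1)"
  assume nd: "\<not> linform u ^ k dvd f"
  have q1: "?q \<ge> 1" by simp
  have n1: "?n \<ge> 1" by (simp add: Suc_leI)
  have pmx: "pos ?mx = 0" using n1 by simp
  have pi0: "pos i0 = ?n - 1" unfolding i0_def using n1 by simp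
  let ?I = "\<lambda>s. \<exists>g m. invertible g \<and> u v* g = axis ?mx 1 \<and> lookup (gl_act f g) m \<noteq> 0
    \<and> (\<forall>j. pos j < s \<longrightarrow> lookup m j < k * ?q ^ pos j)"
  have base: "?I 1"
  proof -
    have "u \<noteq> 0" using u by auto
    then obtain g :: "(('k, 'n) vec, 'n) vec" where g: "invertible g" "u v* g = axis ?mx 1" by (rule ex_gl_to_axis')
    obtain m where m: "lookup (gl_act f g) m \<noteq> 0" "lookup m ?mx < k" using ex_small_exponent[OF nd g] by blast
    have "\<forall>j. pos j < 1 \<longrightarrow> lookup m j < k * ?q ^ pos j"
    proof (intro allI impI)
      fix j :: 'n assume "pos j < 1"
      then have "pos j = pos ?mx" using pmx by simp
      then have j: "j = ?mx" by (simp only: pos_inj)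
      show "lookup m j < k * ?q ^ pos j" unfolding j pmx using m(2) by simp
    qed
    then show ?thesis using g m(1) by blast
  qed
  have step: "?I (Suc s)" if s: "1 \<le> s" "s + 1 < ?n" and I: "?I s" for s
  proof -
    obtain g m where g: "invertible g" "u v* g = axis ?mx 1" "lookup (gl_act f g) m \<noteq> 0"
      "\<And>j. pos j < s \<Longrightarrow> lookup m j < k * ?q ^ pos j" using I by blast
    let ?S = "{j :: 'n. pos j < s}" and ?F = "gl_act f g"
    let ?F' = "slice ?S m ?F"
    let ?L = "{v \<in> (Mons :: ('k, 'n) vec set). \<forall>j. pos j < s \<longrightarrow> v $ j = 0}"
    have F': "?F' \<noteq> 0" "homog N ?F'"
    proof -
      have "lookup ?F' m \<noteq> 0" using g(3) by (simp add: lookup_slice)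
      then show "?F' \<noteq> 0" by auto
      show "homog N ?F'"
        using homogD[OF homog_gl_act[OF hom, of g]]
        by (intro homogI) (auto simp: lookup_slice N_def split: if_splits)
    qed
    \<comment> \<open>Otherwise the product of all these powers divides the slice, and by
      \<open>many_block_lines\<close> its degree exceeds \<open>N\<close>.\<close>
    have "\<exists>v\<in>?L. \<not> linform v ^ (k * ?q ^ s) dvd ?F'"
    proof (rule ccontr)
      assume "\<not> (\<exists>v\<in>?L. \<not> linform v ^ (k * ?q ^ s) dvd ?F')"
      then have all: "linform v ^ (k * ?q ^ s) dvd ?F'" if "v \<in> ?L" for v using that by blast
      have "(\<Prod>v\<in>?L. linform v) ^ (k * ?q ^ s) dvd ?F'"
      proof (rule prod_linform_power_dvd)
        show "w = v" if "v \<in> ?L" "w \<in> ?L" "w = c *s v" for v w c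
          using Mons_scale[OF _ _ that(3)] that(1,2) by blast
      qed (use all Mons_neq_0 in auto)
      moreover have "homog (k * ?q ^ s * card ?L) ((\<Prod>v\<in>?L. linform v) ^ (k * ?q ^ s) :: ('k, 'n) sympoly)"
        by (intro homog_power homog_prod_linform)
      ultimately have "k * ?q ^ s * card ?L \<le> N" using homog_dvd_le F' by blast
      moreover have "N = k * ?q ^ s * ?q ^ (?n - 1 - s)"
        using s unfolding N_def by (simp flip: power_add)
      moreover have "k * ?q ^ s > 0" using k by simp
      ultimately have "card ?L \<le> ?q ^ (?n - 1 - s)" by simp
      then show False using many_block_lines[OF s(2), where ?'k = 'k] by simp
    qed
    then obtain v where v: "v \<in> ?L" "\<not> linform v ^ (k * ?q ^ s) dvd ?F'" by blast
    have v0: "v \<noteq> 0" using v(1) Mons_neq_0 by blast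
    \<comment> \<open>A coordinate change within the block of undecided variables: the earlier ones
      stay fixed and do not occur in the images of the others, so their exponents in the slice
      persist.\<close>
    obtain h :: "(('k, 'n) vec, 'n) vec" where h: "invertible h" "v v* h = axis (idx s) 1"
      "\<And>a. a \<notin> - ?S \<Longrightarrow> h $ a = axis a 1" "\<And>a b. a \<in> - ?S \<Longrightarrow> b \<notin> - ?S \<Longrightarrow> h $ a $ b = 0"
      by (rule ex_gl_to_axis[of v "- ?S" "idx s"]) (use v0 v(1) s in auto)
    obtain m' where m': "lookup (gl_act ?F' h) m' \<noteq> 0" "lookup m' (idx s) < k * ?q ^ s"
      using ex_small_exponent[OF v(2) h(1,2)] by blast
    have hS: "h $ a = axis a 1" if "a \<in> ?S" for a using h(3) that by simp
    have hS': "h $ a $ b = 0" if "a \<notin> ?S" "b \<in> ?S" for a b using h(4) that by simp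
    have eq: "\<forall>j\<in>?S. lookup m' j = lookup m j" by (rule slice_gl_act(1)[OF hS hS' m'(1)])
    have "lookup (gl_act f (g ** h)) m' \<noteq> 0"
      using m'(1) slice_gl_act(2)[OF hS hS' eq, of ?F] by (simp add: gl_act_gl_act)
    moreover have "u v* (g ** h) = axis ?mx 1"
      using hS[of ?mx] pmx s(1) by (simp add: vector_matrix_mul_assoc[symmetric] g(2) axis_vmult)
    moreover have "lookup m' j < k * ?q ^ pos j" if j: "pos j < Suc s" for j
    proof (cases "pos j < s")
      case False
      then have "pos j = s" using j by simp
      then have "j = idx s" using idx_pos[of j] by simp
      then show ?thesis using m'(2) \<open>pos j = s\<close> by simp
    qed (use eq g(4) in simp)
    ultimately show ?thesis using invertible_mult[OF g(1) h(1)] by blast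
  qed
  show False
  \<comment> \<open>With a single variable the initial choice already bounds every exponent, against
    \<open>large\<close>.\<close>
  proof (cases "?n = 1")
    case True
    obtain g m where g: "invertible g" "lookup (gl_act f g) m \<noteq> 0"
      "\<And>j. pos j < 1 \<Longrightarrow> lookup m j < k * ?q ^ pos j" using base by blast
    obtain j where "k * ?q ^ pos j \<le> lookup m j" using large[OF g(1,2)] by blast
    moreover have "pos j < 1" using pos_less_card[of j] True by simp
    ultimately show False using g(3)[of j] by simp
  next
    case False
    then have n2: "1 \<le> ?n - 1" using n1 by linarith
    have "?I (?n - 1)"
      using n2
    proof (induction rule: dec_induct)
      case base
      show ?case by (rule \<open>?I 1\<close>)
    next
      case (step s)
      show ?case by (rule \<open>\<And>s. 1 \<le> s \<Longrightarrow> s + 1 < ?n \<Longrightarrow> ?I s \<Longrightarrow> ?I (Suc s)\<close>) (use step in auto)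
    qed
    then obtain g m where g: "invertible g" "u v* g = axis ?mx 1" "lookup (gl_act f g) m \<noteq> 0"
      "\<And>j. pos j < ?n - 1 \<Longrightarrow> lookup m j < k * ?q ^ pos j" by blast
    \<comment> \<open>Only the last position can reach its bound, and that bound is the whole
      degree, so the monomial is a pure power.\<close>
    obtain j where j: "k * ?q ^ pos j \<le> lookup m j" using large[OF g(1,3)] by blast
    then have "\<not> pos j < ?n - 1" using g(4)[of j] by (meson leD)
    then have "pos j = pos i0" using pos_less_card[of j] pi0 by linarith
    then have "j = i0" by (simp add: pos_inj)
    then have mi0: "N \<le> lookup m i0" using j pi0 by (simp add: N_def)
    have hF: "homog N (gl_act f g)" unfolding N_def by (rule homog_gl_act[OF hom])
    then have mN: "mdeg m = N" using g(3) by (rule homogD)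
    have "mdeg m = lookup m i0 + (\<Sum>i\<in>UNIV - {i0}. lookup m i)" unfolding mdeg_def by (rule sum.remove) auto
    then have "lookup m i0 = N" "(\<Sum>i\<in>UNIV - {i0}. lookup m i) = 0" using mN mi0 by linarith+
    then have "m = single i0 N" by (intro poly_mapping_eqI) (auto simp: lookup_single when_def)
    then have "ev (g *v axis i0 1) f \<noteq> 0" using g(3) ev_axis[OF hF] by (simp add: ev_gl_act)
    moreover have "(g *v axis i0 1) $ i = g $ i $ i0" for i
      by (simp add: matrix_vector_mult_def axis_def if_distrib[of "\<lambda>x. _ * x"] cong: if_cong)
    ultimately have col: "g $ i0 $ i0 \<noteq> 0" "\<And>i. i \<noteq> i0 \<Longrightarrow> g $ i $ i0 = 0"
      using supp[of "g *v axis i0 1"] by auto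
    \<comment> \<open>By \<open>supp\<close> column \<open>i0\<close> of \<open>g\<close> is
      supported in row \<open>i0\<close>, so this entry is nonzero, whereas \<open>u v* g\<close> is
      the axis vector of another index.\<close>
    have "(u v* g) $ i0 = (\<Sum>i\<in>UNIV. if i = i0 then u $ i0 * g $ i0 $ i0 else 0)"
      unfolding vector_matrix_mult_def vec_lambda_beta
    proof (rule sum.cong)
      show "u $ i * g $ i $ i0 = (if i = i0 then u $ i0 * g $ i0 $ i0 else 0)" for i
        using col(2)[of i] by (cases "i = i0") (simp_all add: mult.commute)
    qed simp
    then have "(u v* g) $ i0 \<noteq> 0" using col(1) u by simp
    moreover have "?mx \<noteq> i0" using pmx pi0 n2 by auto
    ultimately show False unfolding g(2) by (simp add: axis_def)
  qed
qed

section \<open>Degree counts and a distinguished hyperplane\<close>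

lemma mdeg_TM:
  fixes k :: nat
  assumes "k \<ge> 1"
  shows "mdeg (TM CARD('k) k :: 'n::{finite,linorder} \<Rightarrow>\<^sub>0 nat) + CARD('n)
    = k * card (Mons :: ('k::{field,finite}, 'n) vec set)"
proof -
  have "mdeg (TM CARD('k) k :: 'n \<Rightarrow>\<^sub>0 nat) + CARD('n) = (\<Sum>i\<in>(UNIV :: 'n set). (k * CARD('k) ^ pos i - 1) + 1)"
    unfolding mdeg_def TM_def lookup_sum_single sum.distrib by simp
  also have "\<dots> = (\<Sum>i\<in>(UNIV :: 'n set). k * CARD('k) ^ pos i)"
    using assms by (intro sum.cong) auto
  also have "\<dots> = k * card (Mons :: ('k, 'n) vec set)"
    using sum_pos[of "\<lambda>t. k * CARD('k) ^ t", where ?'n = 'n] by (simp add: card_Mons sum_distrib_left)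
  finally show ?thesis .
qed

lemma card_Mons_split:
  "card (Mons :: ('k::{field,finite}, 'n::{finite,linorder}) vec set)
    = (\<Sum>t<CARD('n) - 1. CARD('k) ^ t) + CARD('k) ^ (CARD('n) - 1)"
proof -
  obtain m where "CARD('n) = Suc m" using not0_implies_Suc[of "CARD('n)"] by auto
  then show ?thesis by (simp add: card_Mons)
qed

text \<open>The index of position \<open>CARD('n) - 1\<close> is the smallest one, so the monic
  vectors off this hyperplane form a single block.\<close>

definition first_hyperplane :: "('k::field, 'n::{finite,linorder}) vec set" where
  "first_hyperplane = {v. v $ idx (CARD('n) - 1) = 0}"

lemma subspace_first_hyperplane: "vec.subspace first_hyperplane"
  unfolding first_hyperplane_def vec.subspace_def by simp

lemma Mons_minus_first_hyperplane:
  "Mons - first_hyperplane = (Mon (idx (CARD('n) - 1)) :: ('k::field, 'n::{finite,linorder}) vec set)"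
proof -
  let ?i0 = "idx (CARD('n) - 1) :: 'n"
  have p0: "pos ?i0 = CARD('n) - 1" by simp
  have min: "?i0 \<le> j" for j
  proof (rule ccontr)
    assume "\<not> ?i0 \<le> j"
    then have "pos ?i0 < pos j" by (intro pos_less) simp
    then show False using pos_less_card[of j] p0 by linarith
  qed
  have "i = ?i0" if "v \<in> Mon i" "v $ ?i0 \<noteq> 0" for v :: "('k, 'n) vec" and i
    using that min[of i] by (auto simp: Mon_def le_less)
  then show ?thesis unfolding first_hyperplane_def Mons_def by (auto simp: Mon_def)
qed

lemma first_hyperplane: "(first_hyperplane :: ('k::field, 'n::{finite,linorder}) vec set) \<in> hyperplanes"
proof -
  let ?i0 = "idx (CARD('n) - 1) :: 'n" and ?H = "first_hyperplane :: ('k, 'n) vec set"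
  have sp: "vec.span ?H = ?H" by (simp add: subspace_first_hyperplane)
  have notin: "axis ?i0 1 \<notin> ?H" by (simp add: first_hyperplane_def)
  have "vec.span (insert (axis ?i0 1) ?H) = UNIV"
  proof (intro equalityI subsetI UNIV_I)
    fix v :: "('k, 'n) vec"
    have "v - v $ ?i0 *s axis ?i0 1 \<in> ?H" by (simp add: first_hyperplane_def)
    then have "v - v $ ?i0 *s axis ?i0 1 \<in> vec.span ?H" by (rule vec.span_base)
    then show "v \<in> vec.span (insert (axis ?i0 1) ?H)" unfolding vec.span_breakdown_eq by blast
  qed
  then have "vec.dim (insert (axis ?i0 1) ?H) = vec.dim (UNIV :: ('k, 'n) vec set)" by (metis vec.dim_span)
  moreover have "vec.dim (UNIV :: ('k, 'n) vec set) = CARD('n)" by (rule vec_dim_card)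
  moreover have "vec.dim (insert (axis ?i0 1) ?H) = vec.dim ?H + 1"
    using notin by (simp add: vec.dim_insert sp)
  ultimately show ?thesis using subspace_first_hyperplane by (simp add: hyperplanes_def)
qed

context fq
begin

text \<open>Otherwise \<open>m\<close> lies below \<open>TM\<close>, and the complementary monomial
  has degree below the index of the operation. Multiplication by it gives a hit element with nonzero
  coefficient at \<open>TM\<close>.\<close>

lemma Hf_large:
  fixes g :: "(('k, 'n::{finite,linorder}) vec, 'n) vec"
  assumes kr: "k = CARD('k) ^ a * r" "1 \<le> r" "r \<le> CARD('k) - 1"
    and g: "invertible g" "lookup (gl_act (Hf k i0) g) m \<noteq> 0"
  shows "\<exists>j. k * CARD('k) ^ pos j \<le> lookup m j"
proof (rule ccontr)
  let ?q = "CARD('k)" and ?n = "CARD('n)" and ?S = "\<Sum>t<CARD('n) - 1. CARD('k) ^ t"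
  let ?T = "TM ?q k :: 'n \<Rightarrow>\<^sub>0 nat"
  assume "\<not> (\<exists>j. k * ?q ^ pos j \<le> lookup m j)"
  then have le: "lookup m j \<le> lookup ?T j" for j
    unfolding TM_def lookup_sum_single by (auto simp: not_le intro: Suc_leI dest: spec[of _ j])
  have k1: "k \<ge> 1" using kr by simp
  have gG: "g \<in> GLn" using g(1) by (simp add: GLn_def)
  have T: "?T = (?T - m) + m" using le by (intro poly_mapping_eqI) (simp add: lookup_add lookup_minus)
  have "mdeg m = k * ?q ^ (?n - 1)" by (rule homogD[OF homog_gl_act[OF homog_Hf[OF k1]] g(2)])
  moreover have "mdeg ?T = mdeg (?T - m) + mdeg m" using T by (metis mdeg_add)
  moreover have "mdeg ?T + ?n = k * ?S + k * ?q ^ (?n - 1)"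
    using mdeg_TM[OF k1, where ?'k = 'k and ?'n = 'n] unfolding card_Mons_split by (simp add: add_mult_distrib2)
  moreover have "?n > 0" by simp
  ultimately have N: "mdeg (?T - m) < k * ?S - (?n - 1)" by linarith
  let ?h = "single (?T - m) 1 :: ('k, 'n) sympoly"
  have "gl_act ?h (matrix_inv g) * Hf k i0 \<in> Pplus"
    by (rule Hf_hit[OF homog_gl_act[OF homog_single[OF refl]] N])
  then have "gl_act (gl_act ?h (matrix_inv g) * Hf k i0) g \<in> Pplus" by (rule Pplus_gl_act)
  then have "?h * gl_act (Hf k i0) g \<in> Pplus"
    by (simp add: gl_act_simps gl_act_gl_act GLn_inv[OF gG])
  then have "lookup (?h * gl_act (Hf k i0) g) ?T = 0" by (rule lookup_TM_Pplus[OF kr])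
  moreover have "lookup (?h * gl_act (Hf k i0) g) ((?T - m) + m) = 1 * lookup (gl_act (Hf k i0) g) m"
    by (rule lookup_single_times)
  ultimately show False using g(2) T by simp
qed

text \<open>All \<open>k\<close>-th powers of forms off the hyperplane divide \<open>Hf\<close>, and
  the degrees agree, so the quotient is a constant; it is nonzero because \<open>Hf\<close> does not
  vanish at a coordinate point.\<close>

lemma VH_first_hyperplane_hit:
  fixes h :: "('k, 'n::{finite,linorder}) sympoly"
  assumes kr: "k = CARD('k) ^ a * r" "1 \<le> r" "r \<le> CARD('k) - 1"
    and h: "homog N h" "N < k * (\<Sum>t<CARD('n) - 1. CARD('k) ^ t) - (CARD('n) - 1)"
  shows "h * VH first_hyperplane ^ k \<in> Pplus"
proof -
  let ?q = "CARD('k)" and ?i0 = "idx (CARD('n) - 1) :: 'n"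
  let ?f = "Hf k ?i0 :: ('k, 'n) sympoly" and ?V = "\<Prod>v\<in>Mon ?i0. linform v :: ('k, 'n) sympoly"
  have k1: "k \<ge> 1" using kr by simp
  note hom = homog_Hf[OF k1, of ?i0, where ?'k = 'k]
  have "linform u ^ k dvd ?f" if "u \<in> Mon ?i0" for u
  proof (rule linform_power_dvd_if_supported[OF k1 hom])
    show "\<exists>j. k * ?q ^ pos j \<le> lookup m j" if "invertible g" "lookup (gl_act ?f g) m \<noteq> 0" for g m
      by (rule Hf_large[OF kr that])
    show "y $ ?i0 \<noteq> 0 \<and> (\<forall>i. i \<noteq> ?i0 \<longrightarrow> y $ i = 0)" if "ev y ?f \<noteq> 0" for y
      using that ev_Hf[OF kr] by blast
    show "u $ ?i0 \<noteq> 0" using that by (simp add: Mon_def)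
  qed
  then have "?V ^ k dvd ?f"
  proof (intro prod_linform_power_dvd)
    have sub: "Mon ?i0 \<subseteq> (Mons :: ('k, 'n) vec set)" by (auto simp: Mons_def)
    show "w = v" if "v \<in> Mon ?i0" "w \<in> Mon ?i0" "w = c *s v" for v w :: "('k, 'n) vec" and c
      using Mons_scale[OF _ _ that(3)] that(1,2) sub by blast
    show "v \<noteq> 0" if "v \<in> Mon ?i0" for v :: "('k, 'n) vec" using Mons_neq_0 that sub by blast
  qed auto
  then obtain Q where Q: "?f = ?V ^ k * Q" by (elim dvdE)
  have "homog (k * card (Mon ?i0 :: ('k, 'n) vec set)) (?V ^ k)"
    by (intro homog_power homog_prod_linform)
  then have V: "homog (k * ?q ^ (CARD('n) - 1)) (?V ^ k)" by (simp add: card_Mon)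
  have "?f = hc (k * ?q ^ (CARD('n) - 1)) (?V ^ k * Q)"
    unfolding Q[symmetric] hc_homog[OF hom] by simp
  also have "\<dots> = ?V ^ k * hc 0 Q" unfolding hc_mult_homog[OF V] by simp
  also have "hc 0 Q = pconst (lookup (hc 0 Q) 0)" by (rule homog_0D[OF homog_hc])
  finally obtain c where c: "?f = ?V ^ k * pconst c" by blast
  have "ev (axis ?i0 1) ?f \<noteq> 0" unfolding ev_Hf[OF kr] by (simp add: axis_def)
  then have "c \<noteq> 0" unfolding c by (auto simp: ev_simps)
  obtain b where b: "VH first_hyperplane = pconst b * ?V"
    using VH_eq[OF subspace_first_hyperplane, where ?'k = 'k and ?'n = 'n] unfolding Mons_minus_first_hyperplane by blast
  have "VH first_hyperplane ^ k = pconst (b ^ k * inverse c) * ?f"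
  proof -
    have "pconst (b ^ k * inverse c) * ?f = pconst b ^ k * ?V ^ k * (pconst (inverse c) * pconst c)"
      unfolding c pconst_mult pconst_power by (simp only: ac_simps)
    also have "pconst (inverse c) * pconst c = (1 :: ('k, 'n) sympoly)" using \<open>c \<noteq> 0\<close> by (simp flip: pconst_mult)
    finally show ?thesis by (simp add: b power_mult_distrib)
  qed
  then have eq: "h * VH first_hyperplane ^ k = pconst (b ^ k * inverse c) * (h * ?f)" by (simp only: ac_simps)
  show ?thesis unfolding eq by (intro Pplus_pconst Hf_hit[OF h])
qed

text \<open>Transported from the distinguished hyperplane by a substitution, which preserves degrees
  and hit elements.\<close>

lemma VH_hit:
  fixes h :: "('k, 'n::{finite,linorder}) sympoly"
  assumes kr: "k = CARD('k) ^ a * r" "1 \<le> r" "r \<le> CARD('k) - 1"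
    and H: "H \<in> hyperplanes"
  shows "homog (CARD('k) ^ (CARD('n) - 1)) (VH H :: ('k, 'n) sympoly)"
    and "homog N h \<Longrightarrow> N < k * (\<Sum>t<CARD('n) - 1. CARD('k) ^ t) - (CARD('n) - 1) \<Longrightarrow> h * VH H ^ k \<in> Pplus"
proof -
  let ?H0 = "first_hyperplane :: ('k, 'n) vec set"
  obtain g :: "(('k, 'n) vec, 'n) vec" where g: "invertible g" "H = (\<lambda>v. v v* g) ` ?H0"
    by (rule ex_gl_hyperplane[OF first_hyperplane H])
  have gG: "g \<in> GLn" using g(1) by (simp add: GLn_def)
  obtain c where c: "c \<noteq> 0" "gl_act (VH ?H0) g = pconst c * VH H"
    using VH_gl_act[OF subspace_first_hyperplane g(1)] unfolding g(2) by blast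
  have "pconst (inverse c) * gl_act (VH ?H0) g = (pconst (inverse c) * pconst c) * VH H"
    unfolding c(2) by (simp only: mult.assoc)
  also have "\<dots> = VH H" using c(1) by (simp flip: pconst_mult)
  finally have VH: "VH H = pconst (inverse c) * gl_act (VH ?H0) g" ..
  obtain b where b: "VH ?H0 = pconst b * (\<Prod>v\<in>Mon (idx (CARD('n) - 1)). linform v)"
    using VH_eq[OF subspace_first_hyperplane, where ?'k = 'k and ?'n = 'n] unfolding Mons_minus_first_hyperplane by blast
  have "homog (CARD('k) ^ (CARD('n) - 1)) (VH ?H0)"
    unfolding b using homog_prod_linform[of "Mon (idx (CARD('n) - 1)) :: ('k, 'n) vec set" "\<lambda>v. v"]
    by (intro homog_pconst_mult) (simp add: card_Mon)
  then show "homog (CARD('k) ^ (CARD('n) - 1)) (VH H)"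
    unfolding VH by (intro homog_pconst_mult homog_gl_act)
  assume h: "homog N h" "N < k * (\<Sum>t<CARD('n) - 1. CARD('k) ^ t) - (CARD('n) - 1)"
  have "gl_act h (matrix_inv g) * VH ?H0 ^ k \<in> Pplus"
    by (rule VH_first_hyperplane_hit[OF kr homog_gl_act[OF h(1)] h(2)])
  then have "gl_act (gl_act h (matrix_inv g) * VH ?H0 ^ k) g \<in> Pplus" by (rule Pplus_gl_act)
  then have "h * gl_act (VH ?H0) g ^ k \<in> Pplus"
    by (simp add: gl_act_simps gl_act_gl_act GLn_inv[OF gG])
  then have "pconst (inverse c ^ k) * (h * gl_act (VH ?H0) g ^ k) \<in> Pplus" by (rule Pplus_pconst)
  moreover have "pconst (inverse c ^ k) * (h * gl_act (VH ?H0) g ^ k) = h * VH H ^ k"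
    unfolding VH power_mult_distrib pconst_power by (simp only: ac_simps)
  ultimately show "h * VH H ^ k \<in> Pplus" by simp
qed

lemma Iid_in_Pplus:
  fixes f :: "('k, 'n::{finite,linorder}) sympoly"
  assumes kr: "k = CARD('k) ^ a * r" "1 \<le> r" "r \<le> CARD('k) - 1"
    and d: "d + CARD('n) = k * card (Mons :: ('k, 'n) vec set)"
    and f: "f \<in> Iid k" "homog i f" "i \<le> d"
  shows "f \<in> Pplus"
proof -
  let ?M = "k * CARD('k) ^ (CARD('n) - 1)" and ?S = "\<Sum>t<CARD('n) - 1. CARD('k) ^ t"
  obtain c where c: "f = (\<Sum>H\<in>hyperplanes. c H * VH H ^ k)" using f(1) unfolding Iid_def by blast
  have "hc i (c H * VH H ^ k) \<in> Pplus" if H: "H \<in> hyperplanes" for H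
  proof -
    have "hc i (VH H ^ k * c H) = (if ?M \<le> i then VH H ^ k * hc (i - ?M) (c H) else 0)"
      by (rule hc_mult_homog[OF homog_power[OF VH_hit(1)[OF kr H]]])
    moreover have "hc (i - ?M) (c H) * VH H ^ k \<in> Pplus" if "?M \<le> i"
    proof (rule VH_hit(2)[OF kr H homog_hc])
      have "d + CARD('n) = k * ?S + ?M" unfolding d card_Mons_split by (simp add: add_mult_distrib2)
      moreover have "CARD('n) > 0" by simp
      \<comment> \<open>The cofactor has degree at most \<open>d - ?M = k * ?S - CARD('n)\<close>,
        just one below the bound of \<open>VH_hit\<close>.\<close>
      ultimately show "i - ?M < k * ?S - (CARD('n) - 1)" using that f(3) by linarith
    qed
    ultimately show ?thesis by (simp add: mult.commute Pplus_0)
  qed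
  then have "hc i f \<in> Pplus" unfolding c hc_sum by (rule Pplus_sum)
  then show ?thesis using f(2) by (simp add: hc_homog)
qed

text \<open>Both summands are graded, so each may be replaced by its component of degree
  \<open>i\<close>, and in degrees up to \<open>d\<close> the ideal consists of hit
  elements.\<close>

lemma setplus_Pplus_Iid:
  assumes kr: "k = CARD('k) ^ a * r" "1 \<le> r" "r \<le> CARD('k) - 1"
    and d: "d + CARD('n) = k * card (Mons :: ('k, 'n::{finite,linorder}) vec set)" and i: "i \<le> d"
  shows "setplus Pplus (Iid k) \<inter> Hom i = (Pplus \<inter> Hom i :: ('k, 'n) sympoly set)"
proof (intro equalityI subsetI)
  fix f :: "('k, 'n) sympoly" assume "f \<in> setplus Pplus (Iid k) \<inter> Hom i"
  then obtain P h where f: "P \<in> Pplus" "h \<in> Iid k" "f = P + h" "homog i f" unfolding setplus_def Hom_def by blast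
  have "\<exists>d. homog d s" if "s \<in> (\<lambda>H. VH H ^ k) ` (hyperplanes :: ('k, 'n) vec set set)" for s
    using that homog_power[OF VH_hit(1)[OF kr]] by blast
  then have "hc i h \<in> Iid k" using hc_span_homog f(2) unfolding Iid_eq_span by blast
  then have "hc i h \<in> Pplus" by (rule Iid_in_Pplus[OF kr d _ homog_hc i])
  then have "hc i P + hc i h \<in> Pplus" using Pplus_hc[OF f(1)] by (intro Pplus_add)
  moreover have "f = hc i P + hc i h" using f(4) unfolding hc_add[symmetric] f(3)[symmetric] by (simp add: hc_homog)
  ultimately show "f \<in> Pplus \<inter> Hom i" using f(4) by (simp add: Hom_def)
next
  fix f :: "('k, 'n) sympoly" assume "f \<in> Pplus \<inter> Hom i"
  moreover have "f = f + 0" by simp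
  ultimately show "f \<in> setplus Pplus (Iid k) \<inter> Hom i" unfolding setplus_def using Iid_0 by blast
qed

end

theorem theorem1p2:
  fixes p e n k d :: nat
    and TYPE_k :: "'k::{field,finite} itself"
    and TYPE_n :: "('n::{finite,linorder}) itself"
  assumes "prime p"
    and "CARD('k) = p ^ e"
    and "n = CARD('n)" and "n \<ge> 1"
    and "k \<ge> 1"
    and "d = k * ((CARD('k) ^ n - 1) div (CARD('k) - 1)) - n"
  shows
    \<comment> \<open>(1) vanishing above degree d\<close>
    "(\<forall>i>d. Hom i \<subseteq> (Iid k :: ('k, 'n) sympoly set))
     \<comment> \<open>(1) R^d = Sym^d / I^d is isomorphic to St_n \<otimes> Det^(k-1) (first isomorphism theorem form)\<close>
     \<and> (\<exists>\<psi> :: ('k, 'n) sympoly \<Rightarrow> ((('k, 'n) vec, 'n) vec \<Rightarrow> 'k).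
          (\<forall>f g a b. f \<in> Hom d \<and> g \<in> Hom d \<longrightarrow>
              \<psi> (pconst a * f + pconst b * g) = (\<lambda>x. a * \<psi> f x + b * \<psi> g x))
        \<and> \<psi> ` Hom d = Steinberg
        \<and> {f \<in> Hom d. \<psi> f = (\<lambda>x. 0)} = Hom d \<inter> Iid k
        \<and> (\<forall>f g. f \<in> Hom d \<and> g \<in> GLn \<longrightarrow>
              \<psi> (gl_act f g) = (\<lambda>x. det g ^ (k - 1) * ract (\<psi> f) g x)))
     \<comment> \<open>(2)\<close>
     \<and> (\<forall>a r. k = CARD('k) ^ a * r \<and> 1 \<le> r \<and> r \<le> CARD('k) - 1 \<longrightarrow>
          (\<forall>i\<le>d. \<exists>\<phi>. bij_betw \<phi> (QSym i :: ('k, 'n) sympoly set set) (QR k i)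
                 \<and> (\<forall>f\<in>Hom i. \<phi> (coset f (Pplus \<inter> Hom i)) = coset f (setplus Pplus (Iid k) \<inter> Hom i)))
        \<and> Hom d \<inter> setplus Pplus (Iid k) \<subseteq> (Iid k :: ('k, 'n) sympoly set))"
proof -
  interpret fq p e "TYPE('k)" by unfold_locales (use assms in auto)
  have q2: "CARD('k) \<ge> 2" by (rule card_field_ge_2)
  have "CARD('n) \<le> card (Mons :: ('k, 'n) vec set)"
    unfolding card_Mons by (rule le_geometric) (use q2 in simp)
  \<comment> \<open>This ensures that the subtraction in the definition of \<open>d\<close> is not
    truncated.\<close>
  then have le: "CARD('n) \<le> k * card (Mons :: ('k, 'n) vec set)"
    using mult_le_mono1[of 1 k "card (Mons :: ('k, 'n) vec set)"] assms(5) by linarith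
  have "d = k * card (Mons :: ('k, 'n) vec set) - CARD('n)"
    unfolding assms(6) assms(3) geometric_nat_div[OF q2] card_Mons ..
  then have d: "d + CARD('n) = k * card (Mons :: ('k, 'n) vec set)" using le by simp
  have "Hom i \<subseteq> (Iid k :: ('k, 'n) sympoly set)" if "i > d" for i
  proof
    fix f :: "('k, 'n) sympoly" assume "f \<in> Hom i"
    then show "f \<in> Iid k" by (intro homog_in_Iid[of i]) (use that d in \<open>simp_all add: Hom_def\<close>)
  qed
  moreover have "(\<exists>\<phi>. bij_betw \<phi> (QSym i :: ('k, 'n) sympoly set set) (QR k i)
      \<and> (\<forall>f\<in>Hom i. \<phi> (coset f (Pplus \<inter> Hom i)) = coset f (setplus Pplus (Iid k) \<inter> Hom i)))"
    if "k = CARD('k) ^ a * r \<and> 1 \<le> r \<and> r \<le> CARD('k) - 1" "i \<le> d" for a r i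
  proof -
    have eq: "setplus Pplus (Iid k) \<inter> Hom i = (Pplus \<inter> Hom i :: ('k, 'n) sympoly set)"
      using setplus_Pplus_Iid[OF _ _ _ d that(2)] that(1) by blast
    \<comment> \<open>The two quotients are by the same subspace, so the identity on cosets is the
      map induced by the projection.\<close>
    show ?thesis by (rule exI[of _ id]) (simp add: QSym_def QR_def eq)
  qed
  moreover have "Hom d \<inter> setplus Pplus (Iid k) \<subseteq> (Iid k :: ('k, 'n) sympoly set)"
    if "k = CARD('k) ^ a * r \<and> 1 \<le> r \<and> r \<le> CARD('k) - 1" for a r
    using top_degree_indecomposable[OF _ _ _ d] that by blast
  ultimately show ?thesis using top_degree_Steinberg[OF assms(5) d] by (intro conjI allI impI) blast+
qed

end
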